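(* Let $A$ be a finite-dimensional unital associative real algebra, and consider Cauchy conditions on $A^n$ induced by $A$. Let $f$ be a function from $A^n$ to $A$ which is Cauchy on an annulus (French "couronne") containing the boundary $\partial D$ of a bounded smooth domain $D$. Then $f$ extends to a Cauchy function on all of $D$.
   Context: Let $d=\dim_{\mathbb{R}}A$ and identify $A$ with $\mathbb{R}^d$ by coordinates $(x_1,\dots,x_d)$ in a basis of $A$ containing the unit. $A$-valued functions are differentiated and integrated componentwise; $\|\cdot\|$ is the Euclidean norm; $\widehat{dy_j}$ is $dy_1\wedge\dots\wedge dy_d$ with $dy_j$ omitted. Cauchy conditions on $A$ are a system of $q$ equations $\sum_{j=1}^d\frac{\partial f}{\partial x_j}a^j_m=0$, $m=1,\dots,q$, with constant coefficients $a^j_m\in A$, for functions with values in $A$. They are admissible for $A$ if they admit a Cauchy kernel, that is, if there exist $b^i_m\in A$ such that, setting $\varphi_m(x,y)=\sum_{i=1}^d b^i_m(y_i-x_i)$, for every bounded domain $G\subset\mathbb{R}^d$ with smooth boundary, every $C^1$ function $g:\overline G\to A$ satisfying the conditions on $G$, and every $x\in G$, $$g(x)=\int_{\partial G} g(y)\sum_{m=1}^q\sum_{j=1}^d a^j_m\,\frac{\varphi_m(x,y)}{\|y-x\|^d}\,(-1)^{j-1}\,\widehat{dy_j}$$ (boundary orientation on $\partial G$). Identify $A^n$ with $\mathbb{R}^{nd}$ with coordinates $x^{(l)}_j$, $1\le l\le n$, $1\le j\le d$. The Cauchy conditions on $A^n$ induced by $A$ are obtained from Cauchy conditions admissible for $A$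 by imposing them in each $A$-variable separately: $\sum_{j=1}^d\frac{\partial f}{\partial x^{(l)}_j}a^j_m=0$ for all $1\le l\le n$, $1\le m\le q$. A function on an open subset of $A^n$, with values in $A$, satisfying these induced conditions on that set is said to be Cauchy there. If $D=\{\rho<0\}$ with $\rho$ smooth, the annuli used around $\partial D$ are the shells between $\{\rho<-\varepsilon\}$ and $\{\rho<\varepsilon\}$, $\varepsilon>0$ small.
   Formalization: The formal theorem adds n ≥ 2 (for n = 1, A = ℂ, the function 1/z near the unit circle does not extend) and that the annulus is connected (for D = {1<|x|<2}, f = 0 near the inner sphere and 1 near the outer one does not extend). *)

theory Defs
  imports "HOL-Analysis.Analysis"
begin

(* The algebra A is a type of sort {real_algebra_1, euclidean_space}: Basis is the chosen basis
   of A, norm is the Euclidean norm of the coordinates in that basis, and no compatibility between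
   norm and multiplication is assumed.  A^n is 'a^'n, whose coordinate directions are axis l j
   with j in Basis. *)

section \<open>Differentiability classes\<close>

abbreviation partial :: "('a::real_normed_vector \<Rightarrow> 'b::real_normed_vector) \<Rightarrow> 'a \<Rightarrow> 'a \<Rightarrow> 'b"
  where "partial f j x \<equiv> frechet_derivative f (at x) j"

text \<open>Used for open sets only.\<close>

primrec Ck_on ::
  "nat \<Rightarrow> 'a set \<Rightarrow> ('a::euclidean_space \<Rightarrow> 'b::real_normed_vector) \<Rightarrow> bool" where
  "Ck_on 0 S f \<longleftrightarrow> continuous_on S f"
| "Ck_on (Suc k) S f \<longleftrightarrow>
     (\<forall>x\<in>S. f differentiable (at x)) \<and> (\<forall>j\<in>Basis. Ck_on k S (partial f j))"

definition smooth_on ::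
  "'a set \<Rightarrow> ('a::euclidean_space \<Rightarrow> 'b::real_normed_vector) \<Rightarrow> bool" where
  "smooth_on S f \<longleftrightarrow> (\<forall>k. Ck_on k S f)"

definition C1_closure ::
  "'a set \<Rightarrow> ('a::euclidean_space \<Rightarrow> 'b::real_normed_vector) \<Rightarrow> bool" where
  "C1_closure G g \<longleftrightarrow> continuous_on (closure G) g \<and> Ck_on 1 G g \<and>
     (\<forall>j\<in>Basis. \<exists>h. continuous_on (closure G) h \<and> (\<forall>x\<in>G. h x = partial g j x))"


section \<open>Bounded domains with smooth boundary\<close>

definition local_defining_function ::
  "'a::euclidean_space set \<Rightarrow> 'a \<Rightarrow> 'a set \<Rightarrow> ('a \<Rightarrow> real) \<Rightarrow> bool" where
  "local_defining_function G p U \<rho> \<longleftrightarrow>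
     open U \<and> p \<in> U \<and> smooth_on U \<rho> \<and> (\<forall>x\<in>U. x \<in> G \<longleftrightarrow> \<rho> x < 0) \<and>
     (\<exists>j\<in>Basis. partial \<rho> j p \<noteq> 0)"

definition bounded_smooth_domain :: "'a::euclidean_space set \<Rightarrow> bool" where
  "bounded_smooth_domain G \<longleftrightarrow>
     open G \<and> connected G \<and> G \<noteq> {} \<and> bounded G \<and>
     (\<forall>p\<in>frontier G. \<exists>U \<rho>. local_defining_function G p U \<rho>)"

definition outward_unit_normal ::
  "'a::euclidean_space set \<Rightarrow> 'a \<Rightarrow> 'a \<Rightarrow> bool" where
  "outward_unit_normal G p \<nu> \<longleftrightarrow> norm \<nu> = 1 \<and>
     (\<exists>U \<rho> c. local_defining_function G p U \<rho> \<and> c > 0 \<and>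
        (\<rho> has_derivative (\<lambda>v. c * (\<nu> \<bullet> v))) (at p))"


section \<open>Integrals of (d-1)-forms over an oriented boundary\<close>

text \<open>
  A family \<open>\<eta> y j\<close> (\<open>j \<in> Basis\<close>) stands for the form
  \<open>\<Sum>j. \<eta> y j (-1)^(j-1) dy_1 \<and> \<dots> \<and> dy_d\<close> with \<open>dy_j\<close> omitted.  Since
  \<open>(-1)^(j-1) dy_1 \<and> \<dots> \<and> dy_d\<close> (\<open>dy_j\<close> omitted) is the contraction of
  \<open>dy_1 \<and> \<dots> \<and> dy_d\<close> with the \<open>j\<close>-th basis vector, its value on \<open>w_2, \<dots>, w_d\<close> is
  \<open>det (e_j, w_2, \<dots>, w_d)\<close>.

  Boundary patches are parametrized by the coordinate hyperplane orthogonal to a basis vector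
  \<open>k\<close>; \<open>det (v, \<partial>\<gamma>)\<close> is computed by putting \<open>v\<close> at position \<open>k\<close> and \<open>\<partial>_b \<gamma>\<close> at
  position \<open>b\<close> for the other basis vectors.  Being the determinant of an endomorphism, it does
  not depend on an ordering of the basis.
\<close>

definition basis_det :: "('a::euclidean_space \<Rightarrow> 'a) \<Rightarrow> real" where
  "basis_det L = (\<Sum>p | p permutes Basis. of_int (sign p) * (\<Prod>b\<in>Basis. L b \<bullet> p b))"

definition hyperplane :: "'a::euclidean_space \<Rightarrow> 'a set" where
  "hyperplane k = {t. t \<bullet> k = 0}"

text \<open>The \<open>(d-1)\<close>-dimensional Lebesgue measure of \<open>hyperplane k\<close>; a unit point mass if \<open>d = 1\<close>.\<close>

definition hyperplane_lborel :: "'a::euclidean_space \<Rightarrow> 'a measure" where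
  "hyperplane_lborel k =
     distr (\<Pi>\<^sub>M b\<in>Basis - {k}. lborel) borel (\<lambda>\<tau>. \<Sum>b\<in>Basis - {k}. \<tau> b *\<^sub>R b)"

definition patch_det :: "'a::euclidean_space \<Rightarrow> ('a \<Rightarrow> 'a) \<Rightarrow> 'a \<Rightarrow> 'a \<Rightarrow> real" where
  "patch_det k \<gamma> t v = basis_det ((\<lambda>b. partial \<gamma> b t)(k := v))"

text \<open>
  A patch \<open>(k, s, W, \<gamma>, \<theta>)\<close> consists of an injective immersion \<open>\<gamma>\<close> of the open subset
  \<open>W \<inter> hyperplane k\<close> of \<open>hyperplane k\<close> into \<open>\<partial>G\<close> (\<open>\<gamma>\<close> is given with some smooth extension
  to \<open>W\<close>, which plays no role), a weight \<open>\<theta>\<close>, and the sign \<open>s\<close> of \<open>\<gamma>\<close> with respect to the boundary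
  orientation (outward normal first).  The sign cannot be absorbed into \<open>\<gamma>\<close> when \<open>d = 1\<close>.
\<close>

type_synonym 'a patch = "'a \<times> real \<times> 'a set \<times> ('a \<Rightarrow> 'a) \<times> ('a \<Rightarrow> real)"

fun boundary_patch :: "'a::euclidean_space set \<Rightarrow> 'a patch \<Rightarrow> bool" where
  "boundary_patch G (k, s, W, \<gamma>, \<theta>) \<longleftrightarrow>
     k \<in> Basis \<and> s \<in> {-1, 1} \<and> open W \<and> smooth_on W \<gamma> \<and>
     inj_on \<gamma> (W \<inter> hyperplane k) \<and> \<gamma> ` (W \<inter> hyperplane k) \<subseteq> frontier G \<and>
     (\<forall>t \<in> W \<inter> hyperplane k. \<exists>\<nu>. outward_unit_normal G (\<gamma> t) \<nu> \<and> s * patch_det k \<gamma> t \<nu> > 0) \<and>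
     \<theta> \<in> borel_measurable borel \<and> (\<forall>p. 0 \<le> \<theta> p) \<and>
     (\<forall>p \<in> frontier G. \<theta> p \<noteq> 0 \<longrightarrow> p \<in> \<gamma> ` (W \<inter> hyperplane k))"

fun patch_weight :: "'a patch \<Rightarrow> 'a \<Rightarrow> real" where
  "patch_weight (k, s, W, \<gamma>, \<theta>) = \<theta>"

text \<open>Finite atlases with a (measurable) subordinate partition of unity.\<close>

definition boundary_partition :: "'a::euclidean_space set \<Rightarrow> 'a patch list \<Rightarrow> bool" where
  "boundary_partition G Ps \<longleftrightarrow>
     (\<forall>P \<in> set Ps. boundary_patch G P) \<and>
     (\<forall>p \<in> frontier G. (\<Sum>P\<leftarrow>Ps. patch_weight P p) = 1)"

fun patch_integral :: "('a::euclidean_space \<Rightarrow> 'a \<Rightarrow> 'b::euclidean_space) \<Rightarrow> 'a patch \<Rightarrow> 'b" where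
  "patch_integral \<eta> (k, s, W, \<gamma>, \<theta>) =
     s *\<^sub>R (LINT t:(W \<inter> hyperplane k)|hyperplane_lborel k.
       \<theta> (\<gamma> t) *\<^sub>R (\<Sum>j\<in>Basis. patch_det k \<gamma> t j *\<^sub>R \<eta> (\<gamma> t) j))"

text \<open>The integral is the common value obtained from all atlases and partitions of unity.\<close>

definition has_boundary_integral ::
  "'a::euclidean_space set \<Rightarrow> ('a \<Rightarrow> 'a \<Rightarrow> 'b::euclidean_space) \<Rightarrow> 'b \<Rightarrow> bool" where
  "has_boundary_integral G \<eta> I \<longleftrightarrow>
     (\<exists>Ps. boundary_partition G Ps) \<and>
     (\<forall>Ps. boundary_partition G Ps \<longrightarrow> (\<Sum>P\<leftarrow>Ps. patch_integral \<eta> P) = I)"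


section \<open>Cauchy conditions\<close>

text \<open>The coefficient \<open>a^j_m\<close> is \<open>a j m\<close> with \<open>j \<in> Basis\<close> and \<open>m \<in> {1..q}\<close>.\<close>

definition satisfies_cauchy_conditions ::
  "nat \<Rightarrow> ('a \<Rightarrow> nat \<Rightarrow> 'a) \<Rightarrow> 'a set \<Rightarrow>
   ('a::{real_algebra_1, euclidean_space} \<Rightarrow> 'a) \<Rightarrow> bool" where
  "satisfies_cauchy_conditions q a G g \<longleftrightarrow>
     (\<forall>x\<in>G. \<forall>m\<in>{1..q}. (\<Sum>j\<in>Basis. partial g j x * a j m) = 0)"

definition kernel_phi ::
  "('a \<Rightarrow> nat \<Rightarrow> 'a) \<Rightarrow> nat \<Rightarrow> 'a \<Rightarrow> 'a::{real_algebra_1, euclidean_space} \<Rightarrow> 'a" where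
  "kernel_phi b m x y = (\<Sum>i\<in>Basis. ((y - x) \<bullet> i) *\<^sub>R b i m)"

definition admissible_cauchy_conditions ::
  "nat \<Rightarrow> ('a::{real_algebra_1, euclidean_space} \<Rightarrow> nat \<Rightarrow> 'a) \<Rightarrow> bool" where
  "admissible_cauchy_conditions q a \<longleftrightarrow>
     (\<exists>b :: 'a \<Rightarrow> nat \<Rightarrow> 'a. \<forall>G g. \<forall>x\<in>G.
        bounded_smooth_domain G \<and> C1_closure G g \<and> satisfies_cauchy_conditions q a G g \<longrightarrow>
        has_boundary_integral G
          (\<lambda>y j. g y * (\<Sum>m=1..q. a j m * (kernel_phi b m x y /\<^sub>R norm (y - x) ^ DIM('a))))
          (g x))"

definition cauchy_on ::
  "nat \<Rightarrow> ('a \<Rightarrow> nat \<Rightarrow> 'a) \<Rightarrow> ('a ^ 'n) set \<Rightarrow>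
   ('a::{real_algebra_1, euclidean_space} ^ 'n \<Rightarrow> 'a) \<Rightarrow> bool" where
  "cauchy_on q a U f \<longleftrightarrow> Ck_on 1 U f \<and>
     (\<forall>x\<in>U. \<forall>l. \<forall>m\<in>{1..q}. (\<Sum>j\<in>Basis. partial f (axis l j) x * a j m) = 0)"

definition annulus :: "('a \<Rightarrow> real) \<Rightarrow> real \<Rightarrow> 'a set" where
  "annulus \<rho> \<epsilon> = {x. - \<epsilon> < \<rho> x \<and> \<rho> x < \<epsilon>}"

end

theory Submission
  imports Defs
begin

text \<open>
  Write \<open>D\<^sub>l\<^sub>,\<^sub>m f\<close> for the left-hand side of the \<open>m\<close>-th condition in the \<open>l\<close>-th variable.

  \<^emph>\<open>The conditions factor the Laplacian.\<close>  The Cauchy formula is used only for the constant function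
  1, the centre of an ellipsoid and its boundary.  It says that the integral of a form built from the
  coefficients \<open>\<Sum>m. a j m * b i m\<close> is the same for all ellipsoids, and comparing ellipsoids stretched
  along two orthogonal directions shows that the symmetric part of this matrix of coefficients is a
  scalar matrix (\<open>kernel_form_diag_eq\<close>).  After rescaling \<open>b\<close> to \<open>\<beta>\<close>, applying the conditions, then
  multiplying by \<open>\<beta>\<close> and differentiating once more gives the Laplacian in one variable
  (\<open>dirac_pair\<close>, \<open>admissible_dirac_pair\<close>).  Only this identity is used afterwards.

  \<^emph>\<open>Regularity.\<close>  Hence a Cauchy function has the mean value property for radial weights
  (\<open>cauchy_mean_value\<close>); being of class \<open>C\<^sup>1\<close> is enough for the argument.  Differentiating the mean
  value formula gives smoothness (\<open>cauchy_smooth\<close>), bounds for the derivatives that are strong enough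
  for the Taylor series to converge, and so unique continuation (\<open>cauchy_unique_continuation\<close>).

  \<^emph>\<open>Extension.\<close>  Let \<open>v\<close> be \<open>f\<close> multiplied by a function of \<open>\<rho>\<close> that vanishes well inside \<open>D\<close> and is 1
  near and outside the boundary.  Then \<open>D\<^sub>l\<^sub>,\<^sub>m v\<close> has compact support in \<open>D\<close>.  Convolution with the Cauchy
  kernel in one single variable \<open>l0\<close> produces \<open>u\<close> with \<open>D\<^sub>l\<^sub>,\<^sub>m u = D\<^sub>l\<^sub>,\<^sub>m v\<close> for all \<open>l\<close> and \<open>m\<close>
  (\<open>cauchy_solve\<close>), so \<open>v - u\<close> is Cauchy on all of \<open>D\<close>.  Moreover \<open>u\<close> vanishes on every slice
  parallel to the \<open>l0\<close>-axis that misses the support.  As there is a second variable, such slices pass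
  through the annulus near a boundary point of \<open>D\<close> that is extreme in the direction of that variable;
  there \<open>v - u = f\<close>, and unique continuation gives \<open>v - u = f\<close> on the whole connected annulus.
\<close>

section \<open>Functions of class \<open>C^k\<close>\<close>

lemma partialI: "(f has_derivative D) (at x) \<Longrightarrow> partial f v x = D v"
  using frechet_derivative_at by metis

lemma has_derivative_partial:
  "f differentiable (at x) \<Longrightarrow> (f has_derivative (\<lambda>v. partial f v x)) (at x)"
  by (simp add: frechet_derivative_works)

lemma partial_expand:
  fixes f :: "'a::euclidean_space \<Rightarrow> 'b::real_normed_vector"
  assumes "f differentiable (at x)"
  shows "partial f v x = (\<Sum>j\<in>Basis. (v \<bullet> j) *\<^sub>R partial f j x)"
proof -
  have "linear (\<lambda>v. partial f v x)"
    using has_derivative_partial[OF assms] has_derivative_linear by blast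
  then have "partial f (\<Sum>j\<in>Basis. (v \<bullet> j) *\<^sub>R j) x = (\<Sum>j\<in>Basis. (v \<bullet> j) *\<^sub>R partial f j x)"
    by (simp add: linear_sum linear_scale)
  then show ?thesis by (simp add: euclidean_representation)
qed

lemma partial_transform:
  assumes "f differentiable (at x)" "open S" "x \<in> S" "\<And>y. y \<in> S \<Longrightarrow> f y = g y"
  shows "partial f v x = partial g v x"
  using frechet_derivative_transform_within_open[OF assms] by simp

lemma differentiable_transform_open:
  assumes "f differentiable (at x)" "open S" "x \<in> S" "\<And>y. y \<in> S \<Longrightarrow> f y = g y"
  shows "g differentiable (at x)"
  using assms has_derivative_transform_within_open unfolding differentiable_def by blast

lemma C1_iff:
  "Ck_on 1 S f \<longleftrightarrow> (\<forall>x\<in>S. f differentiable (at x)) \<and> (\<forall>j\<in>Basis. continuous_on S (partial f j))"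
  by simp

lemma C1_differentiable: "Ck_on 1 S f \<Longrightarrow> x \<in> S \<Longrightarrow> f differentiable (at x)"
  by simp

lemma C1_continuous: "Ck_on 1 S f \<Longrightarrow> continuous_on S f"
  by (simp add: differentiable_imp_continuous_within continuous_at_imp_continuous_on)

lemma C1_partial_continuous: 
  fixes f :: "'a::euclidean_space \<Rightarrow> 'b::real_normed_vector"
  assumes "Ck_on 1 S f"
  shows "continuous_on S (partial f v)"
proof -
  have "continuous_on S (\<lambda>x. \<Sum>j\<in>Basis. (v \<bullet> j) *\<^sub>R partial f j x)"
    using assms by (intro continuous_intros) (auto simp: C1_iff)
  then show ?thesis
    using partial_expand[of f _ v] assms by (simp cong: continuous_on_cong)
qed

lemma C1I:
  assumes "\<And>x. x \<in> S \<Longrightarrow> (f has_derivative D x) (at x)"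
    and "\<And>v. v \<in> Basis \<Longrightarrow> continuous_on S (\<lambda>x. D x v)"
  shows "Ck_on 1 S f"
proof -
  have "continuous_on S (partial f v)" if "v \<in> Basis" for v
    using assms(2)[OF that] partialI[OF assms(1), of _ v] by (simp cong: continuous_on_cong)
  then show ?thesis using assms(1) unfolding C1_iff differentiable_def by blast
qed

lemma Ck_subset: "Ck_on k T f \<Longrightarrow> S \<subseteq> T \<Longrightarrow> Ck_on k S f"
proof (induction k arbitrary: f)
  case 0
  then show ?case by (simp add: continuous_on_subset)
next
  case (Suc k)
  then show ?case by (metis Ck_on.simps(2) subsetD)
qed

lemma Ck_cong: "Ck_on k S f \<Longrightarrow> open S \<Longrightarrow> (\<And>x. x \<in> S \<Longrightarrow> f x = g x) \<Longrightarrow> Ck_on k S g"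
proof (induction k arbitrary: f g)
  case 0
  then show ?case by (simp cong: continuous_on_cong)
next
  case (Suc k)
  have "Ck_on k S (partial g j)" if "j \<in> Basis" for j
  proof (rule Suc.IH[of "partial f j"])
    fix x assume "x \<in> S"
    then show "partial f j x = partial g j x"
      using partial_transform Suc.prems by (metis Ck_on.simps(2))
  qed (use Suc.prems that in auto)
  moreover have "g differentiable (at x)" if "x \<in> S" for x
    using differentiable_transform_open[OF _ Suc.prems(2) that] Suc.prems that by auto
  ultimately show ?case by simp
qed

lemma Ck_Un: "Ck_on k S f \<Longrightarrow> Ck_on k T f \<Longrightarrow> open S \<Longrightarrow> open T \<Longrightarrow> Ck_on k (S \<union> T) f"
proof (induction k arbitrary: f)
  case 0
  then show ?case by (simp add: continuous_on_open_Un)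
next
  case (Suc k)
  then show ?case by auto
qed

lemma Ck_Suc_imp:
  fixes f :: "'a::euclidean_space \<Rightarrow> 'b::real_normed_vector"
  shows "Ck_on (Suc k) S f \<Longrightarrow> Ck_on k S f"
proof (induction k arbitrary: f)
  case 0
  then show ?case using C1_continuous[of S f] by simp
next
  case (Suc k)
  then show ?case by (metis Ck_on.simps(2))
qed

lemma Ck_le:
  fixes f :: "'a::euclidean_space \<Rightarrow> 'b::real_normed_vector"
  assumes "Ck_on k S f" "m \<le> k"
  shows "Ck_on m S f"
  using assms(2,1) by (induction rule: dec_induct) (auto dest: Ck_Suc_imp simp del: Ck_on.simps)

lemma Ck_const: "Ck_on k S (\<lambda>x. c)"
proof (induction k arbitrary: c)
  case 0
  then show ?case by simp
next
  case (Suc k)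
  have "partial (\<lambda>x. c) j = (\<lambda>x. 0)" for j
    by (auto simp: fun_eq_iff intro!: partialI derivative_eq_intros)
  then show ?case using Suc by simp
qed

lemma Ck_bounded_linear: 
  assumes "bounded_linear h" "open S"
  shows "Ck_on k S f \<Longrightarrow> Ck_on k S (\<lambda>x. h (f x))"
proof (induction k arbitrary: f)
  case 0
  then show ?case using assms by (simp add: bounded_linear.continuous_on)
next
  case (Suc k)
  have *: "((\<lambda>x. h (f x)) has_derivative (\<lambda>v. h (partial f v x))) (at x)" if "x \<in> S" for x
    by (rule bounded_linear.has_derivative[OF assms(1) has_derivative_partial]) (use Suc.prems that in simp)
  have "Ck_on k S (partial (\<lambda>x. h (f x)) j)" if "j \<in> Basis" for j
  proof (rule Ck_cong[OF _ assms(2)])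
    show "Ck_on k S (\<lambda>x. h (partial f j x))" using Suc that by simp
  qed (simp add: partialI[OF *])
  then show ?case using * by (auto simp: differentiable_def)
qed

lemma Ck_add:
  fixes f g :: "'a::euclidean_space \<Rightarrow> 'b::real_normed_vector"
  assumes "open S"
  shows "Ck_on k S f \<Longrightarrow> Ck_on k S g \<Longrightarrow> Ck_on k S (\<lambda>x. f x + g x)"
proof (induction k arbitrary: f g)
  case 0
  then show ?case by (simp add: continuous_on_add)
next
  case (Suc k)
  have *: "((\<lambda>x. f x + g x) has_derivative (\<lambda>v. partial f v x + partial g v x)) (at x)"
    if "x \<in> S" for x
    using Suc.prems that by (intro derivative_intros has_derivative_partial) auto
  have "Ck_on k S (partial (\<lambda>x. f x + g x) j)" if "j \<in> Basis" for j
  proof (rule Ck_cong[OF _ assms])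
    show "Ck_on k S (\<lambda>x. partial f j x + partial g j x)" using Suc that by simp
  qed (simp add: partialI[OF *])
  then show ?case using * by (auto simp: differentiable_def)
qed

lemma Ck_sum:
  fixes f :: "'i \<Rightarrow> 'a::euclidean_space \<Rightarrow> 'b::real_normed_vector"
  assumes "open S" "\<And>i. i \<in> I \<Longrightarrow> Ck_on k S (f i)"
  shows "Ck_on k S (\<lambda>x. \<Sum>i\<in>I. f i x)"
  using assms(2) by (induction I rule: infinite_finite_induct) (auto intro!: Ck_const Ck_add assms(1))

lemma Ck_scaleR:
  fixes f :: "'a::euclidean_space \<Rightarrow> real" and g :: "'a::euclidean_space \<Rightarrow> 'b::real_normed_vector"
  assumes "open S"
  shows "Ck_on k S f \<Longrightarrow> Ck_on k S g \<Longrightarrow> Ck_on k S (\<lambda>x. f x *\<^sub>R g x)"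
proof (induction k arbitrary: f g)
  case 0
  then show ?case by (simp add: continuous_on_scaleR)
next
  case (Suc k)
  have *: "((\<lambda>x. f x *\<^sub>R g x) has_derivative (\<lambda>v. f x *\<^sub>R partial g v x + partial f v x *\<^sub>R g x)) (at x)"
    if "x \<in> S" for x
    using Suc.prems that by (intro derivative_intros has_derivative_partial) auto
  have "Ck_on k S (partial (\<lambda>x. f x *\<^sub>R g x) j)" if "j \<in> Basis" for j
  proof (rule Ck_cong[OF _ assms])
    show "Ck_on k S (\<lambda>x. f x *\<^sub>R partial g j x + partial f j x *\<^sub>R g x)"
      using Suc.IH Ck_Suc_imp[OF Suc.prems(1)] Ck_Suc_imp[OF Suc.prems(2)] Suc.prems that
      by (intro Ck_add assms) auto
  qed (simp add: partialI[OF *])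
  then show ?case using * by (auto simp: differentiable_def)
qed

lemma Ck_diff:
  fixes f g :: "'a::euclidean_space \<Rightarrow> 'b::real_normed_vector"
  assumes "open S" "Ck_on k S f" "Ck_on k S g"
  shows "Ck_on k S (\<lambda>x. f x - g x)"
  using Ck_add[OF assms(1,2) Ck_bounded_linear[OF bounded_linear_minus[OF bounded_linear_ident] assms(1,3)]]
  by simp

lemma Ck_linear:
  fixes h :: "'a::euclidean_space \<Rightarrow> 'b::real_normed_vector"
  assumes "bounded_linear h"
  shows "Ck_on k S h"
proof (cases k)
  case 0
  then show ?thesis using assms by (simp add: linear_continuous_on)
next
  case (Suc m)
  have *: "(h has_derivative h) (at x)" for x using assms by (rule bounded_linear_imp_has_derivative)
  have "partial h j = (\<lambda>x. h j)" for j using partialI[OF *] by auto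
  then show ?thesis using Suc * Ck_const by (auto simp: differentiable_def)
qed

lemma Ck_inverse:
  fixes f :: "'a::euclidean_space \<Rightarrow> real"
  assumes "open S" "\<And>x. x \<in> S \<Longrightarrow> f x \<noteq> 0"
  shows "Ck_on k S f \<Longrightarrow> Ck_on k S (\<lambda>x. inverse (f x))"
proof (induction k)
  case 0
  then show ?case using assms by (simp add: continuous_on_inverse)
next
  case (Suc k)
  have *: "((\<lambda>x. inverse (f x)) has_derivative (\<lambda>v. - (inverse (f x) * partial f v x * inverse (f x)))) (at x)"
    if "x \<in> S" for x
    using Suc.prems that assms by (intro derivative_intros has_derivative_partial) auto
  have I: "Ck_on k S (\<lambda>x. inverse (f x))" using Suc.IH Ck_Suc_imp[OF Suc.prems] by blast
  have "Ck_on k S (partial (\<lambda>x. inverse (f x)) j)" if "j \<in> Basis" for j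
  proof (rule Ck_cong[OF _ assms(1)])
    have "Ck_on k S (\<lambda>x. inverse (f x) *\<^sub>R inverse (f x) *\<^sub>R - (partial f j x))"
      using Suc.prems that by (intro Ck_scaleR I assms Ck_bounded_linear[of uminus]
        bounded_linear_minus bounded_linear_ident) auto
    then show "Ck_on k S (\<lambda>x. inverse (f x) *\<^sub>R inverse (f x) *\<^sub>R - (partial f j x))" .
  qed (simp add: partialI[OF *])
  then show ?case using * by (auto simp: differentiable_def)
qed

text \<open>
  Truncated powers provide cutoff functions of every finite class \<open>C^k\<close>; their derivatives are again
  truncated powers.
\<close>
definition pospow :: "nat \<Rightarrow> real \<Rightarrow> real" where
  "pospow n t = (if 0 < t then t ^ n else 0)"

lemma pospow_deriv: "((pospow (Suc (Suc n))) has_real_derivative (real (n + 2) * pospow (Suc n) t)) (at t)"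
proof (cases t "0::real" rule: linorder_cases)
  case less
  have "((\<lambda>x. 0) has_real_derivative 0) (at t)" by simp
  then have "(pospow (Suc (Suc n)) has_real_derivative 0) (at t)"
    by (rule has_field_derivative_transform_within_open[where S = "{..<0}"]) 
      (use less in \<open>auto simp: pospow_def\<close>)
  then show ?thesis using less by (simp add: pospow_def)
next
  case greater
  have "((\<lambda>x. x ^ (Suc (Suc n))) has_real_derivative (real (n + 2) * t ^ Suc n)) (at t)"
    using DERIV_pow[of "Suc (Suc n)" t] by simp
  then have "(pospow (Suc (Suc n)) has_real_derivative (real (n + 2) * t ^ Suc n)) (at t)"
    by (rule has_field_derivative_transform_within_open[where S = "{0<..}"]) 
      (use greater in \<open>auto simp: pospow_def\<close>)
  then show ?thesis using greater by (simp add: pospow_def)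
next
  case equal
  have "(\<lambda>h. pospow (Suc (Suc n)) h / h) \<midarrow>0\<rightarrow> 0"
  proof (rule Lim_null_comparison)
    show "\<forall>\<^sub>F h in at 0. norm (pospow (Suc (Suc n)) h / h) \<le> \<bar>h\<bar> ^ Suc n"
      by (intro always_eventually) (auto simp: pospow_def not_less intro!: mult_nonpos_nonneg)
    have "((\<lambda>h::real. \<bar>h\<bar> ^ Suc n) \<longlongrightarrow> \<bar>0\<bar> ^ Suc n) (at 0)" by (intro tendsto_intros)
    then show "((\<lambda>h::real. \<bar>h\<bar> ^ Suc n) \<longlongrightarrow> 0) (at 0)" by simp
  qed
  then show ?thesis using equal unfolding DERIV_def by (simp add: pospow_def)
qed

lemma Ck_pospow:
  fixes f :: "'a::euclidean_space \<Rightarrow> real"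
  assumes "open S"
  shows "Ck_on k S f \<Longrightarrow> Ck_on k S (\<lambda>x. pospow (Suc k) (f x))"
proof (induction k arbitrary: f)
  case 0
  have "isCont (pospow 1) t" for t
  proof -
    have "pospow 1 = (\<lambda>t. max 0 t)" by (auto simp: pospow_def fun_eq_iff)
    then show ?thesis by (simp add: continuous_max)
  qed
  then have "continuous_on UNIV (pospow 1)" by (simp add: continuous_at_imp_continuous_on)
  then have "continuous_on S (\<lambda>x. pospow 1 (f x))"
    using 0 continuous_on_compose2[of UNIV "pospow 1" S f] by auto
  then show ?case by simp
next
  case (Suc k)
  have *: "((\<lambda>x. pospow (Suc (Suc k)) (f x)) has_derivative
      (\<lambda>v. (real (k + 2) * pospow (Suc k) (f x)) *\<^sub>R partial f v x)) (at x)"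
    if "x \<in> S" for x
    using DERIV_compose_FDERIV[OF pospow_deriv has_derivative_partial[of f x]] Suc.prems that
    by (simp add: mult.commute)
  have "Ck_on k S (partial (\<lambda>x. pospow (Suc (Suc k)) (f x)) j)" if "j \<in> Basis" for j
  proof (rule Ck_cong[OF _ assms])
    show "Ck_on k S (\<lambda>x. (real (k + 2) *\<^sub>R pospow (Suc k) (f x)) *\<^sub>R partial f j x)"
      using Suc.prems that Suc.IH[OF Ck_Suc_imp[OF Suc.prems]]
      by (intro Ck_scaleR assms Ck_const) auto
  qed (simp add: partialI[OF *])
  then show ?case using * by (auto simp: differentiable_def)
qed

section \<open>Integrals of translates\<close>

lemma open_translates_in:
  fixes g :: "'c::euclidean_space \<Rightarrow> 'e::euclidean_space"
  assumes "open S" "continuous_on (cbox lo hi) g"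
  shows "open {x. \<forall>y\<in>cbox lo hi. x + g y \<in> S}"
  unfolding open_contains_ball
proof
  fix x assume x: "x \<in> {x. \<forall>y\<in>cbox lo hi. x + g y \<in> S}"
  have "compact ((\<lambda>y. x + g y) ` cbox lo hi)"
    by (intro compact_continuous_image continuous_intros assms compact_cbox)
  moreover have "(\<lambda>y. x + g y) ` cbox lo hi \<subseteq> S" using x by auto
  ultimately obtain \<epsilon> where \<epsilon>: "\<epsilon> > 0" "(\<Union>z\<in>(\<lambda>y. x + g y) ` cbox lo hi. ball z \<epsilon>) \<subseteq> S"
    using compact_subset_open_imp_ball_epsilon_subset assms(1) by metis
  have "ball x \<epsilon> \<subseteq> {x. \<forall>y\<in>cbox lo hi. x + g y \<in> S}"
  proof (intro subsetI CollectI ballI)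
    fix z y assume "z \<in> ball x \<epsilon>" "y \<in> cbox lo hi"
    then have "z + g y \<in> ball (x + g y) \<epsilon>" by (simp add: dist_norm)
    then show "z + g y \<in> S" using \<epsilon>(2) \<open>y \<in> cbox lo hi\<close> by blast
  qed
  then show "\<exists>e>0. ball x e \<subseteq> {x. \<forall>y\<in>cbox lo hi. x + g y \<in> S}"
    using \<epsilon>(1) by blast
qed

lemma continuous_on_translate:
  fixes g :: "'c::euclidean_space \<Rightarrow> 'e::euclidean_space" and f :: "'e \<Rightarrow> 'v::euclidean_space"
  assumes "continuous_on S f" "continuous_on (cbox lo hi) g" "continuous_on (cbox lo hi) k"
    and "\<forall>y\<in>cbox lo hi. x + g y \<in> S"
  shows "continuous_on (cbox lo hi) (\<lambda>y. k y *\<^sub>R f (x + g y))"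
  using assms(4) by (intro continuous_intros assms continuous_on_compose2[OF assms(1)]) auto

lemma integrable_translate:
  fixes g :: "'c::euclidean_space \<Rightarrow> 'e::euclidean_space" and f :: "'e \<Rightarrow> 'v::euclidean_space"
  assumes "continuous_on S f" "continuous_on (cbox lo hi) g" "continuous_on (cbox lo hi) k"
    and "\<forall>y\<in>cbox lo hi. x + g y \<in> S"
  shows "(\<lambda>y. k y *\<^sub>R f (x + g y)) integrable_on cbox lo hi"
  using integrable_continuous[OF continuous_on_translate[OF assms]] .

text \<open>
  Every integral depending on a parameter below is a weighted integral of translates of a \<open>C\<^sup>1\<close>
  function.  By compactness of the box, the translates stay in \<open>S\<close> when \<open>x0\<close> is moved a little.
\<close>
lemma has_derivative_integral_translates:
  fixes g :: "'c::euclidean_space \<Rightarrow> 'e::euclidean_space" and f :: "'e \<Rightarrow> 'v::euclidean_space"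
  assumes S: "open S" and f: "Ck_on 1 S f"
    and g: "continuous_on (cbox lo hi) g" and k: "continuous_on (cbox lo hi) k"
    and x0: "\<forall>y\<in>cbox lo hi. x0 + g y \<in> S"
  shows "((\<lambda>x. integral (cbox lo hi) (\<lambda>y. k y *\<^sub>R f (x + g y))) has_derivative
    (\<lambda>v. integral (cbox lo hi) (\<lambda>y. k y *\<^sub>R partial f v (x0 + g y)))) (at x0)"
proof -
  obtain \<epsilon> where \<epsilon>: "\<epsilon> > 0" "ball x0 \<epsilon> \<subseteq> {x. \<forall>y\<in>cbox lo hi. x + g y \<in> S}"
    using openE[OF open_translates_in[OF S g], of x0] x0 by blast
  define fx where "fx = (\<lambda>x y. Blinfun (\<lambda>v. k y *\<^sub>R partial f v (x + g y)))"
  have fd: "f differentiable (at (x + g y))" if "x \<in> ball x0 \<epsilon>" "y \<in> cbox lo hi" for x y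
    using that \<epsilon> f C1_differentiable by blast
  have fx: "blinfun_apply (fx x y) = (\<lambda>v. k y *\<^sub>R partial f v (x + g y))"
    if "x \<in> ball x0 \<epsilon>" "y \<in> cbox lo hi" for x y
    unfolding fx_def
    by (intro bounded_linear_Blinfun_apply bounded_linear_scaleR_right[THEN bounded_linear_compose]
      has_derivative_bounded_linear[OF has_derivative_partial] fd that)
  have c: "continuous_on (ball x0 \<epsilon> \<times> cbox lo hi) (\<lambda>p. k (snd p) *\<^sub>R partial f v (fst p + g (snd p)))" for v
    using \<epsilon>(2)
    by (intro continuous_intros continuous_on_compose2[OF k] continuous_on_compose2[OF g]
        continuous_on_compose2[OF C1_partial_continuous[OF f]]) auto
  have cont: "continuous_on (ball x0 \<epsilon> \<times> cbox lo hi) (\<lambda>(x, t). fx x t)"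
  proof (rule continuous_on_blinfun_componentwise)
    fix v :: 'e
    show "continuous_on (ball x0 \<epsilon> \<times> cbox lo hi) (\<lambda>p. blinfun_apply (case p of (x, t) \<Rightarrow> fx x t) v)"
      using c[of v] by (rule continuous_on_eq) (auto simp: fx)
  qed
  have "((\<lambda>x. integral (cbox lo hi) (\<lambda>y. k y *\<^sub>R f (x + g y))) has_derivative
      integral (cbox lo hi) (fx x0)) (at x0 within ball x0 \<epsilon>)"
  proof (rule leibniz_rule[OF _ _ cont])
    fix x t assume xt: "x \<in> ball x0 \<epsilon>" "t \<in> cbox lo hi"
    have sh: "((\<lambda>x. x + g t) has_derivative (\<lambda>v. v)) (at x)"
      by (auto intro!: derivative_eq_intros)
    have "((\<lambda>x. k t *\<^sub>R f (x + g t)) has_derivative blinfun_apply (fx x t)) (at x)"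
      unfolding fx[OF xt]
      using has_derivative_scaleR_right[OF has_derivative_compose[OF sh has_derivative_partial[OF fd[OF xt]]]] by simp
    then show "((\<lambda>x. k t *\<^sub>R f (x + g t)) has_derivative blinfun_apply (fx x t)) (at x within ball x0 \<epsilon>)"
      by (rule has_derivative_at_withinI)
  next
    fix x assume "x \<in> ball x0 \<epsilon>"
    then show "(\<lambda>y. k y *\<^sub>R f (x + g y)) integrable_on cbox lo hi"
      using integrable_translate[OF C1_continuous[OF f] g k] \<epsilon>(2) by auto
  qed (use \<epsilon>(1) in auto)
  moreover have "blinfun_apply (integral (cbox lo hi) (fx x0)) =
      (\<lambda>v. integral (cbox lo hi) (\<lambda>y. k y *\<^sub>R partial f v (x0 + g y)))"
  proof
    fix v
    have "continuous_on (cbox lo hi) (fx x0)"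
    proof -
      have "continuous_on (cbox lo hi) (\<lambda>t. (x0, t))"
        by (rule continuous_on_Pair[OF continuous_on_const continuous_on_id])
      then show ?thesis
        using continuous_on_compose2[OF cont] \<epsilon>(1) by fastforce
    qed
    then have "integral (cbox lo hi) ((\<lambda>b. blinfun_apply b v) \<circ> fx x0) = blinfun_apply (integral (cbox lo hi) (fx x0)) v"
      by (intro integral_linear integrable_continuous blinfun.bounded_linear_left)
    moreover have "integral (cbox lo hi) ((\<lambda>b. blinfun_apply b v) \<circ> fx x0) = integral (cbox lo hi) (\<lambda>y. k y *\<^sub>R partial f v (x0 + g y))"
      using \<epsilon>(1) by (intro integral_cong) (simp add: fx)
    ultimately show "blinfun_apply (integral (cbox lo hi) (fx x0)) v =
        integral (cbox lo hi) (\<lambda>y. k y *\<^sub>R partial f v (x0 + g y))" by simp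
  qed
  ultimately have "((\<lambda>x. integral (cbox lo hi) (\<lambda>y. k y *\<^sub>R f (x + g y))) has_derivative
      (\<lambda>v. integral (cbox lo hi) (\<lambda>y. k y *\<^sub>R partial f v (x0 + g y)))) (at x0 within ball x0 \<epsilon>)"
    by simp
  moreover have "at x0 within ball x0 \<epsilon> = at x0"
    by (rule at_within_open) (use \<epsilon>(1) in auto)
  ultimately show ?thesis by (simp only:)
qed

lemma continuous_on_integral_translates:
  fixes g :: "'c::euclidean_space \<Rightarrow> 'e::euclidean_space" and f :: "'e \<Rightarrow> 'v::euclidean_space"
  assumes f: "continuous_on S f" and g: "continuous_on (cbox lo hi) g" and k: "continuous_on (cbox lo hi) k"
  shows "continuous_on {x. \<forall>y\<in>cbox lo hi. x + g y \<in> S} (\<lambda>x. integral (cbox lo hi) (\<lambda>y. k y *\<^sub>R f (x + g y)))"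
proof (rule integral_continuous_on_param)
  show "continuous_on ({x. \<forall>y\<in>cbox lo hi. x + g y \<in> S} \<times> cbox lo hi) (\<lambda>(x, y). k y *\<^sub>R f (x + g y))"
    unfolding split_def
    by (intro continuous_intros continuous_on_compose2[OF k] continuous_on_compose2[OF g]
        continuous_on_compose2[OF f]) auto
qed

lemma C1_integral_translates:
  fixes g :: "'c::euclidean_space \<Rightarrow> 'e::euclidean_space" and f :: "'e \<Rightarrow> 'v::euclidean_space"
  assumes S: "open S" and f: "Ck_on 1 S f"
    and g: "continuous_on (cbox lo hi) g" and k: "continuous_on (cbox lo hi) k"
  shows "Ck_on 1 {x. \<forall>y\<in>cbox lo hi. x + g y \<in> S} (\<lambda>x. integral (cbox lo hi) (\<lambda>y. k y *\<^sub>R f (x + g y)))"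
  by (rule C1I[OF has_derivative_integral_translates[OF S f g k]])
    (auto intro!: continuous_on_integral_translates C1_partial_continuous f g k)

text \<open>
  By the fundamental theorem of calculus, \<open>f (z + t b) - f z\<close> is \<open>t\<close> times the average of the \<open>b\<close>-derivative over
  the segment.  Differentiating this in the direction \<open>a\<close>, dividing by \<open>t\<close> and letting \<open>t\<close> tend to 0
  turns the left-hand side into the \<open>b\<close>-derivative of the \<open>a\<close>-derivative.
\<close>
lemma partial_commute:
  fixes f :: "'e::euclidean_space \<Rightarrow> 'v::euclidean_space"
  assumes S: "open S" and f: "Ck_on 2 S f" and x: "x \<in> S" and b: "b \<in> Basis"
  shows "partial (partial f a) b x = partial (partial f b) a x"
proof -
  have f1: "Ck_on 1 S f" using f Ck_le[of 2 S f 1] by simp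
  have fb: "Ck_on 1 S (partial f b)" using f b by (simp add: numeral_2_eq_2)
  have fa: "partial f a differentiable (at x)"
  proof (rule differentiable_transform_open[OF _ S x])
    show "(\<lambda>x. \<Sum>j\<in>Basis. (a \<bullet> j) *\<^sub>R partial f j x) differentiable (at x)"
      using f x by (intro derivative_intros differentiable_sum differentiable_scaleR differentiable_const) (auto simp: numeral_2_eq_2)
  qed (use partial_expand f1 C1_differentiable in metis)
  define G where "G = (\<lambda>t. integral (cbox 0 1) (\<lambda>s. 1 *\<^sub>R partial (partial f b) a (x + (s * t) *\<^sub>R b)))"
  obtain r where r: "r > 0" "ball x r \<subseteq> S" using S x open_contains_ball by blast
  have nb: "norm b = 1" using b by simp
  have inS: "z + (s * t) *\<^sub>R b \<in> S" if "norm (z - x) < r / 2" "\<bar>t\<bar> < r / 2" "s \<in> cbox 0 1" for s t z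
  proof -
    have "\<bar>s * t\<bar> \<le> \<bar>t\<bar>" using that(3) by (auto simp: abs_mult intro!: mult_left_le_one_le)
    moreover have "norm (z + (s * t) *\<^sub>R b - x) \<le> norm (z - x) + norm ((s * t) *\<^sub>R b)"
      using norm_triangle_ineq[of "z - x" "(s * t) *\<^sub>R b"] by (simp add: algebra_simps)
    ultimately have "norm (z + (s * t) *\<^sub>R b - x) < r" using that nb by simp
    then show ?thesis using r(2) by (auto simp: dist_norm norm_minus_commute)
  qed
  have ftc: "f (z + t *\<^sub>R b) - f z = t *\<^sub>R integral (cbox 0 1) (\<lambda>s. 1 *\<^sub>R partial f b (z + (s * t) *\<^sub>R b))"
    if "norm (z - x) < r / 2" "\<bar>t\<bar> < r / 2" for z t
  proof -
    have "((\<lambda>s. t *\<^sub>R partial f b (z + (s * t) *\<^sub>R b)) has_integral (f (z + (1 * t) *\<^sub>R b) - f (z + (0 * t) *\<^sub>R b))) {0..1}"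
    proof (rule fundamental_theorem_of_calculus)
      fix s :: real assume s: "s \<in> {0..1}"
      have d: "f differentiable (at (z + (s * t) *\<^sub>R b))" using C1_differentiable[OF f1] inS[OF that] s by auto
      have i: "((\<lambda>s. z + (s * t) *\<^sub>R b) has_derivative (\<lambda>h. (h * t) *\<^sub>R b)) (at s within {0..1})"
        by (auto intro!: derivative_eq_intros)
      have "((\<lambda>s. f (z + (s * t) *\<^sub>R b)) has_derivative (\<lambda>h. partial f ((h * t) *\<^sub>R b) (z + (s * t) *\<^sub>R b))) (at s within {0..1})"
        using has_derivative_compose[OF i has_derivative_partial[OF d]] .
      moreover have "partial f ((h * t) *\<^sub>R b) (z + (s * t) *\<^sub>R b) = h *\<^sub>R t *\<^sub>R partial f b (z + (s * t) *\<^sub>R b)" for h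
        using linear_scale[OF has_derivative_linear[OF has_derivative_partial[OF d]]] by (metis scaleR_scaleR)
      ultimately show "((\<lambda>s. f (z + (s * t) *\<^sub>R b)) has_vector_derivative t *\<^sub>R partial f b (z + (s * t) *\<^sub>R b)) (at s within {0..1})"
        by (simp add: has_vector_derivative_def)
    qed simp
    then show ?thesis by (simp add: integral_unique flip: integral_cmul)
  qed
  have 1: "partial f a (x + t *\<^sub>R b) - partial f a x = t *\<^sub>R G t" if t: "\<bar>t\<bar> < r / 2" for t
  proof -
    have xr: "norm (x - x) < r / 2" using r by simp
    have "((\<lambda>z. t *\<^sub>R integral (cbox 0 1) (\<lambda>s. 1 *\<^sub>R partial f b (z + (s * t) *\<^sub>R b))) has_derivative
       (\<lambda>v. t *\<^sub>R integral (cbox 0 1) (\<lambda>s. 1 *\<^sub>R partial (partial f b) v (x + (s * t) *\<^sub>R b)))) (at x)"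
      using inS[OF xr t]
      by (intro derivative_intros has_derivative_integral_translates[OF S fb]) (auto intro!: continuous_intros)
    then have A: "((\<lambda>z. f (z + t *\<^sub>R b) - f z) has_derivative
       (\<lambda>v. t *\<^sub>R integral (cbox 0 1) (\<lambda>s. 1 *\<^sub>R partial (partial f b) v (x + (s * t) *\<^sub>R b)))) (at x)"
      by (rule has_derivative_transform_within_open[OF _ open_ball[of x "r/2"]])
        (use r ftc t in \<open>auto simp: dist_norm norm_minus_commute\<close>)
    have B: "((\<lambda>z. f (z + t *\<^sub>R b) - f z) has_derivative (\<lambda>v. partial f v (x + t *\<^sub>R b) - partial f v x)) (at x)"
    proof -
      have d: "f differentiable (at (x + t *\<^sub>R b))" using C1_differentiable[OF f1] inS[OF xr t, of 1] by auto
      have sh: "((\<lambda>z. z + t *\<^sub>R b) has_derivative (\<lambda>v. v)) (at x)" by (auto intro!: derivative_eq_intros)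
      show ?thesis
        using has_derivative_diff[OF has_derivative_compose[OF sh has_derivative_partial[OF d]]
          has_derivative_partial[OF C1_differentiable[OF f1 x]]] .
    qed
    show ?thesis using fun_cong[OF has_derivative_unique[OF B A], of a] unfolding G_def by simp
  qed
  have "continuous_on (ball 0 (r/2)) G" unfolding G_def
  proof (rule integral_continuous_on_param)
    show "continuous_on (ball 0 (r / 2) \<times> cbox 0 1) (\<lambda>(t, s). 1 *\<^sub>R partial (partial f b) a (x + (s * t) *\<^sub>R b))"
      unfolding split_def using r(1)
      by (intro continuous_intros continuous_on_compose2[OF C1_partial_continuous[OF fb, of a]])
        (auto intro!: inS)
  qed
  then have G: "(G \<longlongrightarrow> G 0) (at 0)"
    using r(1) by (simp add: continuous_on_eq_continuous_at isCont_def)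
  have G0: "G 0 = partial (partial f b) a x" by (simp add: G_def)
  have "((\<lambda>t. partial f a (x + t *\<^sub>R b)) has_vector_derivative G 0) (at 0)"
  proof -
    have "((\<lambda>t. (1 / norm t) *\<^sub>R (partial f a (x + t *\<^sub>R b) - (partial f a (x + 0 *\<^sub>R b) + (t - 0) *\<^sub>R G 0))) \<longlongrightarrow> 0) (at 0)"
    proof (rule Lim_null_comparison)
      show "((\<lambda>t. norm (G t - G 0)) \<longlongrightarrow> 0) (at 0)"
        using G by (simp add: LIM_zero tendsto_norm_zero)
      have "norm ((1 / norm t) *\<^sub>R (partial f a (x + t *\<^sub>R b) - (partial f a (x + 0 *\<^sub>R b) + (t - 0) *\<^sub>R G 0))) \<le> norm (G t - G 0)"
        if t: "t \<noteq> 0" "dist t 0 < r / 2" for t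
      proof -
        have "partial f a (x + t *\<^sub>R b) - (partial f a (x + 0 *\<^sub>R b) + (t - 0) *\<^sub>R G 0) = t *\<^sub>R (G t - G 0)"
          using 1[of t] t by (simp add: algebra_simps)
        then show ?thesis using t by simp
      qed
      then show "\<forall>\<^sub>F t in at 0. norm ((1 / norm t) *\<^sub>R (partial f a (x + t *\<^sub>R b) - (partial f a (x + 0 *\<^sub>R b) + (t - 0) *\<^sub>R G 0))) \<le> norm (G t - G 0)"
        unfolding eventually_at using r(1) by (intro exI[of _ "r/2"]) auto
    qed
    then show ?thesis
      unfolding has_vector_derivative_def has_derivative_at2 by (simp add: bounded_linear_scaleR_left)
  qed
  moreover have "((\<lambda>t. partial f a (x + t *\<^sub>R b)) has_vector_derivative partial (partial f a) b x) (at 0)"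
  proof -
    have i: "((\<lambda>t. x + t *\<^sub>R b) has_derivative (\<lambda>h. h *\<^sub>R b)) (at 0)" by (auto intro!: derivative_eq_intros)
    have "partial f a differentiable (at (x + 0 *\<^sub>R b))" using fa by simp
    from has_derivative_compose[OF i has_derivative_partial[OF this]]
    show ?thesis unfolding has_vector_derivative_def
      using linear_scale[OF has_derivative_linear[OF has_derivative_partial[OF fa]]] by simp
  qed
  ultimately show ?thesis using vector_derivative_unique_at G0 by metis
qed

section \<open>Integration by parts on a box\<close>

abbreviation std_box :: "'c::euclidean_space set" where
  "std_box \<equiv> cbox (- (3 *\<^sub>R One)) (3 *\<^sub>R One)"

lemma norm_le_std_box: "norm y \<le> 3 \<Longrightarrow> y \<in> (std_box :: 'c::euclidean_space set)"
  using order_trans[OF Basis_le_norm, of _ y 3] by (auto simp: mem_box abs_le_iff minus_le_iff)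

text \<open>
  The integral of a translate of \<open>w\<close> does not depend on the translation, and its derivative with respect
  to the translation is the integral of the derivative.
\<close>
lemma integral_partial_eq_0:
  fixes w :: "'c::euclidean_space \<Rightarrow> 'v::euclidean_space"
  assumes w: "Ck_on 1 UNIV w" and z: "\<And>y. 2 \<le> norm y \<Longrightarrow> w y = 0"
  shows "integral std_box (partial w e) = 0"
proof -
  let ?I = "\<lambda>x. integral std_box (\<lambda>y. 1 *\<^sub>R w (x + y))"
  have "(?I has_derivative (\<lambda>v. integral std_box (\<lambda>y. 1 *\<^sub>R partial w v (0 + y)))) (at 0)"
    by (rule has_derivative_integral_translates[OF open_UNIV w]) (auto intro!: continuous_intros)
  moreover have "(?I has_derivative (\<lambda>v. 0)) (at 0)"
  proof (rule has_derivative_transform_within_open[OF has_derivative_const[of "integral UNIV w"] open_ball[of 0 1]])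
    fix x :: 'c assume x: "x \<in> ball 0 1"
    have io: "w integrable_on cbox a b" for a b
      using integrable_continuous C1_continuous[OF w] continuous_on_subset by blast
    have "(w has_integral integral (cbox (- (3 *\<^sub>R One) + x) (3 *\<^sub>R One + x)) w) UNIV"
    proof (rule has_integral_on_superset[OF integrable_integral[OF io]])
      fix y assume y: "y \<notin> cbox (- (3 *\<^sub>R One) + x) (3 *\<^sub>R One + x)"
      then have "y - x \<notin> std_box" by (force simp: mem_box algebra_simps)
      then have "norm (y - x) > 3" using norm_le_std_box by force
      then show "w y = 0" using x norm_triangle_ineq4[of y x] by (intro z) auto
    qed simp
    moreover have "integral (cbox (- (3 *\<^sub>R One) + x) (3 *\<^sub>R One + x)) w = ?I x"
      using integral_shift_cbox_plus[of "- (3 *\<^sub>R One)" "3 *\<^sub>R One" w x] by (simp add: o_def add.commute)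
    ultimately show "integral UNIV w = ?I x" by (simp add: integral_unique)
  qed auto
  ultimately have "(\<lambda>v. integral std_box (\<lambda>y. 1 *\<^sub>R partial w v (0 + y))) = (\<lambda>v. 0)"
    using has_derivative_unique by blast
  then show ?thesis by (metis (no_types, lifting) add_0 integral_cong scaleR_one)
qed

text \<open>
  The function \<open>f\<close> is defined only near the translated box, but the product with the compactly supported \<open>h\<close>
  is of class \<open>C\<^sup>1\<close> everywhere.
\<close>
lemma integral_by_parts:
  fixes L :: "'c::euclidean_space \<Rightarrow> 'e::euclidean_space" and f :: "'e \<Rightarrow> 'v::euclidean_space"
    and h :: "'c \<Rightarrow> real"
  assumes S: "open S" and f: "Ck_on 1 S f" and L: "linear L"
    and x: "\<forall>y\<in>std_box. x + L y \<in> S"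
    and h: "Ck_on 1 UNIV h" and z: "\<And>y. 2 \<le> norm y \<Longrightarrow> h y = 0"
  shows "integral std_box (\<lambda>y. h y *\<^sub>R partial f (L e) (x + L y)) =
    - integral std_box (\<lambda>y. partial h e y *\<^sub>R f (x + L y))"
proof -
  let ?w = "\<lambda>y. h y *\<^sub>R f (x + L y)"
  let ?D = "\<lambda>y e. h y *\<^sub>R partial f (L e) (x + L y) + partial h e y *\<^sub>R f (x + L y)"
  have bL: "bounded_linear L" using L linear_conv_bounded_linear by blast
  have o: "open {y::'c. 2 < norm y}" by (rule open_Collect_less) (auto intro!: continuous_intros)
  have h0: "partial h v y = 0" if "2 < norm y" for y v
  proof -
    have "((\<lambda>y. 0::real) has_derivative (\<lambda>v. 0)) (at y)" by simp
    then have "(h has_derivative (\<lambda>v. 0)) (at y)"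
      by (rule has_derivative_transform_within_open[OF _ o]) (use that z in auto)
    then show ?thesis by (rule partialI)
  qed
  have d: "(?w has_derivative ?D y) (at y)" for y
  proof (cases "y \<in> std_box")
    case True
    have i: "((\<lambda>y. x + L y) has_derivative L) (at y)"
      using bounded_linear_imp_has_derivative[OF bL] by (auto intro!: derivative_eq_intros)
    have fd: "f differentiable (at (x + L y))" using C1_differentiable[OF f] x True by blast
    show ?thesis
      by (rule has_derivative_scaleR[OF has_derivative_partial has_derivative_compose[OF i has_derivative_partial[OF fd]]])
        (use h in \<open>auto simp: C1_iff\<close>)
  next
    case False
    then have y: "2 < norm y" using norm_le_std_box[of y] by force
    have "(?w has_derivative (\<lambda>v. 0)) (at y)"
      by (rule has_derivative_transform_within_open[OF has_derivative_const[of 0] o]) (use y z in auto)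
    then show ?thesis using y z[of y] h0[of y] by simp
  qed
  have c1: "continuous_on std_box (\<lambda>y. h y *\<^sub>R partial f (L e) (x + L y))" for e
    by (intro continuous_on_translate[OF C1_partial_continuous[OF f]] x linear_continuous_on bL
       continuous_on_subset[OF C1_continuous[OF h]]) auto
  have c2: "continuous_on std_box (\<lambda>y. partial h e y *\<^sub>R f (x + L y))" for e
    by (intro continuous_on_translate[OF C1_continuous[OF f]] x linear_continuous_on bL
       continuous_on_subset[OF C1_partial_continuous[OF h]]) auto
  have w: "Ck_on 1 UNIV ?w"
  proof (rule C1I[OF d])
    fix v :: 'c
    have "continuous_on (box (- (3 *\<^sub>R One)) (3 *\<^sub>R One)) (\<lambda>y. ?D y v)"
      by (rule continuous_on_subset[OF continuous_on_add[OF c1 c2] box_subset_cbox])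
    moreover have "continuous_on {y. 2 < norm y} (\<lambda>y. ?D y v)"
      by (rule continuous_on_eq[of _ "\<lambda>y. 0"]) (auto simp: h0 z)
    ultimately have "continuous_on (box (- (3 *\<^sub>R One)) (3 *\<^sub>R One) \<union> {y. 2 < norm y}) (\<lambda>y. ?D y v)"
      by (rule continuous_on_open_Un[OF open_box o])
    moreover have "box (- (3 *\<^sub>R One)) (3 *\<^sub>R One) \<union> {y::'c. 2 < norm y} = UNIV"
    proof -
      have "y \<in> box (- (3 *\<^sub>R One)) (3 *\<^sub>R One)" if "norm y \<le> 2" for y :: 'c
        unfolding mem_box
      proof
        fix i :: 'c assume i: "i \<in> Basis"
        have "\<bar>y \<bullet> i\<bar> \<le> 2" using order_trans[OF Basis_le_norm[OF i] that] .
        then show "- (3 *\<^sub>R One) \<bullet> i < y \<bullet> i \<and> y \<bullet> i < 3 *\<^sub>R One \<bullet> i" using i by (simp add: abs_le_iff)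
      qed
      then show ?thesis by force
    qed
    ultimately show "continuous_on UNIV (\<lambda>y. ?D y v)" by simp
  qed
  have "integral std_box (\<lambda>y. ?D y e) = 0"
    using integral_partial_eq_0[OF w, of e] z partialI[OF d] by simp
  moreover have "integral std_box (\<lambda>y. ?D y e) = integral std_box (\<lambda>y. h y *\<^sub>R partial f (L e) (x + L y)) +
     integral std_box (\<lambda>y. partial h e y *\<^sub>R f (x + L y))"
    by (intro integral_add integrable_continuous c1 c2)
  ultimately show ?thesis by (simp add: eq_neg_iff_add_eq_0)
qed

section \<open>A radial shell function\<close>

definition shell_profile :: "real \<Rightarrow> real" where
  "shell_profile r = pospow 2 (r - 1) * pospow 2 (4 - r)"

text \<open>
  A radial weight supported in the shell \<open>1 \<le> norm y \<le> 2\<close>.  That it vanishes for \<open>norm y < 1\<close> gives the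
  averages over \<open>x + s y\<close> finite range: for large \<open>s\<close> they do not see a given compact set any more.
\<close>
definition shell :: "'c::euclidean_space \<Rightarrow> real" where
  "shell y = shell_profile (y \<bullet> y)"

text \<open>
  A compactly supported function whose gradient at \<open>y\<close> is \<open>shell y *\<^sub>R y\<close>; the constant of integration
  makes it vanish outside the ball of radius 2.
\<close>
definition shell_potential :: "'c::euclidean_space \<Rightarrow> real" where
  "shell_potential y = (integral {-1..y \<bullet> y} shell_profile - integral {-1..4} shell_profile) / 2"

lemma shell_profile_eq_0: "r \<le> 1 \<or> 4 \<le> r \<Longrightarrow> shell_profile r = 0"
  by (auto simp: shell_profile_def pospow_def)

lemma shell_nonneg: "0 \<le> shell y"
  by (simp add: shell_def shell_profile_def pospow_def)

lemma shell_eq_0: "norm y \<le> 1 \<or> 2 \<le> norm y \<Longrightarrow> shell y = 0"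
proof -
  assume "norm y \<le> 1 \<or> 2 \<le> norm y"
  then have "(norm y)\<^sup>2 \<le> 1\<^sup>2 \<or> 2\<^sup>2 \<le> (norm y)\<^sup>2"
    by (metis norm_ge_zero power_mono zero_le_numeral)
  then show ?thesis by (auto simp: shell_def dot_square_norm intro!: shell_profile_eq_0)
qed

lemma Ck_inner_self: "Ck_on k S (\<lambda>y::'c::euclidean_space. y \<bullet> y)" if "open S"
proof -
  have "Ck_on k S (\<lambda>y::'c. \<Sum>b\<in>Basis. (y \<bullet> b) *\<^sub>R (y \<bullet> b))"
    by (intro Ck_sum Ck_scaleR that Ck_linear bounded_linear_inner_left)
  then show ?thesis by (simp add: euclidean_inner[symmetric])
qed

lemma C1_shell: "Ck_on 1 UNIV (shell :: 'c::euclidean_space \<Rightarrow> real)"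
proof -
  have "Ck_on 1 UNIV (\<lambda>y::'c. pospow (Suc 1) (y \<bullet> y - 1) *\<^sub>R pospow (Suc 1) (4 - y \<bullet> y))"
    by (intro Ck_scaleR Ck_pospow Ck_diff Ck_const Ck_inner_self open_UNIV)
  then show ?thesis by (simp add: shell_def[abs_def] shell_profile_def numeral_2_eq_2)
qed

lemma continuous_shell: "continuous_on S shell"
  using continuous_on_subset[OF C1_continuous[OF C1_shell]] by blast

lemma has_derivative_inner_self: "((\<lambda>y::'c::euclidean_space. y \<bullet> y) has_derivative (\<lambda>v. 2 * (y \<bullet> v))) (at y)"
  by (auto intro!: derivative_eq_intros simp: inner_commute)

lemma has_derivative_shell:
  obtains d where "\<And>y::'c::euclidean_space. (shell has_derivative (\<lambda>v. d (y \<bullet> y) * (y \<bullet> v))) (at y)"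
proof -
  have p: "(pospow 2 has_real_derivative 2 * pospow 1 t) (at t)" for t
    using pospow_deriv[of 0 t] by (simp add: numeral_2_eq_2)
  define d where "d = (\<lambda>r. 2 * pospow 1 (r - 1) * pospow 2 (4 - r) - pospow 2 (r - 1) * (2 * pospow 1 (4 - r)))"
  have "(shell_profile has_real_derivative d r) (at r)" for r
    unfolding shell_profile_def[abs_def] d_def
    by (rule derivative_eq_intros DERIV_chain2[OF p] refl | simp add: algebra_simps)+
  then have "(shell has_derivative (\<lambda>v. (2 * d (y \<bullet> y)) * (y \<bullet> v))) (at y)" for y :: 'c
    using DERIV_compose_FDERIV[OF _ has_derivative_inner_self, of shell_profile "d (y \<bullet> y)" y]
    by (simp add: shell_def[abs_def] algebra_simps)
  then show ?thesis using that[of "\<lambda>r. 2 * d r"] by blast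
qed

lemma C1_shell_coord: "Ck_on 1 UNIV (\<lambda>y::'c::euclidean_space. shell y * (y \<bullet> e))"
proof -
  have "Ck_on 1 UNIV (\<lambda>y::'c. shell y *\<^sub>R (y \<bullet> e))"
    by (rule Ck_scaleR[OF open_UNIV C1_shell Ck_linear[OF bounded_linear_inner_left]])
  then show ?thesis by simp
qed

text \<open>
  The vector field with components \<open>shell y * (y \<bullet> e)\<close> is a gradient field because \<open>shell\<close> is radial,
  so its Jacobian is symmetric.
\<close>
lemma partial_shell_coord_commute:
  "partial (\<lambda>y::'c::euclidean_space. shell y * (y \<bullet> e)) v y = partial (\<lambda>y. shell y * (y \<bullet> v)) e y"
proof -
  obtain d where d: "\<And>y::'c. (shell has_derivative (\<lambda>v. d (y \<bullet> y) * (y \<bullet> v))) (at y)"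
    using has_derivative_shell by blast
  have p: "partial (\<lambda>y::'c. shell y * (y \<bullet> e)) v y = shell y * (v \<bullet> e) + d (y \<bullet> y) * (y \<bullet> v) * (y \<bullet> e)" for e v
    by (rule partialI[where D = "\<lambda>v. shell y * (v \<bullet> e) + d (y \<bullet> y) * (y \<bullet> v) * (y \<bullet> e)"])
      (intro has_derivative_mult d bounded_linear_imp_has_derivative bounded_linear_inner_left)
  show ?thesis unfolding p by (simp add: inner_commute[of v e])
qed

lemma has_derivative_shell_potential:
  "(shell_potential has_derivative (\<lambda>v. shell y * (y \<bullet> v))) (at (y::'c::euclidean_space))"
proof -
  have c: "continuous_on {-1..y \<bullet> y + 1} shell_profile"
  proof -
    have "pospow 2 = (\<lambda>t. (max 0 t) ^ 2)" by (auto simp: pospow_def fun_eq_iff)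
    then show ?thesis unfolding shell_profile_def[abs_def] by (auto intro!: continuous_intros)
  qed
  have r: "-1 < y \<bullet> y" "-1 \<le> y \<bullet> y"
    using less_le_trans[OF _ inner_ge_zero[of y], of "-1"] order_trans[OF _ inner_ge_zero[of y], of "-1"] by auto
  have "((\<lambda>u. integral {-1..u} shell_profile) has_real_derivative shell_profile (y \<bullet> y)) (at (y \<bullet> y) within {-1..y \<bullet> y + 1})"
    by (rule integral_has_real_derivative[OF c]) (use r in simp)
  moreover have "at (y \<bullet> y) within {-1..y \<bullet> y + 1} = at (y \<bullet> y)"
    by (rule at_within_interior) (use r in simp)
  ultimately have "((\<lambda>u. integral {-1..u} shell_profile) has_real_derivative shell_profile (y \<bullet> y)) (at (y \<bullet> y))"
    by simp
  then have "((\<lambda>u. (integral {-1..u} shell_profile - integral {-1..4} shell_profile) / 2) has_real_derivative shell_profile (y \<bullet> y) / 2) (at (y \<bullet> y))"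
    by (auto intro!: derivative_eq_intros)
  from DERIV_compose_FDERIV[OF this has_derivative_inner_self]
  show ?thesis by (simp add: shell_potential_def[abs_def] shell_def algebra_simps)
qed

lemma partial_shell_potential: "partial shell_potential v y = shell y * (y \<bullet> v)"
  by (rule partialI[OF has_derivative_shell_potential])

lemma C1_shell_potential: "Ck_on 1 UNIV (shell_potential :: 'c::euclidean_space \<Rightarrow> real)"
  by (rule C1I[OF has_derivative_shell_potential]) (intro continuous_intros continuous_shell)

lemma shell_potential_eq_0: "2 \<le> norm y \<Longrightarrow> shell_potential y = 0"
proof -
  assume "2 \<le> norm y"
  then have 4: "4 \<le> y \<bullet> y" using power_mono[of 2 "norm y" 2] by (simp add: dot_square_norm)
  have "(shell_profile has_integral integral {-1..4} shell_profile) {-1..4}"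
  proof (rule integrable_integral[OF integrable_continuous_real])
    have "pospow 2 = (\<lambda>t. (max 0 t) ^ 2)" by (auto simp: pospow_def fun_eq_iff)
    then show "continuous_on {-1..4} shell_profile"
      unfolding shell_profile_def[abs_def] by (auto intro!: continuous_intros)
  qed
  then have "(shell_profile has_integral integral {-1..4} shell_profile) {-1..y \<bullet> y}"
  proof -
    assume h: "(shell_profile has_integral integral {-1..4} shell_profile) {-1..4}"
    have "((\<lambda>r. if r \<in> {-1..4} then shell_profile r else 0) has_integral integral {-1..4} shell_profile) {-1..y \<bullet> y}"
      using has_integral_restrict[of "{-1..4}" "{-1..y \<bullet> y}" shell_profile] 4 h by auto
    then show ?thesis
      by (rule has_integral_eq[rotated]) (auto simp: shell_profile_eq_0)
  qed
  then show ?thesis by (simp add: shell_potential_def integral_unique)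
qed

lemma shell_mass_pos: "0 < integral (std_box :: 'c::euclidean_space set) shell"
proof -
  obtain b :: 'c where b: "b \<in> Basis" using nonempty_Basis by blast
  have i: "0 \<le> integral (std_box :: 'c set) shell"
    by (rule integral_nonneg) (auto intro!: integrable_continuous continuous_shell shell_nonneg)
  have z: "(3/2) *\<^sub>R b \<in> std_box" "shell ((3/2) *\<^sub>R b) \<noteq> 0"
    using b by (auto intro!: norm_le_std_box simp: shell_def shell_profile_def pospow_def dot_square_norm power2_eq_square)
  have "integral (std_box :: 'c set) shell \<noteq> 0"
  proof
    assume "integral (std_box :: 'c set) shell = 0"
    then have "\<forall>y\<in>(std_box::'c set). shell y = 0"
      by (subst (asm) integral_cbox_eq_0_iff) (auto intro!: continuous_shell shell_nonneg simp: box_ne_empty)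
    then show False using z by blast
  qed
  then show ?thesis using i by simp
qed

text \<open>
  The inner integral on the right is the derivative with respect to \<open>s\<close> of the average of \<open>f\<close> over
  the shell of radius \<open>s\<close>; at \<open>s = 0\<close> this average is \<open>f x\<close> times the mass of the shell.
\<close>
lemma radial_ftc:
  fixes f :: "'e::euclidean_space \<Rightarrow> 'v::euclidean_space" and L :: "'c::euclidean_space \<Rightarrow> 'e"
  assumes f: "Ck_on 1 S f" and L: "linear L" and \<delta>: "0 \<le> \<delta>"
    and x: "\<And>s y. s \<in> {0..\<delta>} \<Longrightarrow> y \<in> std_box \<Longrightarrow> x + s *\<^sub>R L y \<in> S"
  shows "integral std_box (\<lambda>y. shell y *\<^sub>R f (x + \<delta> *\<^sub>R L y)) - integral std_box (shell :: 'c \<Rightarrow> real) *\<^sub>R f x =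
    integral {0..\<delta>} (\<lambda>s. integral std_box (\<lambda>y. \<Sum>e\<in>Basis. (shell y * (y \<bullet> e)) *\<^sub>R partial f (L e) (x + s *\<^sub>R L y)))"
proof -
  have bL: "bounded_linear L" using L linear_conv_bounded_linear by blast
  let ?g = "\<lambda>s y. \<Sum>e\<in>Basis. (shell y * (y \<bullet> e)) *\<^sub>R partial f (L e) (x + s *\<^sub>R L y)"
  have c: "continuous_on (cbox (0, - (3 *\<^sub>R One)) (\<delta>, 3 *\<^sub>R One)) (\<lambda>(s, y). ?g s y)"
    unfolding split_def
    by (intro continuous_intros continuous_on_compose2[OF C1_partial_continuous[OF f]]
        continuous_on_compose2[OF continuous_shell[of UNIV]] linear_continuous_on_compose[OF _ L])
      (use x in \<open>auto simp: cbox_Pair_eq\<close>)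
  have "integral {0..\<delta>} (\<lambda>s. integral std_box (?g s)) = integral std_box (\<lambda>y. integral {0..\<delta>} (\<lambda>s. ?g s y))"
    using integral_swap_continuous[OF c] by simp
  also have "\<dots> = integral std_box (\<lambda>y. shell y *\<^sub>R f (x + \<delta> *\<^sub>R L y) - shell y *\<^sub>R f x)"
  proof (rule integral_cong)
    fix y :: 'c assume y: "y \<in> std_box"
    have "((\<lambda>s. ?g s y) has_integral (shell y *\<^sub>R f (x + \<delta> *\<^sub>R L y) - shell y *\<^sub>R f (x + 0 *\<^sub>R L y))) {0..\<delta>}"
    proof (rule fundamental_theorem_of_calculus[OF \<delta>])
      fix s assume s: "s \<in> {0..\<delta>}"
      have d: "f differentiable (at (x + s *\<^sub>R L y))" using C1_differentiable[OF f x[OF s y]] .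
      have i: "((\<lambda>s. x + s *\<^sub>R L y) has_derivative (\<lambda>h. h *\<^sub>R L y)) (at s within {0..\<delta>})"
        by (auto intro!: derivative_eq_intros)
      have lin: "linear (\<lambda>v. partial f v (x + s *\<^sub>R L y))"
        using has_derivative_linear[OF has_derivative_partial[OF d]] .
      have "((\<lambda>s. shell y *\<^sub>R f (x + s *\<^sub>R L y)) has_derivative (\<lambda>h. shell y *\<^sub>R partial f (h *\<^sub>R L y) (x + s *\<^sub>R L y))) (at s within {0..\<delta>})"
        using has_derivative_scaleR_right[OF has_derivative_compose[OF i has_derivative_partial[OF d]]] .
      moreover have "shell y *\<^sub>R partial f (h *\<^sub>R L y) (x + s *\<^sub>R L y) = h *\<^sub>R ?g s y" for h
      proof -
        have "L y = (\<Sum>e\<in>Basis. (y \<bullet> e) *\<^sub>R L e)"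
          by (subst euclidean_representation[symmetric, of y]) (simp only: linear_sum[OF L] linear_scale[OF L])
        then have "partial f (L y) z = (\<Sum>e\<in>Basis. (y \<bullet> e) *\<^sub>R partial f (L e) z)"
          if z: "linear (\<lambda>v. partial f v z)" for z
          using arg_cong[of _ _ "\<lambda>v. partial f v z"] by (simp add: linear_sum[OF z] linear_scale[OF z])
        note this[OF lin]
        then have "shell y *\<^sub>R partial f (L y) (x + s *\<^sub>R L y) = ?g s y"
          by (simp add: scaleR_sum_right)
        then show ?thesis using linear_scale[OF lin, of h "L y"] by (metis scaleR_left_commute)
      qed
      ultimately show "((\<lambda>s. shell y *\<^sub>R f (x + s *\<^sub>R L y)) has_vector_derivative ?g s y) (at s within {0..\<delta>})"
        by (simp only: has_vector_derivative_def)
    qed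
    then show "integral {0..\<delta>} (\<lambda>s. ?g s y) = shell y *\<^sub>R f (x + \<delta> *\<^sub>R L y) - shell y *\<^sub>R f x"
      by (simp add: integral_unique)
  qed
  also have "\<dots> = integral std_box (\<lambda>y. shell y *\<^sub>R f (x + \<delta> *\<^sub>R L y)) - integral std_box (\<lambda>y::'c. shell y *\<^sub>R f x)"
  proof (rule Henstock_Kurzweil_Integration.integral_diff)
    show "(\<lambda>y. shell y *\<^sub>R f (x + \<delta> *\<^sub>R L y)) integrable_on std_box"
      by (rule integrable_translate[OF C1_continuous[OF f]
            continuous_on_scaleR[OF continuous_on_const linear_continuous_on[OF bL]] continuous_shell])
        (use x \<delta> in auto)
    show "(\<lambda>y::'c. shell y *\<^sub>R f x) integrable_on std_box"
      by (intro integrable_continuous continuous_intros continuous_shell)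
  qed
  also have "integral std_box (\<lambda>y::'c. shell y *\<^sub>R f x) = integral std_box (shell::'c \<Rightarrow> real) *\<^sub>R f x"
    using integral_linear[OF integrable_continuous[OF continuous_shell] bounded_linear_scaleR_left[of "f x"]]
    by (simp add: o_def)
  finally show ?thesis by simp
qed


section \<open>The algebraic identity and the mean value property\<close>

text \<open>
  Partial derivatives commute, so only the symmetric part of \<open>\<Sum>m. a i m * \<beta> j m\<close> matters when the
  operators with coefficients \<open>a\<close> and \<open>\<beta>\<close> are composed: the identity says that the composition is the
  Laplacian, as for the Dirac operator and its conjugate.
\<close>
definition dirac_pair :: "nat \<Rightarrow> ('a::{real_algebra_1, euclidean_space} \<Rightarrow> nat \<Rightarrow> 'a) \<Rightarrow> ('a \<Rightarrow> nat \<Rightarrow> 'a) \<Rightarrow> bool" where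
  "dirac_pair q a \<beta> \<longleftrightarrow> (\<forall>i\<in>Basis. \<forall>j\<in>Basis.
     (\<Sum>m=1..q. a i m * \<beta> j m + a j m * \<beta> i m) = (if i = j then 2 else 0))"

lemma dirac_pair_contract:
  fixes F :: "'a::{real_algebra_1, euclidean_space} \<Rightarrow> 'a \<Rightarrow> 'a"
  assumes "dirac_pair q a \<beta>" and sym: "\<And>j k. j \<in> Basis \<Longrightarrow> k \<in> Basis \<Longrightarrow> F j k = F k j"
  shows "(\<Sum>k\<in>Basis. \<Sum>m=1..q. (\<Sum>j\<in>Basis. F j k * a j m) * \<beta> k m) = (\<Sum>j\<in>Basis. F j j)"
proof -
  let ?M = "\<lambda>j k. \<Sum>m=1..q. a j m * \<beta> k m"
  have "(\<Sum>k\<in>Basis. \<Sum>m=1..q. (\<Sum>j\<in>Basis. F j k * a j m) * \<beta> k m) = (\<Sum>k\<in>Basis. \<Sum>j\<in>Basis. F j k * ?M j k)"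
    by (intro sum.cong refl, subst sum_distrib_right, subst sum.swap) (simp add: sum_distrib_left mult.assoc)
  then have 1: "(\<Sum>k\<in>Basis. \<Sum>m=1..q. (\<Sum>j\<in>Basis. F j k * a j m) * \<beta> k m) = (\<Sum>k\<in>Basis. \<Sum>j\<in>Basis. F j k * ?M j k)" .
  have 2: "(\<Sum>k\<in>Basis. \<Sum>j\<in>Basis. F j k * ?M j k) = (\<Sum>k\<in>Basis. \<Sum>j\<in>Basis. F j k * ?M k j)"
    by (subst sum.swap) (intro sum.cong refl, simp add: sym)
  have "(\<Sum>k\<in>Basis. \<Sum>j\<in>Basis. F j k * ?M j k) + (\<Sum>k\<in>Basis. \<Sum>j\<in>Basis. F j k * ?M j k) =
      (\<Sum>k\<in>Basis. \<Sum>j\<in>Basis. F j k * (?M j k + ?M k j))"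
    by (subst (2) 2) (simp add: sum.distrib distrib_left)
  also have "\<dots> = (\<Sum>k\<in>Basis. \<Sum>j\<in>Basis. if j = k then 2 * F j j else 0)"
  proof (intro sum.cong refl)
    fix k j :: 'a assume "k \<in> Basis" "j \<in> Basis"
    then have "?M j k + ?M k j = (if j = k then 2 else 0)"
      using assms(1) unfolding dirac_pair_def by (simp add: sum.distrib)
    then show "F j k * (?M j k + ?M k j) = (if j = k then 2 * F j j else 0)"
      by (simp add: mult_2 mult_2_right)
  qed
  also have "\<dots> = 2 * (\<Sum>k\<in>Basis. F k k)" by (simp add: sum_distrib_left)
  finally have "2 *\<^sub>R (\<Sum>k\<in>Basis. \<Sum>j\<in>Basis. F j k * ?M j k) = 2 *\<^sub>R (\<Sum>k\<in>Basis. F k k)"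
    by (simp add: scaleR_2 mult_2)
  then show ?thesis using 1 by simp
qed

lemma bounded_linear_mult_const:
  "bounded_linear (\<lambda>x::'a::{real_algebra_1, euclidean_space}. x * c)"
  by (intro linear_conv_bounded_linear[THEN iffD1] linearI) (simp_all add: distrib_right)

lemma cauchy_on_D:
  assumes "cauchy_on q a S f"
  shows "Ck_on 1 S f" "\<And>x l m. x \<in> S \<Longrightarrow> m \<in> {1..q} \<Longrightarrow> (\<Sum>j\<in>Basis. partial f (axis l j) x * a j m) = 0"
  using assms unfolding cauchy_on_def by blast+

lemma sum_Basis_vec:
  "(\<Sum>e\<in>Basis. g e) = (\<Sum>l\<in>UNIV. \<Sum>j\<in>Basis. g (axis l j :: 'a::euclidean_space ^ 'n))"
proof -
  have "(\<Sum>l\<in>UNIV. \<Sum>j\<in>Basis. g (axis l j :: 'a ^ 'n)) = (\<Sum>p\<in>UNIV \<times> Basis. g (axis (fst p) (snd p) :: 'a ^ 'n))"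
    by (simp add: sum.cartesian_product split_def)
  also have "\<dots> = (\<Sum>e\<in>Basis. g e)"
  proof (rule sum.reindex_cong[symmetric, where l = "\<lambda>p. axis (fst p) (snd p)"])
    show "inj_on (\<lambda>p. axis (fst p) (snd p) :: 'a ^ 'n) (UNIV \<times> Basis)"
      by (auto simp: inj_on_def axis_eq_axis)
    show "(Basis :: ('a ^ 'n) set) = (\<lambda>p. axis (fst p) (snd p)) ` (UNIV \<times> Basis)"
      by (auto simp: Basis_vec_def image_def)
  qed simp
  finally show ?thesis by simp
qed

lemma integral_mult_const:
  fixes h :: "'c::euclidean_space \<Rightarrow> 'a::{real_algebra_1, euclidean_space}"
  shows "h integrable_on S \<Longrightarrow> integral S (\<lambda>y. h y * c) = integral S h * c"
  using integral_linear[OF _ bounded_linear_mult_const] by (simp add: o_def)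

text \<open>
  The integral is a sum over \<open>e\<close> of terms \<open>I e e\<close>, where \<open>I e e'\<close> pairs the \<open>e\<close>-derivative of \<open>f\<close> with the
  \<open>e'\<close>-component of the gradient field of the shell.  Integration by parts makes \<open>I\<close> symmetric, so by
  the contraction property of \<open>\<beta>\<close> its trace over one variable is a combination of integrals of the
  conditions satisfied by \<open>f\<close>.  No second derivative of \<open>f\<close> occurs.
\<close>
lemma cauchy_radial_zero:
  fixes f :: "'a::{real_algebra_1, euclidean_space} ^ 'n \<Rightarrow> 'a"
  assumes S: "open S" and dp: "dirac_pair q a \<beta>" and f: "cauchy_on q a S f" and s: "s \<noteq> 0"
    and x: "\<And>y. y \<in> std_box \<Longrightarrow> x + s *\<^sub>R y \<in> S"
  shows "integral std_box (\<lambda>y. \<Sum>e\<in>Basis. (shell y * (y \<bullet> e)) *\<^sub>R partial f e (x + s *\<^sub>R y)) = 0"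
proof -
  note C1 = cauchy_on_D(1)[OF f]
  define I where "I = (\<lambda>e e'. integral std_box (\<lambda>y. (shell y * (y \<bullet> e')) *\<^sub>R partial f e (x + s *\<^sub>R y)))"
  have io: "(\<lambda>y. (shell y * (y \<bullet> e')) *\<^sub>R partial f e (x + s *\<^sub>R y)) integrable_on std_box" for e e'
    by (rule integrable_translate[OF C1_partial_continuous[OF C1]])
      (use x in \<open>auto intro!: continuous_intros continuous_shell\<close>)
  have lin: "partial f (s *\<^sub>R e) (x + s *\<^sub>R y) = s *\<^sub>R partial f e (x + s *\<^sub>R y)" if "y \<in> std_box" for e y
    using linear_scale[OF has_derivative_linear[OF has_derivative_partial[OF C1_differentiable[OF C1 x[OF that]]]]] .
  have sI: "s *\<^sub>R I e e' = - integral std_box (\<lambda>y. partial (\<lambda>y. shell y * (y \<bullet> e')) e y *\<^sub>R f (x + s *\<^sub>R y))" for e e'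
  proof -
    have "integral std_box (\<lambda>y. (shell y * (y \<bullet> e')) *\<^sub>R partial f (s *\<^sub>R e) (x + s *\<^sub>R y)) =
      - integral std_box (\<lambda>y. partial (\<lambda>y. shell y * (y \<bullet> e')) e y *\<^sub>R f (x + s *\<^sub>R y))"
      by (rule integral_by_parts[OF S C1 _ _ C1_shell_coord, where L = "\<lambda>y. s *\<^sub>R y"])
        (use x in \<open>auto simp: shell_eq_0 linear_scale_self\<close>)
    moreover have "integral std_box (\<lambda>y. (shell y * (y \<bullet> e')) *\<^sub>R partial f (s *\<^sub>R e) (x + s *\<^sub>R y)) =
       s *\<^sub>R I e e'"
      unfolding I_def integral_cmul[symmetric] by (rule integral_cong) (simp add: lin)
    ultimately show ?thesis by simp
  qed
  have sym: "I e e' = I e' e" for e e'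
  proof -
    have "s *\<^sub>R I e e' = s *\<^sub>R I e' e" unfolding sI by (simp only: partial_shell_coord_commute[where e = e' and v = e])
    then show ?thesis using s by simp
  qed
  have "(\<Sum>j\<in>Basis. I (axis l j) (axis l j)) = 0" for l
  proof -
    have "(\<Sum>j\<in>Basis. I (axis l j) (axis l k) * a j m) = 0" if m: "m \<in> {1..q}" for k m
    proof -
      have "(\<Sum>j\<in>Basis. I (axis l j) (axis l k) * a j m) =
        integral std_box (\<lambda>y. \<Sum>j\<in>Basis. (shell y * (y \<bullet> axis l k)) *\<^sub>R partial f (axis l j) (x + s *\<^sub>R y) * a j m)"
        unfolding I_def integral_mult_const[OF io, symmetric]
        by (rule integral_sum[symmetric]) (auto intro: integrable_linear[OF io bounded_linear_mult_const, unfolded o_def] simp del: mult_scaleR_left)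
      also have "\<dots> = integral std_box (\<lambda>y::'a^'n. 0::'a)"
      proof (rule integral_cong)
        fix y :: "'a ^ 'n" assume y: "y \<in> std_box"
        have "(\<Sum>j\<in>Basis. (shell y * (y \<bullet> axis l k)) *\<^sub>R partial f (axis l j) (x + s *\<^sub>R y) * a j m) =
          (shell y * (y \<bullet> axis l k)) *\<^sub>R (\<Sum>j\<in>Basis. partial f (axis l j) (x + s *\<^sub>R y) * a j m)"
          by (simp add: scaleR_sum_right)
        then show "(\<Sum>j\<in>Basis. (shell y * (y \<bullet> axis l k)) *\<^sub>R partial f (axis l j) (x + s *\<^sub>R y) * a j m) = 0"
          using cauchy_on_D(2)[OF f x[OF y] m] by simp
      qed
      finally show ?thesis by simp
    qed
    then have "(\<Sum>k\<in>Basis. \<Sum>m=1..q. (\<Sum>j\<in>Basis. I (axis l j) (axis l k) * a j m) * \<beta> k m) = 0"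
      by (intro sum.neutral ballI) simp
    then show ?thesis using dirac_pair_contract[OF dp, of "\<lambda>j k. I (axis l j) (axis l k)"] sym by simp
  qed
  then have "(\<Sum>e\<in>Basis. I e e) = 0" by (simp add: sum_Basis_vec)
  then show ?thesis unfolding I_def by (subst integral_sum) (auto simp: io)
qed

lemma cauchy_mean_value:
  fixes f :: "'a::{real_algebra_1, euclidean_space} ^ 'n \<Rightarrow> 'a"
  assumes S: "open S" and dp: "dirac_pair q a \<beta>" and f: "cauchy_on q a S f" and \<delta>: "0 \<le> \<delta>"
    and x: "\<And>s y. s \<in> {0..\<delta>} \<Longrightarrow> y \<in> std_box \<Longrightarrow> x + s *\<^sub>R y \<in> S"
  shows "integral std_box (\<lambda>y. shell y *\<^sub>R f (x + \<delta> *\<^sub>R y)) = integral (std_box :: ('a ^ 'n) set) shell *\<^sub>R f x"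
proof -
  have "integral {0..\<delta>} (\<lambda>s. integral std_box (\<lambda>y. \<Sum>e\<in>Basis. (shell y * (y \<bullet> e)) *\<^sub>R partial f e (x + s *\<^sub>R y))) = integral {0..\<delta>} (\<lambda>s. 0)"
    by (rule integral_spike[of "{0}"]) (use cauchy_radial_zero[OF S dp f] x in auto)
  then show ?thesis
    using radial_ftc[OF cauchy_on_D(1)[OF f] linear_id[unfolded id_def] \<delta> x] by simp
qed

section \<open>Smoothness and unique continuation\<close>

lemma Ck_local:
  assumes "\<And>x. x \<in> S \<Longrightarrow> \<exists>U. open U \<and> x \<in> U \<and> Ck_on k U f"
  shows "Ck_on k S f"
  using assms
proof (induction k arbitrary: f)
  case 0
  have "isCont f x" if "x \<in> S" for x
    using 0[OF that] by (auto simp: continuous_on_eq_continuous_at)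
  then show ?case by (simp add: continuous_at_imp_continuous_on)
next
  case (Suc k)
  then show ?case by (metis Ck_on.simps(2))
qed

lemma std_box_bounded: obtains K where "0 < K" "\<And>y::'c::euclidean_space. y \<in> std_box \<Longrightarrow> norm y \<le> K"
  using bounded_cbox bounded_pos by metis

lemma linear_partial: "f differentiable (at x) \<Longrightarrow> linear (\<lambda>v. partial f v x)"
  using has_derivative_linear[OF has_derivative_partial] .

lemma partial_eq_0_on_open:
  assumes "open W" "x \<in> W" "\<And>y. y \<in> W \<Longrightarrow> f y = 0"
  shows "partial f v x = 0"
  using partial_transform[of "\<lambda>x. 0" x W f v] assms frechet_derivative_const[of "0" x] by simp

text \<open>
  The mean value formula is differentiated under the integral sign and the derivative is moved to the
  shell.  The right-hand side contains \<open>f\<close> itself and not its derivative: this gives both the next order of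
  smoothness and a bound of the derivative by \<open>f\<close>.
\<close>
lemma cauchy_partial_formula:
  fixes f :: "'a::{real_algebra_1, euclidean_space} ^ 'n \<Rightarrow> 'a"
  assumes S: "open S" and dp: "dirac_pair q a \<beta>" and f: "cauchy_on q a S f" and \<delta>: "0 < \<delta>"
    and U: "open U" and xU: "x \<in> U"
    and x: "\<And>z s y. z \<in> U \<Longrightarrow> s \<in> {0..\<delta>} \<Longrightarrow> y \<in> std_box \<Longrightarrow> z + s *\<^sub>R y \<in> S"
  shows "partial f v x = - (1 / (\<delta> * integral (std_box :: ('a ^ 'n) set) shell)) *\<^sub>R
    integral std_box (\<lambda>y. partial shell v y *\<^sub>R f (x + \<delta> *\<^sub>R y))"
proof -
  note C1 = cauchy_on_D(1)[OF f]
  let ?c = "integral (std_box :: ('a ^ 'n) set) shell"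
  have xS: "z + \<delta> *\<^sub>R y \<in> S" if "z \<in> U" "y \<in> std_box" for z y using x[OF that(1), of \<delta>] \<delta> that by simp
  have US: "U \<subseteq> S" using x[of _ 0 0] \<delta> norm_le_std_box[of 0] by auto
  have "((\<lambda>z. integral std_box (\<lambda>y. shell y *\<^sub>R f (z + \<delta> *\<^sub>R y))) has_derivative
    (\<lambda>v. integral std_box (\<lambda>y. shell y *\<^sub>R partial f v (x + \<delta> *\<^sub>R y)))) (at x)"
    by (rule has_derivative_integral_translates[OF S C1 _ continuous_shell])
      (use xS[OF xU] in \<open>auto intro!: continuous_intros\<close>)
  moreover have "integral std_box (\<lambda>y. shell y *\<^sub>R f (z + \<delta> *\<^sub>R y)) = ?c *\<^sub>R f z" if "z \<in> U" for z
    using cauchy_mean_value[OF S dp f, of \<delta> z] x[OF that] \<delta> by simp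
  ultimately have A: "((\<lambda>z. ?c *\<^sub>R f z) has_derivative
    (\<lambda>v. integral std_box (\<lambda>y. shell y *\<^sub>R partial f v (x + \<delta> *\<^sub>R y)))) (at x)"
    by (rule has_derivative_transform_within_open[OF _ U xU])
  have B: "((\<lambda>z. ?c *\<^sub>R f z) has_derivative (\<lambda>v. ?c *\<^sub>R partial f v x)) (at x)"
    using US xU by (intro has_derivative_scaleR_right has_derivative_partial C1_differentiable[OF C1]) auto
  have 1: "?c *\<^sub>R partial f v x = integral std_box (\<lambda>y. shell y *\<^sub>R partial f v (x + \<delta> *\<^sub>R y))"
    using fun_cong[OF has_derivative_unique[OF B A], of v] .
  have "integral std_box (\<lambda>y. shell y *\<^sub>R partial f (\<delta> *\<^sub>R v) (x + \<delta> *\<^sub>R y)) =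
      - integral std_box (\<lambda>y. partial shell v y *\<^sub>R f (x + \<delta> *\<^sub>R y))"
    by (rule integral_by_parts[OF S C1 _ _ C1_shell, where L = "\<lambda>y. \<delta> *\<^sub>R y"])
      (use xS xU in \<open>auto simp: shell_eq_0 linear_scale_self\<close>)
  moreover have "integral std_box (\<lambda>y. shell y *\<^sub>R partial f (\<delta> *\<^sub>R v) (x + \<delta> *\<^sub>R y)) =
      \<delta> *\<^sub>R integral std_box (\<lambda>y. shell y *\<^sub>R partial f v (x + \<delta> *\<^sub>R y))"
    unfolding integral_cmul[symmetric]
  proof (rule integral_cong)
    fix y :: "'a ^ 'n" assume "y \<in> std_box"
    then show "shell y *\<^sub>R partial f (\<delta> *\<^sub>R v) (x + \<delta> *\<^sub>R y) = \<delta> *\<^sub>R shell y *\<^sub>R partial f v (x + \<delta> *\<^sub>R y)"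
      using linear_scale[OF linear_partial[OF C1_differentiable[OF C1 xS[OF xU]]], of y \<delta> v] by simp
  qed
  ultimately have "(\<delta> * ?c) *\<^sub>R partial f v x = - integral std_box (\<lambda>y. partial shell v y *\<^sub>R f (x + \<delta> *\<^sub>R y))"
    unfolding scaleR_scaleR[symmetric] 1 by (simp only:)
  then have "(1 / (\<delta> * ?c)) *\<^sub>R (\<delta> * ?c) *\<^sub>R partial f v x =
      (1 / (\<delta> * ?c)) *\<^sub>R - integral std_box (\<lambda>y. partial shell v y *\<^sub>R f (x + \<delta> *\<^sub>R y))" by simp
  then show ?thesis using \<delta> shell_mass_pos[where 'c = "'a ^ 'n"] by simp
qed

lemma cauchy_partial:
  fixes f :: "'a::{real_algebra_1, euclidean_space} ^ 'n \<Rightarrow> 'a"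
  assumes S: "open S" and dp: "dirac_pair q a \<beta>" and f: "cauchy_on q a S f"
  shows "cauchy_on q a S (partial f v)"
proof -
  note C1 = cauchy_on_D(1)[OF f]
  obtain K where K: "0 < K" "\<And>y::'a^'n. y \<in> std_box \<Longrightarrow> norm y \<le> K" using std_box_bounded by blast
  have main: "\<exists>U. open U \<and> x \<in> U \<and> Ck_on 1 U (partial f v) \<and>
    (\<forall>l. \<forall>m\<in>{1..q}. (\<Sum>j\<in>Basis. partial (partial f v) (axis l j) x * a j m) = 0)" if xS: "x \<in> S" for x
  proof -
    obtain r where r: "0 < r" "ball x r \<subseteq> S" using S xS open_contains_ball by blast
    define \<delta> where "\<delta> = r / (2 * K)"
    have \<delta>: "0 < \<delta>" using r K by (simp add: \<delta>_def)
    define U where "U = ball x (r/2)"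
    have U: "open U" "x \<in> U" using r by (auto simp: U_def)
    have in_S: "z + s *\<^sub>R y \<in> S" if "z \<in> U" "s \<in> {0..\<delta>}" "y \<in> std_box" for z s y
    proof -
      have "norm (s *\<^sub>R y) \<le> \<delta> * K" using that K(2)[OF that(3)] \<delta> by (auto intro!: mult_mono)
      then have "norm (s *\<^sub>R y) \<le> r / 2" using K by (simp add: \<delta>_def)
      moreover have "dist x z < r / 2" using that by (simp add: U_def)
      moreover have "dist x (z + s *\<^sub>R y) \<le> dist x z + norm (s *\<^sub>R y)"
        using dist_triangle[of x "z + s *\<^sub>R y" z] by (simp add: dist_norm)
      ultimately have "dist x (z + s *\<^sub>R y) < r" by linarith
      then show ?thesis using r by auto
    qed
    let ?c = "integral (std_box :: ('a ^ 'n) set) shell"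
    let ?k = "- (1 / (\<delta> * ?c))"
    let ?G = "\<lambda>z. integral std_box (\<lambda>y. partial shell v y *\<^sub>R f (z + \<delta> *\<^sub>R y))"
    have eq: "partial f v z = ?k *\<^sub>R ?G z" if "z \<in> U" for z
      by (rule cauchy_partial_formula[OF S dp f \<delta> U(1) that in_S])
    have UT: "U \<subseteq> {z. \<forall>y\<in>std_box. z + \<delta> *\<^sub>R y \<in> S}" using in_S[of _ \<delta>] \<delta> by auto
    have G: "Ck_on 1 U ?G"
      by (rule Ck_subset[OF C1_integral_translates[OF S C1 _ C1_partial_continuous[OF Ck_subset[OF C1_shell]]] UT])
        (auto intro!: continuous_intros)
    have C1U: "Ck_on 1 U (partial f v)"
      by (rule Ck_cong[OF Ck_scaleR[OF U(1) Ck_const G] U(1) eq[symmetric]])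
    have "(\<Sum>j\<in>Basis. partial (partial f v) (axis l j) x * a j m) = 0" if m: "m \<in> {1..q}" for l m
    proof -
      have d: "(?G has_derivative (\<lambda>e. integral std_box (\<lambda>y. partial shell v y *\<^sub>R partial f e (x + \<delta> *\<^sub>R y)))) (at x)"
        using UT U(2)
        by (intro has_derivative_integral_translates[OF S C1 _ C1_partial_continuous[OF Ck_subset[OF C1_shell]]])
          (auto intro!: continuous_intros)
      have pp: "partial (partial f v) e x = partial (\<lambda>z. ?k *\<^sub>R ?G z) e x" for e
        using partial_transform[OF C1_differentiable[OF C1U U(2)] U eq] .
      have p: "partial (partial f v) e x = ?k *\<^sub>R integral std_box (\<lambda>y. partial shell v y *\<^sub>R partial f e (x + \<delta> *\<^sub>R y))" for e
        by (rule trans[OF pp partialI[OF has_derivative_scaleR_right[OF d]]])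
      have io: "(\<lambda>y. partial shell v y *\<^sub>R partial f e (x + \<delta> *\<^sub>R y)) integrable_on std_box" for e
        using UT U(2)
        by (intro integrable_translate[OF C1_partial_continuous[OF C1] _ C1_partial_continuous[OF Ck_subset[OF C1_shell]]])
          (auto intro!: continuous_intros)
      have "(\<Sum>j\<in>Basis. partial (partial f v) (axis l j) x * a j m) =
        ?k *\<^sub>R (\<Sum>j\<in>Basis. integral std_box (\<lambda>y. partial shell v y *\<^sub>R partial f (axis l j) (x + \<delta> *\<^sub>R y)) * a j m)"
        unfolding p scaleR_sum_right by simp
      also have "(\<Sum>j\<in>Basis. integral std_box (\<lambda>y. partial shell v y *\<^sub>R partial f (axis l j) (x + \<delta> *\<^sub>R y)) * a j m) =
        integral std_box (\<lambda>y. \<Sum>j\<in>Basis. partial shell v y *\<^sub>R partial f (axis l j) (x + \<delta> *\<^sub>R y) * a j m)"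
        unfolding integral_mult_const[OF io, symmetric]
        by (rule integral_sum[symmetric]) (auto intro: integrable_linear[OF io bounded_linear_mult_const, unfolded o_def] simp del: mult_scaleR_left)
      also have "\<dots> = integral std_box (\<lambda>y::'a^'n. 0::'a)"
      proof (rule integral_cong)
        fix y :: "'a ^ 'n" assume y: "y \<in> std_box"
        have "(\<Sum>j\<in>Basis. partial shell v y *\<^sub>R partial f (axis l j) (x + \<delta> *\<^sub>R y) * a j m) =
          partial shell v y *\<^sub>R (\<Sum>j\<in>Basis. partial f (axis l j) (x + \<delta> *\<^sub>R y) * a j m)"
          by (simp add: scaleR_sum_right)
        then show "(\<Sum>j\<in>Basis. partial shell v y *\<^sub>R partial f (axis l j) (x + \<delta> *\<^sub>R y) * a j m) = 0"
          using cauchy_on_D(2)[OF f in_S[OF U(2) _ y, of \<delta>] m] \<delta> by simp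
      qed
      finally show ?thesis by simp
    qed
    then show ?thesis using U C1U by blast
  qed
  have "Ck_on 1 S (partial f v)" by (rule Ck_local) (use main in blast)
  then show ?thesis using main unfolding cauchy_on_def by blast
qed

lemma cauchy_smooth:
  fixes f :: "'a::{real_algebra_1, euclidean_space} ^ 'n \<Rightarrow> 'a"
  assumes S: "open S" and dp: "dirac_pair q a \<beta>"
  shows "cauchy_on q a S f \<Longrightarrow> Ck_on k S f"
proof (induction k arbitrary: f)
  case 0
  then show ?case using C1_continuous[OF cauchy_on_D(1)] by auto
next
  case (Suc k)
  then show ?case using C1_differentiable[OF cauchy_on_D(1)[OF Suc.prems]] cauchy_partial[OF S dp Suc.prems] by auto
qed

text \<open>
  The constant depends neither on the function nor on the set, which allows the bound to be iterated.
\<close>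
lemma cauchy_partial_bound:
  obtains C where "0 < C"
    "\<And>S q a \<beta> (f :: 'a::{real_algebra_1, euclidean_space} ^ 'n \<Rightarrow> 'a) x r M v. open S \<Longrightarrow> dirac_pair q a \<beta> \<Longrightarrow>
      cauchy_on q a S f \<Longrightarrow> 0 < r \<Longrightarrow> cball x r \<subseteq> S \<Longrightarrow> 
      (\<And>z. z \<in> cball x r \<Longrightarrow> norm (f z) \<le> M) \<Longrightarrow> norm v \<le> 1 \<Longrightarrow> norm (partial f v x) \<le> C * M / r"
proof -
  obtain K where K: "0 < K" "\<And>y::'a^'n. y \<in> std_box \<Longrightarrow> norm y \<le> K" using std_box_bounded by blast
  let ?c = "integral (std_box :: ('a ^ 'n) set) shell"
  have c: "0 < ?c" by (rule shell_mass_pos)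
  define h :: "'a ^ 'n \<Rightarrow> real" where "h = (\<lambda>y. \<Sum>j\<in>Basis. \<bar>partial shell j y\<bar>)"
  have "continuous_on std_box h"
    unfolding h_def by (intro continuous_intros C1_partial_continuous[OF Ck_subset[OF C1_shell]]) auto
  then have "bounded (h ` std_box)" by (intro compact_imp_bounded compact_continuous_image compact_cbox)
  then obtain B where B: "0 < B" "\<And>y. y \<in> std_box \<Longrightarrow> h y \<le> B"
    by (auto simp: bounded_pos) (meson abs_ge_self order_trans)
  have shell_bound: "\<bar>partial shell v y\<bar> \<le> B" if "norm v \<le> 1" "y \<in> std_box" for v y :: "'a ^ 'n"
  proof -
    have "partial shell v y = (\<Sum>j\<in>Basis. (v \<bullet> j) *\<^sub>R partial shell j y)"
      by (rule partial_expand[OF C1_differentiable[OF C1_shell]]) simp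
    also have "\<bar>\<dots>\<bar> \<le> h y" unfolding h_def
    proof (rule order_trans[OF sum_abs sum_mono])
      fix j :: "'a ^ 'n" assume j: "j \<in> Basis"
      have "\<bar>v \<bullet> j\<bar> \<le> 1" using order_trans[OF Basis_le_norm[OF j] that(1)] .
      then show "\<bar>(v \<bullet> j) *\<^sub>R partial shell j y\<bar> \<le> \<bar>partial shell j y\<bar>"
        by (simp add: abs_mult mult_left_le_one_le)
    qed
    finally show ?thesis using B(2)[OF that(2)] by linarith
  qed
  define V where "V = measure lborel (std_box :: ('a ^ 'n) set)"
  have V: "0 \<le> V" unfolding V_def by (rule measure_nonneg)
  define C where "C = 2 * K / ?c * (B * V) + 1"
  have Cpos: "0 < C" unfolding C_def using K B c V by (intro add_nonneg_pos mult_nonneg_nonneg divide_nonneg_nonneg) auto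
  show thesis
  proof (rule that[OF Cpos])
    fix S q a \<beta> and f :: "'a ^ 'n \<Rightarrow> 'a" and x r M and v :: "'a ^ 'n"
    assume S: "open S" and dp: "dirac_pair q a \<beta>" and f: "cauchy_on q a S f" and r: "0 < r"
      and rS: "cball x r \<subseteq> S" and M: "\<And>z. z \<in> cball x r \<Longrightarrow> norm (f z) \<le> M" and v: "norm v \<le> 1"
    have M0: "0 \<le> M" using order_trans[OF norm_ge_zero M[of x]] r by simp
    define \<delta> where "\<delta> = r / (2 * K)"
    have \<delta>: "0 < \<delta>" using r K by (simp add: \<delta>_def)
    have in_ball: "z + s *\<^sub>R y \<in> cball x r" if "z \<in> ball x (r/2)" "s \<in> {0..\<delta>}" "y \<in> std_box" for z s y
    proof -
      have "norm (s *\<^sub>R y) \<le> \<delta> * K" using that K(2)[OF that(3)] \<delta> by (auto intro!: mult_mono)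
      then have "norm (s *\<^sub>R y) \<le> r / 2" using K by (simp add: \<delta>_def)
      moreover have "dist x z < r / 2" using that by simp
      moreover have "dist x (z + s *\<^sub>R y) \<le> dist x z + norm (s *\<^sub>R y)"
        using dist_triangle[of x "z + s *\<^sub>R y" z] by (simp add: dist_norm)
      ultimately show ?thesis by simp
    qed
    have x2: "x \<in> ball x (r/2)" using r by simp
    have "partial f v x = - (1 / (\<delta> * ?c)) *\<^sub>R integral std_box (\<lambda>y. partial shell v y *\<^sub>R f (x + \<delta> *\<^sub>R y))"
      by (rule cauchy_partial_formula[OF S dp f \<delta> open_ball x2]) (use in_ball rS in blast)
    then have "norm (partial f v x) = 1 / (\<delta> * ?c) * norm (integral std_box (\<lambda>y. partial shell v y *\<^sub>R f (x + \<delta> *\<^sub>R y)))"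
      using \<delta> c by simp
    also have "norm (integral std_box (\<lambda>y. partial shell v y *\<^sub>R f (x + \<delta> *\<^sub>R y))) \<le> (B * M) * V"
      unfolding V_def
    proof (rule has_integral_bound[OF _ integrable_integral])
      show "0 \<le> B * M" using B M0 by simp
      show "(\<lambda>y. partial shell v y *\<^sub>R f (x + \<delta> *\<^sub>R y)) integrable_on std_box"
        by (rule integrable_translate[OF C1_continuous[OF cauchy_on_D(1)[OF f]] _ C1_partial_continuous[OF Ck_subset[OF C1_shell]]])
          (use in_ball[OF x2, of \<delta>] \<delta> rS in \<open>auto intro!: continuous_intros\<close>)
      fix y :: "'a ^ 'n" assume y: "y \<in> std_box"
      show "norm (partial shell v y *\<^sub>R f (x + \<delta> *\<^sub>R y)) \<le> B * M"
        unfolding norm_scaleR real_norm_def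
        using shell_bound[OF v y] M[OF in_ball[OF x2 _ y, of \<delta>]] \<delta> B by (intro mult_mono) auto
    qed
    finally have "norm (partial f v x) \<le> 1 / (\<delta> * ?c) * (B * M * V)"
      using \<delta> c by (simp add: mult_left_mono divide_right_mono)
    also have "\<dots> = (C - 1) * M / r" using K r c by (simp add: C_def \<delta>_def field_simps)
    also have "\<dots> \<le> C * M / r" using M0 r by (intro divide_right_mono mult_right_mono) auto
    finally show "norm (partial f v x) \<le> C * M / r" .
  qed
qed

lemma power_fact_le_exp: "0 \<le> x \<Longrightarrow> x ^ n \<le> exp x * fact n" for x :: real
proof -
  assume x: "0 \<le> x"
  have "sum (\<lambda>n. x ^ n /\<^sub>R fact n) {n} \<le> (\<Sum>n. x ^ n /\<^sub>R fact n)"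
    using x by (intro sum_le_suminf summable_exp_generic) auto
  then have "x ^ n / fact n \<le> exp x" by (simp add: exp_def divide_inverse mult.commute)
  then show ?thesis by (simp add: divide_le_eq)
qed

text \<open>
  Going from \<open>x\<close> to a distance \<open>r / 2\<close> in \<open>n\<close> steps, the first-order bound gives \<open>(2 * C * n / r) ^ n\<close>
  for the \<open>n\<close>-th directional derivative, that is, \<open>n!\<close> times the \<open>n\<close>-th power of a constant over \<open>r\<close>.  A
  function that vanishes near \<open>x\<close> is equal to its Taylor remainder, which tends to 0 on a ball whose
  radius is a fixed fraction of \<open>r\<close>.
\<close>
lemma cauchy_vanishing_ball:
  obtains \<kappa> where "0 < \<kappa>" "\<kappa> \<le> 1"
    "\<And>S q a \<beta> (f :: 'a::{real_algebra_1, euclidean_space} ^ 'n \<Rightarrow> 'a) x r W z. open S \<Longrightarrow> dirac_pair q a \<beta> \<Longrightarrow>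
      cauchy_on q a S f \<Longrightarrow> 0 < r \<Longrightarrow> cball x r \<subseteq> S \<Longrightarrow> open W \<Longrightarrow> x \<in> W \<Longrightarrow>
      (\<And>y. y \<in> W \<Longrightarrow> f y = 0) \<Longrightarrow> z \<in> ball x (\<kappa> * r) \<Longrightarrow> f z = 0"
proof -
  obtain C where C: "0 < C" and bound: 
    "\<And>S q a \<beta> (f :: 'a ^ 'n \<Rightarrow> 'a) x r M v. open S \<Longrightarrow> dirac_pair q a \<beta> \<Longrightarrow>
      cauchy_on q a S f \<Longrightarrow> 0 < r \<Longrightarrow> cball x r \<subseteq> S \<Longrightarrow> 
      (\<And>z. z \<in> cball x r \<Longrightarrow> norm (f z) \<le> M) \<Longrightarrow> norm v \<le> 1 \<Longrightarrow> norm (partial f v x) \<le> C * M / r"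
    using cauchy_partial_bound by blast
  define \<kappa> where "\<kappa> = min (1/2) (1 / (4 * exp 1 * C))"
  have \<kappa>: "0 < \<kappa>" "\<kappa> \<le> 1" "\<kappa> \<le> 1/2" "\<kappa> \<le> 1 / (4 * exp 1 * C)" using C by (auto simp: \<kappa>_def)
  show thesis
  proof (rule that[OF \<kappa>(1,2)])
    fix S q a \<beta> and f :: "'a ^ 'n \<Rightarrow> 'a" and x r W z
    assume S: "open S" and dp: "dirac_pair q a \<beta>" and f: "cauchy_on q a S f" and r: "0 < r"
      and rS: "cball x r \<subseteq> S" and W: "open W" "x \<in> W" and f0: "\<And>y. y \<in> W \<Longrightarrow> f y = 0"
      and z: "z \<in> ball x (\<kappa> * r)"
    have "compact (f ` cball x r)"
      by (intro compact_continuous_image continuous_on_subset[OF C1_continuous[OF cauchy_on_D(1)[OF f]] rS] compact_cball)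
    then obtain M where M: "0 < M" "\<And>y. y \<in> cball x r \<Longrightarrow> norm (f y) \<le> M"
      using compact_imp_bounded bounded_pos by (metis imageI)
    show "f z = 0"
    proof (cases "z = x")
      case True
      then show ?thesis using f0 W by simp
    next
      case False
      define h where "h = norm (z - x)"
      have h: "0 < h" "h < \<kappa> * r" using False z by (auto simp: h_def dist_norm norm_minus_commute)
      define v where "v = (1 / h) *\<^sub>R (z - x)"
      have nv: "norm v = 1" using h(1) by (simp add: v_def h_def)
      have zx: "z = x + h *\<^sub>R v" using h by (simp add: v_def)
      define F where "F = (\<lambda>n. ((\<lambda>g. partial g v) ^^ n) f)"
      have F0: "F 0 = f" and FS: "F (Suc n) = partial (F n) v" for n by (auto simp: F_def)
      have FC: "cauchy_on q a S (F n)" for n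
        by (induction n) (auto simp: F0 FS f cauchy_partial[OF S dp])
      have FW: "\<forall>y\<in>W. F n y = 0" for n
        by (induction n) (auto simp: F0 FS f0 intro!: partial_eq_0_on_open[OF W(1)])
      have Fb: "norm (F n p) \<le> M * (C / \<rho>) ^ n" if "0 < \<rho>" "cball p (real n * \<rho>) \<subseteq> cball x r" for n p \<rho>
        using that
      proof (induction n arbitrary: p)
        case 0
        then show ?case using M(2)[of p] by (simp add: F0)
      next
        case (Suc n)
        have sub: "cball w (real n * \<rho>) \<subseteq> cball p (real (Suc n) * \<rho>)" if "w \<in> cball p \<rho>" for w
        proof
          fix u assume "u \<in> cball w (real n * \<rho>)"
          then show "u \<in> cball p (real (Suc n) * \<rho>)"
            using dist_triangle[of p u w] that by (simp add: algebra_simps)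
        qed
        have "cball p \<rho> \<subseteq> cball p (real (Suc n) * \<rho>)"
          using Suc.prems(1) by (intro subset_cball) (simp add: algebra_simps)
        moreover have "norm v \<le> 1" using nv by simp
        ultimately have "norm (F (Suc n) p) \<le> C * (M * (C / \<rho>) ^ n) / \<rho>"
          unfolding FS using Suc.prems sub rS
          by (intro bound[OF S dp FC Suc.prems(1)] Suc.IH) blast+
        then show ?case by (simp add: field_simps)
      qed
      have "f z \<bullet> b = 0" for b
      proof -
        define G where "G = (\<lambda>n t. F n (x + t *\<^sub>R v) \<bullet> b)"
        have inball: "x + t *\<^sub>R v \<in> cball x (r/2)" if "0 \<le> t" "t \<le> h" for t
        proof -
          have "\<kappa> * r \<le> r / 2" using \<kappa>(3) r by simp
          then show ?thesis using that h nv by (simp add: dist_norm)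
        qed
        have der: "\<forall>m t. m < n \<and> 0 \<le> t \<and> t \<le> h \<longrightarrow> DERIV (G m) t :> G (Suc m) t" for n
        proof (intro allI impI)
          fix m t assume t: "m < n \<and> 0 \<le> t \<and> t \<le> h"
          have "x + t *\<^sub>R v \<in> S" using inball[of t] t rS r by (auto simp: subset_iff)
          then have d: "F m differentiable (at (x + t *\<^sub>R v))" using C1_differentiable[OF cauchy_on_D(1)[OF FC]] by blast
          have i: "((\<lambda>t. x + t *\<^sub>R v) has_derivative (\<lambda>h. h *\<^sub>R v)) (at t)" by (auto intro!: derivative_eq_intros)
          have "(G m has_derivative (\<lambda>k. partial (F m) (k *\<^sub>R v) (x + t *\<^sub>R v) \<bullet> b)) (at t)"
            unfolding G_def
            by (rule has_derivative_inner_left[OF has_derivative_compose[OF i has_derivative_partial[OF d]]])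
          then show "DERIV (G m) t :> G (Suc m) t"
            unfolding has_field_derivative_def
            by (rule has_derivative_eq_rhs) (simp add: linear_scale[OF linear_partial[OF d]] G_def FS fun_eq_iff mult.commute)
        qed
        have G0: "G m 0 = 0" for m using FW W by (simp add: G_def)
        have est: "\<bar>f z \<bullet> b\<bar> \<le> M * norm b * (1/2) ^ n" if n: "0 < n" for n
        proof -
          obtain t where t: "0 < t" "t < h" "G 0 h = (\<Sum>m<n. G m 0 / fact m * h ^ m) + G n t / fact n * h ^ n"
            using Maclaurin[OF h(1) n refl der] by blast
          have eq: "f z \<bullet> b = G n t / fact n * h ^ n"
            using t(3) zx by (simp add: G0) (simp add: G_def F0)
          \<comment> \<open>The \<open>n\<close> steps of length \<open>\<rho>\<close> use up half of the radius; the other half is for the position of \<open>t\<close>.\<close>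
          define \<rho> where "\<rho> = r / (2 * real n)"
          have \<rho>: "0 < \<rho>" "real n * \<rho> = r / 2" using r n by (auto simp: \<rho>_def)
          have "cball (x + t *\<^sub>R v) (real n * \<rho>) \<subseteq> cball x r"
          proof
            fix u assume "u \<in> cball (x + t *\<^sub>R v) (real n * \<rho>)"
            then show "u \<in> cball x r"
              using \<rho>(2) inball[of t] t dist_triangle[of x u "x + t *\<^sub>R v"] by simp
          qed
          then have "norm (F n (x + t *\<^sub>R v)) \<le> M * (C / \<rho>) ^ n" using Fb \<rho> by blast
          then have "\<bar>G n t\<bar> \<le> M * (C / \<rho>) ^ n * norm b"
            unfolding G_def using Cauchy_Schwarz_ineq2[of "F n (x + t *\<^sub>R v)" b]
            by (meson mult_right_mono norm_ge_zero order_trans)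
          then have "\<bar>f z \<bullet> b\<bar> \<le> M * (C / \<rho>) ^ n * norm b / fact n * h ^ n"
            unfolding eq using h by (simp add: abs_mult divide_right_mono mult_right_mono)
          also have "\<dots> = M * norm b * ((2 * C * h / r) ^ n * (real n ^ n / fact n))"
            using r n by (simp add: \<rho>_def power_mult_distrib power_divide field_simps)
          also have "\<dots> \<le> M * norm b * ((2 * C * h / r) ^ n * exp 1 ^ n)"
          proof -
            have "real n ^ n / fact n \<le> exp 1 ^ n"
              using power_fact_le_exp[of "real n" n] by (simp add: divide_le_eq exp_of_nat_mult[symmetric])
            then show ?thesis using M C h r by (intro mult_left_mono) auto
          qed
          also have "(2 * C * h / r) ^ n * exp 1 ^ n = (2 * exp 1 * C * h / r) ^ n"
            unfolding power_mult_distrib[symmetric] by (rule arg_cong[of _ _ "\<lambda>x. x ^ n"]) simp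
          also have "M * norm b * (2 * exp 1 * C * h / r) ^ n \<le> M * norm b * (1/2) ^ n"
          proof (intro mult_left_mono power_mono)
            have "h \<le> 1 / (4 * exp 1 * C) * r"
              using h(2) mult_right_mono[OF \<kappa>(4), of r] r by linarith
            then show "2 * exp 1 * C * h / r \<le> 1 / 2" using r C by (simp add: field_simps)
            show "0 \<le> 2 * exp 1 * C * h / r" using r C h by simp
          qed (use M in auto)
          finally show ?thesis .
        qed
        have "(\<lambda>n. M * norm b * (1/2) ^ n) \<longlonglongrightarrow> M * norm b * 0"
          by (intro tendsto_intros LIMSEQ_realpow_zero) auto
        then have "\<bar>f z \<bullet> b\<bar> \<le> M * norm b * 0"
          by (rule LIMSEQ_le_const) (use est in \<open>auto intro!: exI[of _ 1]\<close>)
        then show ?thesis by simp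
      qed
      then show ?thesis by (metis inner_eq_zero_iff)
    qed
  qed
qed

text \<open>
  Since the radius in the preceding lemma does not depend on where \<open>f\<close> is already known to vanish, the
  interior of the zero set is relatively closed.
\<close>
lemma cauchy_unique_continuation:
  fixes f :: "'a::{real_algebra_1, euclidean_space} ^ 'n \<Rightarrow> 'a"
  assumes S: "open S" "connected S" and dp: "dirac_pair q a \<beta>" and f: "cauchy_on q a S f"
    and W: "open W" "W \<noteq> {}" "W \<subseteq> S" and f0: "\<And>y. y \<in> W \<Longrightarrow> f y = 0" and x: "x \<in> S"
  shows "f x = 0"
proof -
  obtain \<kappa> where \<kappa>: "0 < \<kappa>" "\<kappa> \<le> 1" and van: 
    "\<And>S q a \<beta> (f :: 'a ^ 'n \<Rightarrow> 'a) x r W z. open S \<Longrightarrow> dirac_pair q a \<beta> \<Longrightarrow>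
      cauchy_on q a S f \<Longrightarrow> 0 < r \<Longrightarrow> cball x r \<subseteq> S \<Longrightarrow> open W \<Longrightarrow> x \<in> W \<Longrightarrow>
      (\<And>y. y \<in> W \<Longrightarrow> f y = 0) \<Longrightarrow> z \<in> ball x (\<kappa> * r) \<Longrightarrow> f z = 0"
    using cauchy_vanishing_ball by blast
  define Z where "Z = interior {x\<in>S. f x = 0}"
  have Z: "open Z" "\<And>y. y \<in> Z \<Longrightarrow> f y = 0" "Z \<subseteq> S"
    using interior_subset[of "{x\<in>S. f x = 0}"] by (auto simp: Z_def)
  have WZ: "W \<subseteq> Z" unfolding Z_def using W f0 by (intro interior_maximal) auto
  have cl: "y \<in> Z" if y: "y \<in> S" "y \<in> closure Z" for y
  proof -
    \<comment> \<open>A point of \<open>Z\<close> that is much closer to \<open>y\<close> than the distance of \<open>y\<close> to the complement of \<open>S\<close> suffices.\<close>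
    obtain r where r: "0 < r" "cball y r \<subseteq> S" using S(1) y(1) open_contains_cball by blast
    obtain z where z: "z \<in> Z" "dist z y < \<kappa> * (r / 2)"
      using y(2) \<kappa>(1) r(1) closure_approachable[of y Z] by (metis half_gt_zero mult_pos_pos)
    have kr: "\<kappa> * (r/2) \<le> r/2" using \<kappa> r by (simp add: mult_left_le_one_le)
    have sub: "cball z (r/2) \<subseteq> S"
    proof
      fix u assume "u \<in> cball z (r/2)"
      then have "dist y u \<le> r" using dist_triangle[of y u z] z(2) kr by (simp add: dist_commute)
      then show "u \<in> S" using r by auto
    qed
    have "f u = 0" if "u \<in> ball z (\<kappa> * (r/2))" for u
      by (rule van[OF S(1) dp f _ sub Z(1) z(1) Z(2) that]) (use r in auto)
    moreover have "ball z (\<kappa> * (r/2)) \<subseteq> S" using sub kr by (auto simp: subset_iff)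
    ultimately have "ball z (\<kappa> * (r/2)) \<subseteq> Z"
      unfolding Z_def by (intro interior_maximal) auto
    then show ?thesis using z(2) by auto
  qed
  have "Z \<inter> S = {} \<or> (- closure Z) \<inter> S = {}"
    by (rule connectedD[OF S(2) Z(1)]) (use cl closure_subset[of Z] in auto)
  then have "S \<subseteq> closure Z" using WZ W by auto
  then show ?thesis using cl x Z(2) by blast
qed

section \<open>Solving the inhomogeneous conditions\<close>

lemma norm_axis [simp]: "norm (axis i x :: 'a::real_inner ^ 'n) = norm x"
  by (simp add: norm_eq_sqrt_inner inner_axis_axis)

lemma linear_axis: "linear (axis i :: 'a::real_vector \<Rightarrow> 'a ^ 'n)"
  by (rule linearI) (auto simp: vec_eq_iff axis_def)

lemma bounded_linear_axis: "bounded_linear (axis i :: 'a::euclidean_space \<Rightarrow> 'a ^ 'n)"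
  using linear_axis linear_conv_bounded_linear by blast

lemma partial_sum_mult:
  fixes h :: "'i \<Rightarrow> 'e::euclidean_space \<Rightarrow> 'a::{real_algebra_1, euclidean_space}"
  assumes "\<And>i. i \<in> I \<Longrightarrow> h i differentiable (at z)"
  shows "partial (\<lambda>z. \<Sum>i\<in>I. h i z * c i) e z = (\<Sum>i\<in>I. partial (h i) e z * c i)"
  by (rule partialI[where D = "\<lambda>e. \<Sum>i\<in>I. partial (h i) e z * c i"])
    (intro has_derivative_sum bounded_linear.has_derivative[OF bounded_linear_mult_const] has_derivative_partial assms)

lemma Ck_sum_mult:
  fixes h :: "'i \<Rightarrow> 'e::euclidean_space \<Rightarrow> 'a::{real_algebra_1, euclidean_space}"
  assumes "open S" "\<And>i. i \<in> I \<Longrightarrow> Ck_on k S (h i)"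
  shows "Ck_on k S (\<lambda>z. \<Sum>i\<in>I. h i z * c i)"
  by (intro Ck_sum Ck_bounded_linear[OF bounded_linear_mult_const] assms)

lemma partial_sum:
  fixes h :: "'i \<Rightarrow> 'e::euclidean_space \<Rightarrow> 'v::euclidean_space"
  assumes "\<And>i. i \<in> I \<Longrightarrow> h i differentiable (at z)"
  shows "partial (\<lambda>z. \<Sum>i\<in>I. h i z) e z = (\<Sum>i\<in>I. partial (h i) e z)"
  by (rule partialI[where D = "\<lambda>e. \<Sum>i\<in>I. partial (h i) e z"])
    (intro has_derivative_sum has_derivative_partial assms)

lemma partial_diff:
  assumes "f differentiable (at z)" "g differentiable (at z)"
  shows "partial (\<lambda>z. f z - g z) e z = partial f e z - partial g e z"
  by (rule partialI[where D = "\<lambda>e. partial f e z - partial g e z"])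
    (intro has_derivative_diff has_derivative_partial assms)

lemma Ck_differentiable: "Ck_on (Suc k) S f \<Longrightarrow> x \<in> S \<Longrightarrow> f differentiable (at x)"
  by simp

lemma Ck_partial: "Ck_on (Suc k) S f \<Longrightarrow> e \<in> Basis \<Longrightarrow> Ck_on k S (partial f e)"
  by simp

text \<open>
  With \<open>g l m\<close> the right-hand sides, extended by 0, and \<open>k i = (\<Sum>m. g l0 m * \<beta> i m)\<close>, the solution is
  \<open>- \<integral> \<integral> \<Sum>i. (shell y * (y \<bullet> i)) *\<^sub>R k i (x + s y)\<close> over \<open>s > 0\<close> and \<open>y\<close>, divided by the mass of the shell,
  where \<open>y\<close> moves in the variable \<open>l0\<close> only.  This is the convolution with a constant multiple of
  \<open>y / norm y ^ d\<close>, written in coordinates in which it has no singularity; the integral over \<open>s\<close> has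
  finite range because \<open>k\<close> has compact support.

  Applying the condition \<open>(l, m)\<close> replaces \<open>k i\<close> by its \<open>(l, m)\<close>-derivative.  This differs from the
  \<open>i\<close>-th derivative of \<open>g l m\<close> by a field \<open>X l m i\<close> without divergence: on \<open>\<Omega>\<close> the divergence of \<open>k\<close> is the
  Laplacian of \<open>v\<close> in the variable \<open>l0\<close>, by \<open>dirac_pair\<close>.  A field without divergence has no flux through
  the gradient of \<open>shell_potential\<close>, so \<open>k i\<close> may be replaced by the \<open>i\<close>-th derivative of \<open>g l m\<close>, and
  \<open>radial_ftc\<close> evaluates the integral to \<open>g l m x\<close>.
\<close>
lemma cauchy_solve:
  fixes v :: "'a::{real_algebra_1, euclidean_space} ^ 'n \<Rightarrow> 'a"
  assumes dp: "dirac_pair q a \<beta>" and \<Omega>: "open \<Omega>" and v: "Ck_on 3 \<Omega> v"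
    and Q: "closed Q" "bounded Q" "Q \<subseteq> \<Omega>"
    and vQ: "\<And>x l m. x \<in> \<Omega> - Q \<Longrightarrow> m \<in> {1..q} \<Longrightarrow> (\<Sum>j\<in>Basis. partial v (axis l j) x * a j m) = 0"
  obtains u where "Ck_on 1 UNIV u"
    "\<And>x l m. x \<in> \<Omega> \<Longrightarrow> m \<in> {1..q} \<Longrightarrow>
      (\<Sum>j\<in>Basis. partial u (axis l j) x * a j m) = (\<Sum>j\<in>Basis. partial v (axis l j) x * a j m)"
    "\<And>x. (\<And>y. x + axis l0 y \<notin> Q) \<Longrightarrow> u x = 0"
proof -
  define g where "g = (\<lambda>l m x. if x \<in> \<Omega> then \<Sum>j\<in>Basis. partial v (axis l j) x * a j m else 0)"
  define k where "k = (\<lambda>i x. \<Sum>m=1..q. g l0 m x * \<beta> i m)"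
  have oQ: "open (- Q)" using Q by auto
  have cover: "\<Omega> \<union> - Q = UNIV" using Q by auto
  have g0: "g l m x = 0" if "x \<notin> Q" "m \<in> {1..q}" for l m x using vQ that by (simp add: g_def)
  have k0: "k i x = 0" if "x \<notin> Q" for i x using g0 that by (simp add: k_def)
  have v3: "Ck_on (Suc 2) \<Omega> v" using v by simp
  have v2: "Ck_on 2 \<Omega> (partial v (axis l j))" if "j \<in> Basis" for l j
    by (rule Ck_partial[OF v3]) (simp add: that)
  have g2: "Ck_on 2 UNIV (g l m)" if m: "m \<in> {1..q}" for l m
  proof -
    have "Ck_on 2 \<Omega> (\<lambda>x. \<Sum>j\<in>Basis. partial v (axis l j) x * a j m)" by (intro Ck_sum_mult \<Omega> v2)
    then have "Ck_on 2 \<Omega> (g l m)" by (rule Ck_cong[OF _ \<Omega>]) (simp add: g_def)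
    moreover have "Ck_on 2 (- Q) (g l m)" by (rule Ck_cong[OF Ck_const[of 2 _ 0] oQ]) (use g0[OF _ m] in auto)
    ultimately show ?thesis using Ck_Un[OF _ _ \<Omega> oQ] cover by metis
  qed
  have k2: "Ck_on 2 UNIV (k i)" for i unfolding k_def by (rule Ck_sum_mult) (auto intro: g2)
  have g1: "Ck_on 1 UNIV (g l m)" if "m \<in> {1..q}" for l m by (rule Ck_le[OF g2[OF that]]) simp
  have k1: "Ck_on 1 UNIV (k i)" for i by (rule Ck_le[OF k2]) simp
  have kd: "k i differentiable (at x)" for i x using C1_differentiable[OF k1] by blast
  have two: "(2::nat) = Suc 1" by simp
  have pk1: "Ck_on 1 UNIV (partial (k i) (axis l j))" if "j \<in> Basis" for i l j
    by (rule Ck_partial[OF k2[unfolded two]]) (simp add: that)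
  have pg1: "Ck_on 1 UNIV (partial (g l m) (axis l' j))" if "j \<in> Basis" "m \<in> {1..q}" for l l' m j
    by (rule Ck_partial[OF g2[OF that(2), unfolded two]]) (simp add: that)

  define X where "X = (\<lambda>l m i z. (\<Sum>j\<in>Basis. partial (k i) (axis l j) z * a j m) - partial (g l m) (axis l0 i) z)"
  have X1: "Ck_on 1 UNIV (X l m i)" if "i \<in> Basis" "m \<in> {1..q}" for l m i
    unfolding X_def by (intro Ck_diff Ck_sum_mult open_UNIV pk1 pg1 that)
  have X0: "X l m i z = 0" if "z \<notin> Q" "m \<in> {1..q}" for l m i z
  proof -
    have z: "z \<in> - Q" using that by simp
    have "partial (k i) e z = 0" "partial (g l m) e z = 0" for i e
      by (rule partial_eq_0_on_open[OF oQ z]; use k0 g0[OF _ that(2)] in simp)+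
    then show ?thesis by (simp add: X_def)
  qed
  have divX: "(\<Sum>i\<in>Basis. partial (X l m i) (axis l0 i) z) = 0" if m: "m \<in> {1..q}" for l m z
  proof (cases "z \<in> Q")
    case False
    then have "partial (X l m i) (axis l0 i) z = 0" for i
      using partial_eq_0_on_open[OF oQ, of z "X l m i"] X0 m by simp
    then show ?thesis by simp
  next
    case True
    then have z: "z \<in> \<Omega>" using Q by auto
    \<comment> \<open>On \<open>\<Omega>\<close> the field \<open>X\<close> is the \<open>(l, m)\<close>-derivative of \<open>Y\<close>, which is already divergence-free.\<close>
    define Y where "Y = (\<lambda>i z. k i z - partial v (axis l0 i) z)"
    have Y2: "Ck_on 2 \<Omega> (Y i)" if "i \<in> Basis" for i
      unfolding Y_def by (intro Ck_diff \<Omega> Ck_subset[OF k2] v2 that) auto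
    have Yd: "Y i differentiable (at w)" if "i \<in> Basis" "w \<in> \<Omega>" for i w
      using Ck_differentiable[OF Y2[OF that(1), unfolded two] that(2)] .
    have pYd: "partial (Y i) (axis l j) differentiable (at w)" if "i \<in> Basis" "j \<in> Basis" "w \<in> \<Omega>" for i j l w
      by (rule C1_differentiable[OF Ck_partial[OF Y2[OF that(1), unfolded two]]]) (simp_all add: that)
    have pvd: "partial v (axis l j) differentiable (at w)" if "j \<in> Basis" "w \<in> \<Omega>" for l j w
      by (rule Ck_differentiable[OF v2[OF that(1), unfolded two] that(2)])
    have vc: "partial (partial v (axis l j)) (axis l' j') w = partial (partial v (axis l' j')) (axis l j) w"
      if "j \<in> Basis" "j' \<in> Basis" "w \<in> \<Omega>" for l l' j j' w
      by (rule partial_commute[OF \<Omega> Ck_le[OF v]]) (use that in auto)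
    have gp: "partial (g l m) e w = (\<Sum>j\<in>Basis. partial (partial v (axis l j)) e w * a j m)"
      if "w \<in> \<Omega>" "m \<in> {1..q}" for l m e w
    proof -
      have "partial (g l m) e w = partial (\<lambda>x. \<Sum>j\<in>Basis. partial v (axis l j) x * a j m) e w"
        by (rule partial_transform[OF C1_differentiable[OF g1[OF that(2)]] \<Omega> that(1)]) (auto simp: g_def)
      also have "\<dots> = (\<Sum>j\<in>Basis. partial (partial v (axis l j)) e w * a j m)"
        by (rule partial_sum_mult) (rule pvd[OF _ that(1)])
      finally show ?thesis .
    qed
    have XY: "X l m i w = (\<Sum>j\<in>Basis. partial (Y i) (axis l j) w * a j m)" if "i \<in> Basis" "w \<in> \<Omega>" for i w
    proof -
      have "partial (Y i) (axis l j) w = partial (k i) (axis l j) w - partial (partial v (axis l j)) (axis l0 i) w"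
        if "j \<in> Basis" for j
        unfolding Y_def using partial_diff[OF kd pvd[OF \<open>i \<in> Basis\<close> \<open>w \<in> \<Omega>\<close>]] vc[OF that \<open>i \<in> Basis\<close> \<open>w \<in> \<Omega>\<close>] by simp
      then show ?thesis unfolding X_def gp[OF \<open>w \<in> \<Omega>\<close> m]
        by (simp add: left_diff_distrib sum_subtractf)
    qed
    have divY: "(\<Sum>i\<in>Basis. partial (Y i) (axis l0 i) w) = 0" if w: "w \<in> \<Omega>" for w
    proof -
      have "(\<Sum>i\<in>Basis. partial (k i) (axis l0 i) w) =
         (\<Sum>i\<in>Basis. \<Sum>m=1..q. (\<Sum>j\<in>Basis. partial (partial v (axis l0 j)) (axis l0 i) w * a j m) * \<beta> i m)"
      proof (rule sum.cong[OF refl])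
        fix i :: 'a
        have "partial (k i) (axis l0 i) w = (\<Sum>m=1..q. partial (g l0 m) (axis l0 i) w * \<beta> i m)"
          unfolding k_def by (rule partial_sum_mult) (rule C1_differentiable[OF g1]; simp)
        also have "\<dots> = (\<Sum>m=1..q. (\<Sum>j\<in>Basis. partial (partial v (axis l0 j)) (axis l0 i) w * a j m) * \<beta> i m)"
          by (intro sum.cong refl arg_cong2[of _ _ _ _ "(*)"] gp w)
        finally show "partial (k i) (axis l0 i) w = (\<Sum>m=1..q. (\<Sum>j\<in>Basis. partial (partial v (axis l0 j)) (axis l0 i) w * a j m) * \<beta> i m)" .
      qed
      also have "\<dots> = (\<Sum>j\<in>Basis. partial (partial v (axis l0 j)) (axis l0 j) w)"
        by (rule dirac_pair_contract[OF dp]) (rule vc[OF _ _ w])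
      finally have "(\<Sum>i\<in>Basis. partial (k i) (axis l0 i) w - partial (partial v (axis l0 i)) (axis l0 i) w) = 0"
        by (simp add: sum_subtractf)
      moreover have "partial (Y i) (axis l0 i) w = partial (k i) (axis l0 i) w - partial (partial v (axis l0 i)) (axis l0 i) w"
        if "i \<in> Basis" for i
        unfolding Y_def by (rule partial_diff[OF kd pvd[OF that w]])
      ultimately show ?thesis by simp
    qed
    have "partial (X l m i) (axis l0 i) z = (\<Sum>j\<in>Basis. partial (partial (Y i) (axis l0 i)) (axis l j) z * a j m)"
      if i: "i \<in> Basis" for i
    proof -
      have "partial (X l m i) (axis l0 i) z = partial (\<lambda>w. \<Sum>j\<in>Basis. partial (Y i) (axis l j) w * a j m) (axis l0 i) z"
        by (rule partial_transform[OF C1_differentiable[OF X1[OF i m]] \<Omega> z]) (auto simp: XY i)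
      also have "\<dots> = (\<Sum>j\<in>Basis. partial (partial (Y i) (axis l j)) (axis l0 i) z * a j m)"
        by (rule partial_sum_mult) (rule pYd[OF i _ z])
      also have "\<dots> = (\<Sum>j\<in>Basis. partial (partial (Y i) (axis l0 i)) (axis l j) z * a j m)"
        by (intro sum.cong refl arg_cong2[of _ _ _ _ "(*)"] partial_commute[OF \<Omega> Y2[OF i] z]) (simp add: i)
      finally show ?thesis .
    qed
    then have "(\<Sum>i\<in>Basis. partial (X l m i) (axis l0 i) z) =
        (\<Sum>i\<in>Basis. \<Sum>j\<in>Basis. partial (partial (Y i) (axis l0 i)) (axis l j) z * a j m)" by simp
    also have "\<dots> = (\<Sum>j\<in>Basis. (\<Sum>i\<in>Basis. partial (partial (Y i) (axis l0 i)) (axis l j) z) * a j m)"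
      by (subst sum.swap) (simp add: sum_distrib_right)
    also have "\<dots> = (\<Sum>j\<in>Basis. partial (\<lambda>w. \<Sum>i\<in>Basis. partial (Y i) (axis l0 i) w) (axis l j) z * a j m)"
      using pYd z by (subst partial_sum) auto
    also have "\<dots> = 0"
      using partial_eq_0_on_open[OF \<Omega> z, of "\<lambda>w. \<Sum>i\<in>Basis. partial (Y i) (axis l0 i) w"] divY by simp
    finally show ?thesis .
  qed
  have flux: "integral std_box (\<lambda>y. \<Sum>i\<in>Basis. (shell y * (y \<bullet> i)) *\<^sub>R X l m i (x + s *\<^sub>R axis l0 y)) = 0"
    if m: "m \<in> {1..q}" for l m x s
  proof -
    have L: "linear (\<lambda>y::'a. s *\<^sub>R axis l0 y :: 'a ^ 'n)" by (intro linear_compose_scale_right linear_axis)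
    have bL: "continuous_on A (\<lambda>y::'a. s *\<^sub>R axis l0 y :: 'a ^ 'n)" for A
      using L linear_continuous_on linear_conv_bounded_linear by blast
    have io: "(\<lambda>y. (shell y * (y \<bullet> i)) *\<^sub>R X l m i (x + s *\<^sub>R axis l0 y)) integrable_on std_box" if "i \<in> Basis" for i
      by (rule integrable_translate[OF C1_continuous[OF X1[OF that m]] bL]) (auto intro!: continuous_intros continuous_shell)
    have io': "(\<lambda>y. shell_potential y *\<^sub>R partial (X l m i) e (x + s *\<^sub>R axis l0 y)) integrable_on std_box" if "i \<in> Basis" for i e
      by (rule integrable_translate[OF C1_partial_continuous[OF X1[OF that m]] bL])
        (auto intro!: continuous_on_subset[OF C1_continuous[OF C1_shell_potential]])
    have bp: "integral std_box (\<lambda>y. (shell y * (y \<bullet> i)) *\<^sub>R X l m i (x + s *\<^sub>R axis l0 y)) =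
      - (s *\<^sub>R integral std_box (\<lambda>y. shell_potential y *\<^sub>R partial (X l m i) (axis l0 i) (x + s *\<^sub>R axis l0 y)))"
      if i: "i \<in> Basis" for i
    proof -
      have "integral std_box (\<lambda>y. shell_potential y *\<^sub>R partial (X l m i) (s *\<^sub>R axis l0 i) (x + s *\<^sub>R axis l0 y)) =
        - integral std_box (\<lambda>y. partial shell_potential i y *\<^sub>R X l m i (x + s *\<^sub>R axis l0 y))"
        by (rule integral_by_parts[OF open_UNIV X1[OF i m] L _ C1_shell_potential shell_potential_eq_0]) auto
      moreover have "integral std_box (\<lambda>y. shell_potential y *\<^sub>R partial (X l m i) (s *\<^sub>R axis l0 i) (x + s *\<^sub>R axis l0 y)) =
        s *\<^sub>R integral std_box (\<lambda>y. shell_potential y *\<^sub>R partial (X l m i) (axis l0 i) (x + s *\<^sub>R axis l0 y))"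
        unfolding integral_cmul[symmetric]
        by (rule integral_cong) (simp add: linear_scale[OF linear_partial[OF C1_differentiable[OF X1[OF i m] UNIV_I]]])
      ultimately show ?thesis by (simp add: partial_shell_potential)
    qed
    define J where "J = (\<lambda>i. integral std_box (\<lambda>y. shell_potential y *\<^sub>R partial (X l m i) (axis l0 i) (x + s *\<^sub>R axis l0 y)))"
    have "integral std_box (\<lambda>y. \<Sum>i\<in>Basis. (shell y * (y \<bullet> i)) *\<^sub>R X l m i (x + s *\<^sub>R axis l0 y)) =
      (\<Sum>i\<in>Basis. integral std_box (\<lambda>y. (shell y * (y \<bullet> i)) *\<^sub>R X l m i (x + s *\<^sub>R axis l0 y)))"
      by (rule integral_sum) (auto intro: io)
    also have "\<dots> = (\<Sum>i\<in>Basis. - (s *\<^sub>R J i))"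
      unfolding J_def by (rule sum.cong[OF refl bp])
    also have "\<dots> = - (s *\<^sub>R (\<Sum>i\<in>Basis. J i))" by (simp add: sum_negf scaleR_sum_right)
    also have "(\<Sum>i\<in>Basis. J i) =
      integral std_box (\<lambda>y. \<Sum>i\<in>Basis. shell_potential y *\<^sub>R partial (X l m i) (axis l0 i) (x + s *\<^sub>R axis l0 y))"
      unfolding J_def
      by (rule integral_sum[symmetric]) (auto intro: io')
    also have "\<dots> = integral std_box (\<lambda>y::'a. 0::'a)"
      by (rule integral_cong) (simp add: scaleR_sum_right[symmetric] divX[OF m])
    finally show ?thesis by simp
  qed

  define c0 where "c0 = integral (std_box :: 'a set) shell"
  have c0: "0 < c0" unfolding c0_def by (rule shell_mass_pos)
  obtain R0 where R0: "0 < R0" "\<And>z. z \<in> Q \<Longrightarrow> norm z \<le> R0" using Q(2) bounded_pos by metis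
  define lo where "lo = - (3 *\<^sub>R One :: 'a)"
  define hi where "hi = (3 *\<^sub>R One :: 'a)"
  define w where "w = (\<lambda>i (p :: real \<times> 'a). shell (snd p) * (snd p \<bullet> i))"
  define sh where "sh = (\<lambda>p :: real \<times> 'a. fst p *\<^sub>R axis l0 (snd p) :: 'a ^ 'n)"
  have wc: "continuous_on A (w i)" for A i
    unfolding w_def by (intro continuous_intros continuous_on_compose2[OF continuous_shell[of UNIV]]) auto
  have shc: "continuous_on A sh" for A
    unfolding sh_def by (intro continuous_intros linear_continuous_on_compose[OF _ linear_axis])
  define U where "U = (\<lambda>R x. - (1 / c0) *\<^sub>R (\<Sum>i\<in>Basis. integral (cbox (0, lo) (R, hi)) (\<lambda>p. w i p *\<^sub>R k i (x + sh p))))"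
  define u where "u = (\<lambda>x. U (norm x + R0) x)"
  \<comment> \<open>The shell keeps \<open>norm y > 1\<close>, so beyond \<open>s = norm x + R0\<close> the integrand is 0.\<close>
  have far: "x + s *\<^sub>R axis l0 y \<notin> Q" if "norm x + R0 < s" "1 < norm y" for x s and y :: 'a
  proof
    assume "x + s *\<^sub>R axis l0 y \<in> Q"
    then have "norm (x + s *\<^sub>R axis l0 y) \<le> R0" by (rule R0)
    moreover have "norm (s *\<^sub>R axis l0 y :: 'a ^ 'n) \<le> norm (x + s *\<^sub>R axis l0 y) + norm x"
      using norm_triangle_ineq4[of "x + s *\<^sub>R axis l0 y" x] by simp
    moreover have s0: "0 < s" using that(1) R0(1) norm_ge_zero[of x] by linarith
    then have "s \<le> s * norm y" using that by simp
    then have "s \<le> norm (s *\<^sub>R axis l0 y :: 'a ^ 'n)" using s0 by simp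
    ultimately show False using that by linarith
  qed
  have shell_far: "shell y = 0 \<or> x + s *\<^sub>R axis l0 y \<notin> Q" if "norm x + R0 < s" for x s and y :: 'a
    using far[OF that, of y] shell_eq_0[of y] by linarith
  have Uu: "U R x = u x" if "norm x + R0 \<le> R" for R x
  proof -
    have "integral (cbox (0, lo) (R, hi)) (\<lambda>p. w i p *\<^sub>R k i (x + sh p)) =
      integral (cbox (0, lo) (norm x + R0, hi)) (\<lambda>p. w i p *\<^sub>R k i (x + sh p))" for i
    proof -
      let ?h = "\<lambda>p. w i p *\<^sub>R k i (x + sh p)"
      let ?A = "cbox (0, lo) (norm x + R0, hi)" and ?B = "cbox (0, lo) (R, hi)"
      have sub: "?A \<subseteq> ?B" using that by (auto simp: cbox_Pair_eq)
      have "(?h has_integral integral ?A ?h) ?A"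
        by (intro integrable_integral integrable_translate[OF C1_continuous[OF k1] shc wc]) auto
      then have "((\<lambda>p. if p \<in> ?A then ?h p else 0) has_integral integral ?A ?h) ?B"
        using has_integral_restrict[OF sub, of ?h "integral ?A ?h"] by blast
      then have "(?h has_integral integral ?A ?h) ?B"
      proof (rule has_integral_eq[rotated])
        fix p assume p: "p \<in> ?B"
        show "(if p \<in> ?A then ?h p else 0) = ?h p"
        proof (cases "p \<in> ?A")
          case False
          then have "norm x + R0 < fst p" using p by (cases p) (auto simp: cbox_Pair_eq)
          then have "shell (snd p) = 0 \<or> x + sh p \<notin> Q" unfolding sh_def by (rule shell_far)
          then show ?thesis using False k0[of "x + sh p"] by (auto simp: w_def)
        qed simp
      qed
      then show ?thesis by (rule integral_unique)
    qed
    then show ?thesis by (simp add: u_def U_def)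
  qed
  have UD: "(U R has_derivative (\<lambda>e. - (1 / c0) *\<^sub>R (\<Sum>i\<in>Basis. integral (cbox (0, lo) (R, hi)) (\<lambda>p. w i p *\<^sub>R partial (k i) e (x + sh p))))) (at x)" for R x
    unfolding U_def
    by (intro has_derivative_scaleR_right has_derivative_sum has_derivative_integral_translates[OF open_UNIV k1 shc wc]) auto
  have U1: "Ck_on 1 UNIV (U R)" for R
  proof (rule C1I[OF UD])
    fix e :: "'a ^ 'n"
    have "continuous_on UNIV (\<lambda>x. integral (cbox (0, lo) (R, hi)) (\<lambda>p. w i p *\<^sub>R partial (k i) e (x + sh p)))" for i
      using continuous_on_integral_translates[OF C1_partial_continuous[OF k1] shc wc] by simp
    then show "continuous_on UNIV (\<lambda>x. - (1 / c0) *\<^sub>R (\<Sum>i\<in>Basis. integral (cbox (0, lo) (R, hi)) (\<lambda>p. w i p *\<^sub>R partial (k i) e (x + sh p))))"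
      by (intro continuous_intros)
  qed
  \<comment> \<open>The range of integration in \<open>u\<close> depends on the point, but near \<open>x\<close> it may be replaced by a fixed one.\<close>
  have near: "u z = U (norm x + 1 + R0) z" if "z \<in> ball x 1" for x z
  proof -
    have "norm z \<le> norm x + 1" using norm_triangle_ineq4[of z "z - x"] that norm_triangle_ineq[of x "z - x"]
      by (simp add: dist_norm norm_minus_commute)
    then show ?thesis using Uu[of z] by simp
  qed
  show thesis
  proof (rule that)
    show "Ck_on 1 UNIV u"
    proof (rule Ck_local)
      fix x :: "'a ^ 'n"
      have "Ck_on 1 (ball x 1) u"
        by (rule Ck_cong[OF Ck_subset[OF U1] open_ball near[symmetric]]) auto
      then show "\<exists>U. open U \<and> x \<in> U \<and> Ck_on 1 U u" by (intro exI[of _ "ball x 1"]) auto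
    qed
  next
    fix x assume x: "\<And>y. x + axis l0 y \<notin> Q"
    have "k i (x + sh p) = 0" for i p
      using x[of "fst p *\<^sub>R snd p"] k0 by (simp add: sh_def linear_scale[OF linear_axis])
    then show "u x = 0" by (simp add: u_def U_def)
  next
    fix x l m assume x: "x \<in> \<Omega>" and m: "m \<in> {1..q}"
    define R where "R = norm x + 1 + R0"
    have R: "0 \<le> R" using R0 by (simp add: R_def)
    let ?B = "cbox (0, lo) (R, hi)"
    have "(u has_derivative (\<lambda>e. - (1 / c0) *\<^sub>R (\<Sum>i\<in>Basis. integral ?B (\<lambda>p. w i p *\<^sub>R partial (k i) e (x + sh p))))) (at x)"
      by (rule has_derivative_transform_within_open[OF UD open_ball[of x 1]]) (use near in \<open>auto simp: R_def\<close>)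
    then have pu: "partial u e x = - (1 / c0) *\<^sub>R (\<Sum>i\<in>Basis. integral ?B (\<lambda>p. w i p *\<^sub>R partial (k i) e (x + sh p)))" for e
      by (rule partialI)
    have io: "(\<lambda>p. w i p *\<^sub>R partial (k i) e (x + sh p)) integrable_on ?B" for i e
      by (rule integrable_translate[OF C1_partial_continuous[OF k1] shc wc]) auto
    have io2: "(\<lambda>p. w i p *\<^sub>R (\<Sum>j\<in>Basis. partial (k i) (axis l j) (x + sh p) * a j m)) integrable_on ?B" if "i \<in> Basis" for i
      by (rule integrable_translate[OF C1_continuous[OF Ck_sum_mult[OF open_UNIV pk1]] shc wc]) auto
    have "(\<Sum>j\<in>Basis. partial u (axis l j) x * a j m) =
      - (1 / c0) *\<^sub>R (\<Sum>j\<in>Basis. \<Sum>i\<in>Basis. integral ?B (\<lambda>p. w i p *\<^sub>R partial (k i) (axis l j) (x + sh p)) * a j m)"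
      unfolding pu scaleR_sum_right by (simp add: sum_distrib_right scaleR_sum_right)
    also have "(\<Sum>j\<in>Basis. \<Sum>i\<in>Basis. integral ?B (\<lambda>p. w i p *\<^sub>R partial (k i) (axis l j) (x + sh p)) * a j m) =
      (\<Sum>i\<in>Basis. \<Sum>j\<in>Basis. integral ?B (\<lambda>p. w i p *\<^sub>R partial (k i) (axis l j) (x + sh p) * a j m))"
      unfolding integral_mult_const[OF io, symmetric] by (rule sum.swap)
    also have "\<dots> = (\<Sum>i\<in>Basis. integral ?B (\<lambda>p. w i p *\<^sub>R (\<Sum>j\<in>Basis. partial (k i) (axis l j) (x + sh p) * a j m)))"
      unfolding scaleR_sum_right
      by (intro sum.cong refl, subst integral_sum)
        (auto intro: integrable_linear[OF io bounded_linear_mult_const, unfolded o_def] simp flip: mult_scaleR_left)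
    also have "\<dots> = integral ?B (\<lambda>p. \<Sum>i\<in>Basis. w i p *\<^sub>R (\<Sum>j\<in>Basis. partial (k i) (axis l j) (x + sh p) * a j m))"
      by (rule integral_sum[symmetric]) (auto intro: io2)
    also have "\<dots> = integral {0..R} (\<lambda>s. integral std_box (\<lambda>y. \<Sum>i\<in>Basis. w i (s, y) *\<^sub>R (\<Sum>j\<in>Basis. partial (k i) (axis l j) (x + sh (s, y)) * a j m)))"
    proof -
      have "continuous_on ?B (\<lambda>p. \<Sum>i\<in>Basis. w i p *\<^sub>R (\<Sum>j\<in>Basis. partial (k i) (axis l j) (x + sh p) * a j m))"
        by (intro continuous_on_sum continuous_on_translate[OF C1_continuous[OF Ck_sum_mult[OF open_UNIV pk1]] shc wc]) auto
      from integral_prod_continuous[OF this] show ?thesis by (simp add: lo_def hi_def)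
    qed
    also have "\<dots> = integral {0..R} (\<lambda>s. integral std_box (\<lambda>y. \<Sum>i\<in>Basis. (shell y * (y \<bullet> i)) *\<^sub>R partial (g l m) (axis l0 i) (x + s *\<^sub>R axis l0 y)))"
    proof (rule integral_cong)
      fix s
      have bL: "continuous_on A (\<lambda>y::'a. s *\<^sub>R axis l0 y :: 'a ^ 'n)" for A
        by (intro continuous_intros linear_continuous_on bounded_linear_axis)
      have ioX: "(\<lambda>y. \<Sum>i\<in>Basis. (shell y * (y \<bullet> i)) *\<^sub>R X l m i (x + s *\<^sub>R axis l0 y)) integrable_on std_box"
        by (intro integrable_sum integrable_translate[OF C1_continuous[OF X1[OF _ m]] bL])
          (auto intro!: continuous_intros continuous_shell)
      have ioG: "(\<lambda>y. \<Sum>i\<in>Basis. (shell y * (y \<bullet> i)) *\<^sub>R partial (g l m) (axis l0 i) (x + s *\<^sub>R axis l0 y)) integrable_on std_box"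
        by (intro integrable_sum integrable_translate[OF C1_partial_continuous[OF g1[OF m]] bL])
          (auto intro!: continuous_intros continuous_shell)
      have "integral std_box (\<lambda>y. \<Sum>i\<in>Basis. w i (s, y) *\<^sub>R (\<Sum>j\<in>Basis. partial (k i) (axis l j) (x + sh (s, y)) * a j m)) =
        integral std_box (\<lambda>y. (\<Sum>i\<in>Basis. (shell y * (y \<bullet> i)) *\<^sub>R X l m i (x + s *\<^sub>R axis l0 y)) +
          (\<Sum>i\<in>Basis. (shell y * (y \<bullet> i)) *\<^sub>R partial (g l m) (axis l0 i) (x + s *\<^sub>R axis l0 y)))"
        by (rule integral_cong) (simp add: X_def w_def sh_def sum.distrib[symmetric] scaleR_add_right[symmetric])
      then show "integral std_box (\<lambda>y. \<Sum>i\<in>Basis. w i (s, y) *\<^sub>R (\<Sum>j\<in>Basis. partial (k i) (axis l j) (x + sh (s, y)) * a j m)) =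
        integral std_box (\<lambda>y. \<Sum>i\<in>Basis. (shell y * (y \<bullet> i)) *\<^sub>R partial (g l m) (axis l0 i) (x + s *\<^sub>R axis l0 y))"
        by (simp add: integral_add[OF ioX ioG] flux[OF m])
    qed
    also have "\<dots> = integral std_box (\<lambda>y. shell y *\<^sub>R g l m (x + R *\<^sub>R axis l0 y)) - c0 *\<^sub>R g l m x"
      unfolding c0_def by (rule radial_ftc[OF g1[OF m] linear_axis R, symmetric]) simp
    also have "integral std_box (\<lambda>y. shell y *\<^sub>R g l m (x + R *\<^sub>R axis l0 y)) = integral std_box (\<lambda>y::'a. 0::'a)"
    proof (rule integral_cong)
      fix y :: 'a
      show "shell y *\<^sub>R g l m (x + R *\<^sub>R axis l0 y) = 0"
        using shell_far[of x R y] g0[OF _ m] by (auto simp: R_def)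
    qed
    finally have "(\<Sum>j\<in>Basis. partial u (axis l j) x * a j m) = g l m x" using c0 by simp
    then show "(\<Sum>j\<in>Basis. partial u (axis l j) x * a j m) = (\<Sum>j\<in>Basis. partial v (axis l j) x * a j m)"
      using x by (simp add: g_def)
  qed
qed

section \<open>The determinant of an endomorphism\<close>

lemma basis_det_cong: "(\<And>b. b \<in> Basis \<Longrightarrow> L b = L' b) \<Longrightarrow> basis_det L = basis_det L'"
  unfolding basis_det_def by (intro sum.cong prod.cong refl arg_cong2[of _ _ _ _ "(*)"]) simp

lemma basis_det_permute:
  fixes M :: "'a::euclidean_space \<Rightarrow> 'a"
  assumes \<pi>: "\<pi> permutes Basis"
  shows "basis_det (\<lambda>b. M (\<pi> b)) = of_int (sign \<pi>) * basis_det M"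
proof -
  have "basis_det (\<lambda>b. M (\<pi> b)) =
      (\<Sum>p | p permutes Basis. of_int (sign (p \<circ> \<pi>)) * (\<Prod>b\<in>Basis. M (\<pi> b) \<bullet> (p \<circ> \<pi>) b))"
    unfolding basis_det_def by (rule sum_permutations_compose_right[OF \<pi>])
  also have "\<dots> = (\<Sum>p | p permutes Basis. of_int (sign \<pi>) * (of_int (sign p) * (\<Prod>b\<in>Basis. M b \<bullet> p b)))"
  proof (rule sum.cong[OF refl])
    fix p :: "'a \<Rightarrow> 'a" assume "p \<in> {p. p permutes Basis}"
    then have "sign (p \<circ> \<pi>) = sign p * sign \<pi>"
      using \<pi> by (intro sign_compose permutes_imp_permutation[OF finite_Basis]) auto
    moreover have "(\<Prod>b\<in>Basis. M b \<bullet> p b) = (\<Prod>b\<in>Basis. M (\<pi> b) \<bullet> (p \<circ> \<pi>) b)"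
      using prod.permute[OF \<pi>, of "\<lambda>b. M b \<bullet> p b"] by (simp add: o_def)
    ultimately show "of_int (sign (p \<circ> \<pi>)) * (\<Prod>b\<in>Basis. M (\<pi> b) \<bullet> (p \<circ> \<pi>) b) =
      of_int (sign \<pi>) * (of_int (sign p) * (\<Prod>b\<in>Basis. M b \<bullet> p b))" by simp
  qed
  finally show ?thesis by (simp add: basis_det_def sum_distrib_left)
qed

lemma basis_det_not_inj:
  fixes M :: "'a::euclidean_space \<Rightarrow> 'a"
  assumes "b \<in> Basis" "c \<in> Basis" "b \<noteq> c" "M b = M c"
  shows "basis_det M = 0"
proof -
  have "basis_det (\<lambda>x. M (Transposition.transpose b c x)) = of_int (sign (Transposition.transpose b c)) * basis_det M"
    using assms by (intro basis_det_permute permutes_swap_id)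
  moreover have "(\<lambda>x. M (Transposition.transpose b c x)) = M" using assms(4) by (auto simp: Transposition.transpose_def fun_eq_iff)
  ultimately show ?thesis using assms(3) by (simp add: sign_swap_id)
qed

text \<open>
  Expanding every \<open>T (L b)\<close> in the basis gives a sum over all maps of the basis to itself, of which
  only the permutations contribute.
\<close>
lemma basis_det_compose:
  fixes T L :: "'a::euclidean_space \<Rightarrow> 'a"
  assumes T: "linear T"
  shows "basis_det (\<lambda>b. T (L b)) = basis_det L * basis_det T"
proof -
  let ?E = "PiE Basis (\<lambda>_. Basis) :: ('a \<Rightarrow> 'a) set"
  have fE: "finite ?E" by (simp add: finite_PiE)
  have exp: "T (L b) \<bullet> p = (\<Sum>c\<in>Basis. (L b \<bullet> c) * (T c \<bullet> p))" for b p
  proof -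
    have "T (L b) = T (\<Sum>c\<in>Basis. (L b \<bullet> c) *\<^sub>R c)" by (simp add: euclidean_representation)
    then show ?thesis by (simp add: linear_sum[OF T] linear_scale[OF T] inner_sum_left)
  qed
  have "basis_det (\<lambda>b. T (L b)) =
    (\<Sum>p | p permutes Basis. of_int (sign p) * (\<Sum>g\<in>?E. \<Prod>b\<in>Basis. (L b \<bullet> g b) * (T (g b) \<bullet> p b)))"
    unfolding basis_det_def exp by (subst prod_sum_PiE) auto
  also have "\<dots> = (\<Sum>p | p permutes Basis. \<Sum>g\<in>?E. (\<Prod>b\<in>Basis. L b \<bullet> g b) * (of_int (sign p) * (\<Prod>b\<in>Basis. T (g b) \<bullet> p b)))"
    by (simp add: prod.distrib sum_distrib_left mult_ac)
  also have "\<dots> = (\<Sum>g\<in>?E. (\<Prod>b\<in>Basis. L b \<bullet> g b) * basis_det (\<lambda>b. T (g b)))"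
    by (subst sum.swap) (simp add: basis_det_def sum_distrib_left)
  also have "\<dots> = (\<Sum>g | g \<in> ?E \<and> inj_on g Basis. (\<Prod>b\<in>Basis. L b \<bullet> g b) * basis_det (\<lambda>b. T (g b)))"
  proof (rule sum.mono_neutral_right[OF fE])
    show "\<forall>g\<in>?E - {g. g \<in> ?E \<and> inj_on g Basis}. (\<Prod>b\<in>Basis. L b \<bullet> g b) * basis_det (\<lambda>b. T (g b)) = 0"
    proof
      fix g assume "g \<in> ?E - {g. g \<in> ?E \<and> inj_on g Basis}"
      then obtain b c where "b \<in> Basis" "c \<in> Basis" "b \<noteq> c" "g b = g c" by (auto simp: inj_on_def)
      then have "basis_det (\<lambda>b. T (g b)) = 0" by (intro basis_det_not_inj[of b c]) auto
      then show "(\<Prod>b\<in>Basis. L b \<bullet> g b) * basis_det (\<lambda>b. T (g b)) = 0" by simp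
    qed
  qed auto
  also have "\<dots> = (\<Sum>p | p permutes Basis. (\<Prod>b\<in>Basis. L b \<bullet> p b) * basis_det (\<lambda>b. T (p b)))"
  proof (rule sum.reindex_cong[where l = "\<lambda>p. restrict p Basis"])
    show "inj_on (\<lambda>p. restrict p Basis) {p. p permutes (Basis :: 'a set)}"
    proof (rule inj_onI)
      fix p p' :: "'a \<Rightarrow> 'a"
      assume p: "p \<in> {p. p permutes Basis}" "p' \<in> {p. p permutes Basis}" "restrict p Basis = restrict p' Basis"
      show "p = p'"
      proof
        fix x
        show "p x = p' x"
          using p by (cases "x \<in> Basis") (metis restrict_apply', auto simp: permutes_not_in)
      qed
    qed
    show "{g. g \<in> ?E \<and> inj_on g Basis} = (\<lambda>p. restrict p Basis) ` {p. p permutes Basis}"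
    proof (intro set_eqI iffI)
      fix g assume g: "g \<in> {g. g \<in> ?E \<and> inj_on g Basis}"
      define p where "p = (\<lambda>x. if x \<in> Basis then g x else x)"
      have "g ` Basis = Basis" using g by (intro endo_inj_surj) auto
      then have "bij_betw g Basis Basis" using g by (auto simp: bij_betw_def)
      then have "bij_betw p Basis Basis" by (rule bij_betw_cong[THEN iffD1, rotated]) (simp add: p_def)
      then have "p permutes Basis" by (rule bij_imp_permutes) (simp add: p_def)
      moreover have "g = restrict p Basis" using g by (auto simp: p_def fun_eq_iff PiE_def extensional_def)
      ultimately show "g \<in> (\<lambda>p. restrict p Basis) ` {p. p permutes Basis}" by blast
    next
      fix g :: "'a \<Rightarrow> 'a" assume "g \<in> (\<lambda>p. restrict p Basis) ` {p. p permutes Basis}"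
      then obtain p where p: "p permutes Basis" "g = restrict p Basis" by blast
      then show "g \<in> {g. g \<in> ?E \<and> inj_on g Basis}"
        using permutes_in_image[OF p(1)] permutes_inj_on[OF p(1), of Basis] by (auto simp: inj_on_def)
    qed
    fix p :: "'a \<Rightarrow> 'a"
    show "(\<Prod>b\<in>Basis. L b \<bullet> restrict p Basis b) * basis_det (\<lambda>b. T (restrict p Basis b)) =
      (\<Prod>b\<in>Basis. L b \<bullet> p b) * basis_det (\<lambda>b. T (p b))"
      by (intro arg_cong2[of _ _ _ _ "(*)"] prod.cong basis_det_cong) auto
  qed
  also have "\<dots> = (\<Sum>p | p permutes Basis. of_int (sign p) * (\<Prod>b\<in>Basis. L b \<bullet> p b) * basis_det T)"
    by (rule sum.cong) (auto simp: basis_det_permute)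
  finally show ?thesis by (simp add: basis_det_def sum_distrib_right)
qed

lemma basis_det_scale_upd:
  fixes k v :: "'a::euclidean_space"
  assumes k: "k \<in> Basis"
  shows "basis_det ((\<lambda>b. c *\<^sub>R b)(k := v)) = c ^ (DIM('a) - 1) * (v \<bullet> k)"
proof -
  let ?L = "(\<lambda>b. c *\<^sub>R b)(k := v)"
  have "basis_det ?L = (\<Sum>p\<in>{id}. of_int (sign p) * (\<Prod>b\<in>Basis. ?L b \<bullet> p b))"
    unfolding basis_det_def
  proof (rule sum.mono_neutral_right)
    show "finite {p. p permutes (Basis :: 'a set)}" by (simp add: finite_permutations)
    show "{id} \<subseteq> {p. p permutes (Basis :: 'a set)}" by (simp add: permutes_id)
    show "\<forall>p\<in>{p. p permutes Basis} - {id}. of_int (sign p) * (\<Prod>b\<in>Basis. ?L b \<bullet> p b) = 0"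
    proof
      fix p :: "'a \<Rightarrow> 'a" assume p: "p \<in> {p. p permutes Basis} - {id}"
      have "\<exists>b\<in>Basis. b \<noteq> k \<and> p b \<noteq> b"
      proof (rule ccontr)
        assume n: "\<not> ?thesis"
        have "p permutes {k}"
        proof (rule permutes_superset)
          show "p permutes Basis" using p by simp
          show "\<And>x. x \<in> Basis - {k} \<Longrightarrow> p x = x" using n by blast
        qed
        then show False using p by (auto simp: permutes_sing)
      qed
      then obtain b where b: "b \<in> Basis" "b \<noteq> k" "p b \<noteq> b" by blast
      then have "p b \<in> Basis" using p permutes_in_image by fastforce
      then have "?L b \<bullet> p b = 0" using b by (simp add: inner_not_same_Basis)
      then have "(\<Prod>b\<in>Basis. ?L b \<bullet> p b) = 0" using b(1) by (intro prod_zero finite_Basis bexI[of _ b])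
      then show "of_int (sign p) * (\<Prod>b\<in>Basis. ?L b \<bullet> p b) = 0" by simp
    qed
  qed
  also have "\<dots> = (\<Prod>b\<in>Basis. ?L b \<bullet> b)" by simp
  also have "\<dots> = (v \<bullet> k) * (\<Prod>b\<in>Basis - {k}. ?L b \<bullet> b)"
    using prod.remove[OF finite_Basis k, of "\<lambda>b. ?L b \<bullet> b"] by simp
  also have "(\<Prod>b\<in>Basis - {k}. ?L b \<bullet> b) = (\<Prod>b\<in>Basis - {k}. c)"
    by (rule prod.cong) auto
  also have "\<dots> = c ^ (DIM('a) - 1)" using k by simp
  finally show ?thesis by (simp only: mult.commute)
qed

lemma basis_det_id: "basis_det (\<lambda>b::'a::euclidean_space. b) = 1"
proof -
  obtain k :: 'a where k: "k \<in> Basis" using nonempty_Basis by blast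
  have "(\<lambda>b. 1 *\<^sub>R b)(k := k) = (\<lambda>b. b)" by auto
  then show ?thesis using basis_det_scale_upd[OF k, of 1 k] k by simp
qed

lemma basis_det_nonzero:
  fixes T T' :: "'a::euclidean_space \<Rightarrow> 'a"
  assumes "linear T" "linear T'" "\<And>x. T (T' x) = x"
  shows "basis_det T \<noteq> 0"
  using basis_det_compose[OF assms(1), of T'] assms(3) by (auto simp: basis_det_id)

section \<open>Reflections and stereographic projection\<close>

text \<open>
  For \<open>u = 0\<close> the quotient is 0 by convention and \<open>refl_along u\<close> is the identity, so the orthogonality
  properties hold without a side condition.
\<close>
definition refl_along :: "'a::real_inner \<Rightarrow> 'a \<Rightarrow> 'a" where
  "refl_along u z = z - (2 * (z \<bullet> u) / (u \<bullet> u)) *\<^sub>R u"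

lemma linear_refl_along: "linear (refl_along u)"
  by (rule linearI) (simp_all add: refl_along_def inner_add_left algebra_simps add_divide_distrib)

lemma refl_along_refl_along [simp]: "refl_along u (refl_along u z) = z"
  by (cases "u = 0") (simp_all add: refl_along_def inner_diff_left algebra_simps)

lemma refl_along_sym: "refl_along u x \<bullet> y = x \<bullet> refl_along u y"
  by (simp add: refl_along_def inner_diff_left inner_diff_right inner_commute)

lemma refl_along_inner: "refl_along u x \<bullet> refl_along u y = x \<bullet> y"
  by (simp add: refl_along_sym)

lemma basis_det_refl_along_abs: "\<bar>basis_det (refl_along u)\<bar> = 1"
proof -
  have "basis_det (refl_along u) * basis_det (refl_along u) = 1"
    using basis_det_compose[OF linear_refl_along, of u "refl_along u"] by (simp add: basis_det_id)
  then show ?thesis by (metis abs_mult abs_one abs_mult_self_eq abs_square_eq_1 power2_eq_square)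
qed

text \<open>
  The determinant is \<open>\<plusminus>1\<close> for every reflection and depends continuously on the vector as long as it is
  not 0; moving \<open>t\<close> to 0 along a segment leads to the reflection in a basis vector.
\<close>
lemma basis_det_refl_along:
  fixes k t :: "'a::euclidean_space"
  assumes k: "k \<in> Basis" and t: "t \<bullet> k = 0"
  shows "basis_det (refl_along (t - k)) = -1"
proof -
  let ?f = "\<lambda>\<tau>. basis_det (refl_along (\<tau> *\<^sub>R t - k))"
  have "?f 0 = -1"
  proof -
    have "basis_det (refl_along (0 *\<^sub>R t - k)) = basis_det ((\<lambda>b. 1 *\<^sub>R b)(k := - k))"
      using k by (intro basis_det_cong) (auto simp: refl_along_def inner_not_same_Basis scaleR_2)
    then show ?thesis using basis_det_scale_upd[OF k, of 1 "- k"] k by simp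
  qed
  have nz: "(\<tau> *\<^sub>R t - k) \<bullet> (\<tau> *\<^sub>R t - k) \<noteq> 0" for \<tau>
  proof
    assume "(\<tau> *\<^sub>R t - k) \<bullet> (\<tau> *\<^sub>R t - k) = 0"
    then have "k = \<tau> *\<^sub>R t" by simp
    then have "k \<bullet> k = 0" using t by (simp add: inner_commute)
    then show False using k by simp
  qed
  have cont: "continuous_on {0..1} ?f"
    unfolding basis_det_def refl_along_def
    by (intro continuous_intros) (use nz in auto)
  \<comment> \<open>A value 1 would force a zero in between, but the determinant is never 0.\<close>
  have "?f 1 \<noteq> 1"
  proof
    assume "?f 1 = 1"
    then obtain \<tau> where "?f \<tau> = 0"
      using IVT'[of ?f 0 0 1] cont \<open>?f 0 = -1\<close> by auto
    then show False using basis_det_refl_along_abs[of "\<tau> *\<^sub>R t - k"] by simp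
  qed
  then show ?thesis using basis_det_refl_along_abs[of "t - k"] by (simp add: abs_if split: if_splits)
qed

text \<open>
  Inverse stereographic projection from the pole \<open>k\<close>.  At a point \<open>t\<close> of the hyperplane
  orthogonal to \<open>k\<close> it is conformal: its derivative along the hyperplane is
  \<open>2 / (t \<bullet> t + 1)\<close> times the reflection along \<open>t - k\<close>, and this reflection takes \<open>k\<close> to the point
  \<open>stereo k t\<close>, the outward normal of the sphere.  Hence its Jacobian determinants are immediate.
\<close>
definition stereo :: "'a::euclidean_space \<Rightarrow> 'a \<Rightarrow> 'a" where
  "stereo k t = k + (2 / (t \<bullet> t + 1)) *\<^sub>R (t - k)"

lemma inner_self_add_1_pos: "0 < (t::'a::real_inner) \<bullet> t + 1"
  using inner_ge_zero[of t] by linarith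

lemma stereo_eq_refl_along:
  assumes "k \<in> Basis" "t \<bullet> k = 0"
  shows "stereo k t = refl_along (t - k) k"
proof -
  have "(t - k) \<bullet> (t - k) = t \<bullet> t + 1" "k \<bullet> (t - k) = -1"
    using assms by (simp_all add: inner_diff_left inner_diff_right inner_commute)
  then show ?thesis by (simp add: stereo_def refl_along_def)
qed

lemma norm_stereo: "k \<in> Basis \<Longrightarrow> t \<bullet> k = 0 \<Longrightarrow> norm (stereo k t) = 1"
  by (simp add: stereo_eq_refl_along norm_eq_sqrt_inner refl_along_inner)

lemma has_derivative_stereo:
  "(stereo k has_derivative (\<lambda>v. (2 / (t \<bullet> t + 1)) *\<^sub>R v - (4 * (t \<bullet> v) / (t \<bullet> t + 1)\<^sup>2) *\<^sub>R (t - k))) (at t)"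
proof -
  have nz: "t \<bullet> t + 1 \<noteq> 0" using inner_self_add_1_pos[of t] by linarith
  have d: "((\<lambda>t. 2 / (t \<bullet> t + 1)) has_derivative (\<lambda>v. - (4 * (t \<bullet> v) / (t \<bullet> t + 1)\<^sup>2))) (at t)"
    by (rule has_derivative_eq_rhs[OF has_derivative_divide[OF has_derivative_const
        has_derivative_add[OF has_derivative_inner_self has_derivative_const] nz]])
      (simp add: fun_eq_iff power2_eq_square field_simps)
  have e: "((\<lambda>t. t - k) has_derivative (\<lambda>v. v)) (at t)" by (auto intro!: derivative_eq_intros)
  show ?thesis unfolding stereo_def[abs_def]
    by (rule has_derivative_eq_rhs[OF has_derivative_add[OF has_derivative_const has_derivative_scaleR[OF d e]]])
      (simp add: fun_eq_iff)
qed

lemma Ck_stereo: "Ck_on m UNIV (stereo k)"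
proof -
  have "Ck_on m UNIV (\<lambda>t. k + (2 *\<^sub>R inverse (t \<bullet> t + 1)) *\<^sub>R (t - k))"
    by (intro Ck_add Ck_scaleR Ck_const Ck_inverse Ck_inner_self Ck_diff Ck_linear bounded_linear_ident open_UNIV)
      (use inner_self_add_1_pos in \<open>metis less_irrefl\<close>)
  then show ?thesis by (simp add: stereo_def[abs_def] divide_inverse)
qed

lemma continuous_on_stereo: "continuous_on S (stereo k)"
  using continuous_on_subset[OF _ subset_UNIV] Ck_stereo[of 0 k] by simp

lemma stereo_partial:
  assumes k: "k \<in> Basis" and t: "t \<bullet> k = 0" and b: "b \<in> Basis" "b \<noteq> k"
  shows "partial (stereo k) b t = (2 / (t \<bullet> t + 1)) *\<^sub>R refl_along (t - k) b"
proof -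
  have "(t - k) \<bullet> (t - k) = t \<bullet> t + 1" "b \<bullet> (t - k) = t \<bullet> b"
    using assms by (simp_all add: inner_diff_left inner_diff_right inner_commute inner_not_same_Basis)
  then show ?thesis
    unfolding partialI[OF has_derivative_stereo]
    by (simp add: refl_along_def scaleR_diff_right power2_eq_square)
qed

lemma patch_det_stereo:
  fixes T T' :: "'a::euclidean_space \<Rightarrow> 'a"
  assumes T: "linear T" and T': "\<And>x. T (T' x) = x" and k: "k \<in> Basis" and t: "t \<in> hyperplane k"
  shows "patch_det k (\<lambda>t. T (stereo k t)) t v =
    - basis_det T * (2 / (t \<bullet> t + 1)) ^ (DIM('a) - 1) * (stereo k t \<bullet> T' v)"
proof -
  let ?c = "2 / (t \<bullet> t + 1)" and ?H = "refl_along (t - k)"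
  have tk: "t \<bullet> k = 0" using t by (simp add: hyperplane_def)
  have bT: "bounded_linear T" using T linear_conv_bounded_linear by blast
  have p: "partial (\<lambda>t. T (stereo k t)) b t = T (?H (?c *\<^sub>R b))" if "b \<in> Basis" "b \<noteq> k" for b
  proof -
    have "stereo k differentiable (at t)" using has_derivative_stereo by (auto simp: differentiable_def)
    then have "partial (\<lambda>t. T (stereo k t)) b t = T (partial (stereo k) b t)"
      by (intro partialI[OF bounded_linear.has_derivative[OF bT has_derivative_partial]])
    then show ?thesis by (simp add: stereo_partial[OF k tk that] linear_scale[OF linear_refl_along])
  qed
  have "patch_det k (\<lambda>t. T (stereo k t)) t v = basis_det (\<lambda>b. T (?H (((\<lambda>b. ?c *\<^sub>R b)(k := ?H (T' v))) b)))"
    unfolding patch_det_def by (rule basis_det_cong) (auto simp: p T')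
  also have "\<dots> = basis_det (\<lambda>b. ?H (((\<lambda>b. ?c *\<^sub>R b)(k := ?H (T' v))) b)) * basis_det T"
    by (rule basis_det_compose[OF T])
  also have "basis_det (\<lambda>b. ?H (((\<lambda>b. ?c *\<^sub>R b)(k := ?H (T' v))) b)) =
      basis_det ((\<lambda>b. ?c *\<^sub>R b)(k := ?H (T' v))) * basis_det ?H"
    by (rule basis_det_compose[OF linear_refl_along])
  also have "basis_det ((\<lambda>b. ?c *\<^sub>R b)(k := ?H (T' v))) = ?c ^ (DIM('a) - 1) * (?H (T' v) \<bullet> k)"
    by (rule basis_det_scale_upd[OF k])
  also have "?H (T' v) \<bullet> k = T' v \<bullet> ?H k" by (rule refl_along_sym)
  also have "\<dots> = stereo k t \<bullet> T' v" by (simp only: stereo_eq_refl_along[OF k tk] inner_commute)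
  finally show ?thesis by (simp add: basis_det_refl_along[OF k tk])
qed

section \<open>Boundary integrals over ellipsoids\<close>

text \<open>
  Together with its mirror image under the reflection in \<open>k\<close> this is a partition of unity on the sphere.  Each
  half lives on a closed half sphere, over which the stereographic parameters stay bounded.
\<close>
definition half_weight :: "'a::euclidean_space \<Rightarrow> 'a \<Rightarrow> real" where
  "half_weight k z = (if z \<bullet> k < 0 then 1 else if z \<bullet> k = 0 then 1 / 2 else 0)"

lemma half_weight_refl_along: "k \<in> Basis \<Longrightarrow> half_weight k z + half_weight k (refl_along k z) = 1"
  by (simp add: half_weight_def refl_along_def inner_diff_left)

lemma half_weight_nonneg: "0 \<le> half_weight k z" by (simp add: half_weight_def)

lemma half_weight_le_1: "half_weight k z \<le> 1" by (simp add: half_weight_def)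

lemma half_weight_measurable [measurable]: "half_weight k \<in> borel_measurable borel"
  unfolding half_weight_def[abs_def] by measurable

lemma stereo_inner: "k \<in> Basis \<Longrightarrow> t \<bullet> k = 0 \<Longrightarrow> stereo k t \<bullet> k = 1 - 2 / (t \<bullet> t + 1)"
  by (simp add: stereo_def inner_add_left inner_diff_left)

lemma inj_on_stereo:
  assumes k: "k \<in> Basis"
  shows "inj_on (stereo k) (hyperplane k)"
proof (rule inj_onI)
  fix t t' assume t: "t \<in> hyperplane k" "t' \<in> hyperplane k" and eq: "stereo k t = stereo k t'"
  have "2 / (t \<bullet> t + 1) = 2 / (t' \<bullet> t' + 1)"
    using stereo_inner[OF k, of t] stereo_inner[OF k, of t'] t eq by (simp add: hyperplane_def)
  moreover have "2 / (t \<bullet> t + 1) \<noteq> 0" using inner_self_add_1_pos[of t] by simp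
  ultimately have "t - k = t' - k" using eq unfolding stereo_def by (metis add_left_cancel scaleR_cancel_left)
  then show "t = t'" by simp
qed

lemma stereo_surj:
  assumes k: "k \<in> Basis" and z: "norm z = 1" "z \<bullet> k \<le> 0"
  obtains t where "t \<in> hyperplane k" "stereo k t = z"
proof -
  define c where "c = z \<bullet> k"
  have c: "1 - c \<noteq> 0" using z by (simp add: c_def)
  define t where "t = (1 / (1 - c)) *\<^sub>R (z - c *\<^sub>R k)"
  have zz: "z \<bullet> z = 1" using z(1) by (simp add: dot_square_norm)
  have tk: "t \<bullet> k = 0" using k by (simp add: t_def inner_diff_left c_def)
  have "(z - c *\<^sub>R k) \<bullet> (z - c *\<^sub>R k) = 1 - c\<^sup>2"
    using zz k by (simp add: inner_diff_left inner_diff_right c_def inner_commute power2_eq_square)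
  also have "\<dots> = (1 - c) * (1 + c)" by (simp add: power2_eq_square algebra_simps)
  finally have "t \<bullet> t = (1 + c) / (1 - c)" by (simp add: t_def)
  then have tt: "t \<bullet> t + 1 = 2 / (1 - c)" using c by (simp add: field_simps)
  have "stereo k t = k + (1 - c) *\<^sub>R (t - k)" unfolding stereo_def tt by simp
  also have "\<dots> = k + (1 - c) *\<^sub>R t - (1 - c) *\<^sub>R k" by (simp add: scaleR_diff_right)
  also have "(1 - c) *\<^sub>R t = z - c *\<^sub>R k" using c by (simp add: t_def)
  also have "k + (z - c *\<^sub>R k) - (1 - c) *\<^sub>R k = z" by (simp add: algebra_simps)
  finally show thesis using that[of t] tk by (simp add: hyperplane_def)
qed

lemma half_weight_stereo_eq_0:
  assumes "k \<in> Basis" "t \<in> hyperplane k" "1 < norm t"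
  shows "half_weight k (stereo k t) = 0"
proof -
  have "1 < t \<bullet> t" using assms(3) power_strict_mono[of 1 "norm t" 2] by (simp add: dot_square_norm)
  then have "2 / (t \<bullet> t + 1) < 1" by simp
  moreover have "stereo k t \<bullet> k = 1 - 2 / (t \<bullet> t + 1)"
    using stereo_inner[of k t] assms by (simp add: hyperplane_def)
  ultimately have "0 < stereo k t \<bullet> k" by linarith
  then show ?thesis by (simp add: half_weight_def)
qed

lemma ellipsoid_eq:
  assumes "\<And>x. T (T' x) = x" "\<And>x. T' (T x) = x"
  shows "T ` ball 0 1 = {x. norm (T' x) < 1}"
proof (intro set_eqI iffI)
  fix x assume "x \<in> {x. norm (T' x) < 1}"
  then show "x \<in> T ` ball 0 1" using assms by (intro image_eqI[of _ _ "T' x"]) auto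
qed (use assms in auto)

lemma frontier_ellipsoid:
  fixes T T' :: "'a::euclidean_space \<Rightarrow> 'a"
  assumes T: "linear T" and inv: "\<And>x. T (T' x) = x" "\<And>x. T' (T x) = x"
  shows "frontier (T ` ball 0 1) = {x. norm (T' x) = 1}"
proof -
  have inj: "inj T" using inv(2) by (metis injI)
  have "frontier (T ` ball 0 1) = T ` cball 0 1 - T ` ball 0 1"
    using closure_injective_linear_image[OF T inj, of "ball 0 1"] interior_injective_linear_image[OF T inj, of "ball 0 1"]
    by (simp add: frontier_def interior_open)
  also have "\<dots> = T ` sphere 0 1"
    using image_set_diff[OF inj, of "cball 0 1" "ball 0 1"] by (simp add: cball_diff_eq_sphere)
  also have "\<dots> = {x. norm (T' x) = 1}"
  proof (intro set_eqI iffI)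
    fix x assume "x \<in> {x. norm (T' x) = 1}"
    then show "x \<in> T ` sphere 0 1" using inv by (intro image_eqI[of _ _ "T' x"]) auto
  qed (use inv in auto)
  finally show ?thesis .
qed

lemma ellipsoid_defining_derivative:
  fixes T' :: "'a::euclidean_space \<Rightarrow> 'a"
  assumes T': "linear T'"
  shows "((\<lambda>x. T' x \<bullet> T' x - 1) has_derivative (\<lambda>v. 2 * (T' p \<bullet> T' v))) (at p)"
proof -
  have "bounded_linear T'" using T' linear_conv_bounded_linear by blast
  then have "(T' has_derivative T') (at p)" by (rule bounded_linear_imp_has_derivative)
  then show ?thesis by (auto intro!: derivative_eq_intros simp: inner_commute)
qed

lemma ellipsoid_local_defining:
  fixes T T' :: "'a::euclidean_space \<Rightarrow> 'a"
  assumes T': "linear T'" and inv: "\<And>x. T (T' x) = x" "\<And>x. T' (T x) = x"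
    and p: "norm (T' p) = 1"
  shows "local_defining_function (T ` ball 0 1) p UNIV (\<lambda>x. T' x \<bullet> T' x - 1)"
  unfolding local_defining_function_def
proof (intro conjI ballI)
  have b: "bounded_linear T'" using T' linear_conv_bounded_linear by blast
  show "smooth_on UNIV (\<lambda>x. T' x \<bullet> T' x - 1)"
    unfolding smooth_on_def
  proof
    fix k
    have "Ck_on k UNIV (\<lambda>x. (\<Sum>i\<in>Basis. (T' x \<bullet> i) *\<^sub>R (T' x \<bullet> i)) - 1)"
      by (intro Ck_diff Ck_sum Ck_scaleR Ck_const open_UNIV Ck_linear
          bounded_linear_compose[OF bounded_linear_inner_left b])
    then show "Ck_on k UNIV (\<lambda>x. T' x \<bullet> T' x - 1)" by (simp add: euclidean_inner[symmetric])
  qed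
  show "x \<in> T ` ball 0 1 \<longleftrightarrow> T' x \<bullet> T' x - 1 < 0" for x
    unfolding ellipsoid_eq[OF inv] by (simp add: dot_square_norm power_less_one_iff abs_square_less_1)
  have d: "(\<lambda>x. T' x \<bullet> T' x - 1) differentiable (at p)"
    using ellipsoid_defining_derivative[OF T'] by (auto simp: differentiable_def)
  show "\<exists>j\<in>Basis. partial (\<lambda>x. T' x \<bullet> T' x - 1) j p \<noteq> 0"
  proof (rule ccontr)
    assume "\<not> ?thesis"
    then have "partial (\<lambda>x. T' x \<bullet> T' x - 1) p p = 0" unfolding partial_expand[OF d, of p] by simp
    then show False using partialI[OF ellipsoid_defining_derivative[OF T'], of p p] p by (simp add: dot_square_norm)
  qed
qed auto

lemma ellipsoid_bounded_smooth_domain: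
  fixes T T' :: "'a::euclidean_space \<Rightarrow> 'a"
  assumes T: "linear T" and T': "linear T'" and inv: "\<And>x. T (T' x) = x" "\<And>x. T' (T x) = x"
  shows "bounded_smooth_domain (T ` ball 0 1)"
  unfolding bounded_smooth_domain_def
proof (intro conjI ballI)
  have b: "bounded_linear T" "bounded_linear T'" using T T' linear_conv_bounded_linear by blast+
  show "open (T ` ball 0 1)"
    unfolding ellipsoid_eq[OF inv]
    by (intro open_Collect_less continuous_on_norm linear_continuous_on b continuous_on_const)
  show "connected (T ` ball 0 1)"
    by (intro connected_continuous_image linear_continuous_on b connected_ball)
  show "bounded (T ` ball 0 1)" by (intro bounded_linear_image b bounded_ball)
  fix p assume "p \<in> frontier (T ` ball 0 1)"
  then show "\<exists>U \<rho>. local_defining_function (T ` ball 0 1) p U \<rho>"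
    using ellipsoid_local_defining[OF T' inv] unfolding frontier_ellipsoid[OF T inv] by blast
qed auto

text \<open>
  The sign is opposite to that of \<open>T\<close> because the reflections in the derivative of \<open>stereo\<close> have
  determinant -1.
\<close>
definition ellipsoid_patch :: "'a::euclidean_space \<Rightarrow> ('a \<Rightarrow> 'a) \<Rightarrow> ('a \<Rightarrow> 'a) \<Rightarrow> 'a patch" where
  "ellipsoid_patch k T T' = (k, - sgn (basis_det T), UNIV, \<lambda>t. T (stereo k t), \<lambda>p. half_weight k (T' p))"

lemma boundary_patch_ellipsoid:
  fixes T T' :: "'a::euclidean_space \<Rightarrow> 'a"
  assumes T: "linear T" and T': "linear T'" and inv: "\<And>x. T (T' x) = x" "\<And>x. T' (T x) = x"
    and k: "k \<in> Basis"
  shows "boundary_patch (T ` ball 0 1) (ellipsoid_patch k T T')"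
proof -
  have b: "bounded_linear T" "bounded_linear T'" using T T' linear_conv_bounded_linear by blast+
  have dT: "basis_det T \<noteq> 0" by (rule basis_det_nonzero[OF T T' inv(1)])
  have nrm: "norm (stereo k t) = 1" if "t \<in> hyperplane k" for t
    using norm_stereo[OF k] that by (simp add: hyperplane_def)
  have sm: "smooth_on UNIV (\<lambda>t. T (stereo k t))"
    unfolding smooth_on_def using Ck_bounded_linear[OF b(1) open_UNIV Ck_stereo] by blast
  have inj: "inj_on (\<lambda>t. T (stereo k t)) (hyperplane k)"
    using inj_on_stereo[OF k] inv(2) by (metis (no_types, lifting) inj_on_def)
  have im: "(\<lambda>t. T (stereo k t)) ` hyperplane k \<subseteq> frontier (T ` ball 0 1)"
    unfolding frontier_ellipsoid[OF T inv] using nrm inv by auto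
  have orient: "\<exists>\<nu>. outward_unit_normal (T ` ball 0 1) (T (stereo k t)) \<nu> \<and>
    - sgn (basis_det T) * patch_det k (\<lambda>t. T (stereo k t)) t \<nu> > 0" if t: "t \<in> hyperplane k" for t
  proof -
    let ?z = "stereo k t"
    \<comment> \<open>Normal vectors of the ellipsoid are images of those of the sphere under the inverse transpose of \<open>T\<close>.\<close>
    define n where "n = adjoint T' ?z"
    have n: "n \<bullet> v = ?z \<bullet> T' v" for v
      using adjoint_works[OF T', of v ?z] by (simp add: n_def inner_commute)
    have "n \<bullet> T ?z = 1" using nrm[OF t] by (simp add: n inv dot_square_norm)
    then have n0: "n \<noteq> 0" by auto
    define \<nu> where "\<nu> = (1 / norm n) *\<^sub>R n"
    have \<nu>: "norm \<nu> = 1" "n = norm n *\<^sub>R \<nu>" using n0 by (auto simp: \<nu>_def)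
    have "outward_unit_normal (T ` ball 0 1) (T ?z) \<nu>"
      unfolding outward_unit_normal_def
    proof (intro conjI exI)
      show "norm \<nu> = 1" by fact
      show "local_defining_function (T ` ball 0 1) (T ?z) UNIV (\<lambda>x. T' x \<bullet> T' x - 1)"
        by (rule ellipsoid_local_defining[OF T' inv]) (simp add: inv nrm[OF t])
      show "2 * norm n > 0" using n0 by simp
      have eq: "2 * (T' (T ?z) \<bullet> T' v) = 2 * norm n * (\<nu> \<bullet> v)" for v
        using n[of v] by (simp add: inv \<nu>_def n0)
      show "((\<lambda>x. T' x \<bullet> T' x - 1) has_derivative (\<lambda>v. 2 * norm n * (\<nu> \<bullet> v))) (at (T ?z))"
        by (rule has_derivative_eq_rhs[OF ellipsoid_defining_derivative[OF T']]) (rule ext, rule eq)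
    qed
    moreover have "- sgn (basis_det T) * patch_det k (\<lambda>t. T (stereo k t)) t \<nu> > 0"
    proof -
      have "?z \<bullet> T' \<nu> = norm n"
        using n[of \<nu>, symmetric] n0 by (simp add: \<nu>_def dot_square_norm power2_eq_square)
      then have "- sgn (basis_det T) * patch_det k (\<lambda>t. T (stereo k t)) t \<nu> =
          \<bar>basis_det T\<bar> * ((2 / (t \<bullet> t + 1)) ^ (DIM('a) - 1) * norm n)"
        unfolding patch_det_stereo[OF T inv(1) k t] by (simp add: abs_sgn mult_ac)
      also have "\<dots> > 0" using dT n0 inner_self_add_1_pos[of t] by simp
      finally show ?thesis .
    qed
    ultimately show ?thesis by blast
  qed
  have cov: "p \<in> (\<lambda>t. T (stereo k t)) ` hyperplane k"
    if p: "p \<in> frontier (T ` ball 0 1)" "half_weight k (T' p) \<noteq> 0" for p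
  proof -
    have "norm (T' p) = 1" using p(1) unfolding frontier_ellipsoid[OF T inv] by simp
    moreover have "T' p \<bullet> k \<le> 0" using p(2) by (auto simp: half_weight_def split: if_splits)
    ultimately obtain t where "t \<in> hyperplane k" "stereo k t = T' p" using stereo_surj[OF k] by blast
    then show ?thesis using inv by (intro image_eqI[of _ _ t]) auto
  qed
  have "T' \<in> borel_measurable borel"
    by (intro borel_measurable_continuous_onI linear_continuous_on b)
  then have "(\<lambda>p. half_weight k (T' p)) \<in> borel_measurable borel" by measurable
  then show ?thesis
    unfolding ellipsoid_patch_def boundary_patch.simps
    using k dT sm inj im orient cov half_weight_nonneg by (auto simp: sgn_if)
qed

text \<open>
  Integration over the half sphere opposite to \<open>k\<close>: the power is the Jacobian of \<open>stereo\<close>.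
\<close>
definition cap_integral :: "'a::euclidean_space \<Rightarrow> ('a \<Rightarrow> 'b::euclidean_space) \<Rightarrow> 'b" where
  "cap_integral k F = (LINT t:hyperplane k|hyperplane_lborel k.
     (half_weight k (stereo k t) * (2 / (t \<bullet> t + 1)) ^ (DIM('a) - 1)) *\<^sub>R F (stereo k t))"

lemma patch_integral_ellipsoid:
  fixes T T' :: "'a::euclidean_space \<Rightarrow> 'a" and \<eta> :: "'a \<Rightarrow> 'a \<Rightarrow> 'b::euclidean_space"
  assumes T: "linear T" and T': "linear T'" and inv: "\<And>x. T (T' x) = x" "\<And>x. T' (T x) = x"
    and k: "k \<in> Basis"
  shows "patch_integral \<eta> (ellipsoid_patch k T T') =
    \<bar>basis_det T\<bar> *\<^sub>R cap_integral k (\<lambda>z. \<Sum>j\<in>Basis. (z \<bullet> T' j) *\<^sub>R \<eta> (T z) j)"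
proof -
  let ?d = "basis_det T"
  have dT: "?d \<noteq> 0" by (rule basis_det_nonzero[OF T T' inv(1)])
  let ?w = "\<lambda>t. half_weight k (stereo k t) * (2 / (t \<bullet> t + 1)) ^ (DIM('a) - 1)"
  let ?G = "\<lambda>z. \<Sum>j\<in>Basis. (z \<bullet> T' j) *\<^sub>R \<eta> (T z) j"
  have eq: "indicator (hyperplane k) t *\<^sub>R (half_weight k (T' (T (stereo k t))) *\<^sub>R
        (\<Sum>j\<in>Basis. patch_det k (\<lambda>t. T (stereo k t)) t j *\<^sub>R \<eta> (T (stereo k t)) j)) =
      (- ?d) *\<^sub>R (indicator (hyperplane k) t *\<^sub>R ?w t *\<^sub>R ?G (stereo k t))" for t
  proof (cases "t \<in> hyperplane k")
    case True
    show ?thesis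
      unfolding patch_det_stereo[OF T inv(1) k True]
      using True by (simp add: inv scaleR_sum_right sum_negf mult_ac)
  qed simp
  have "patch_integral \<eta> (ellipsoid_patch k T T') = (- sgn ?d) *\<^sub>R
     (LINT t|hyperplane_lborel k. (- ?d) *\<^sub>R (indicator (hyperplane k) t *\<^sub>R ?w t *\<^sub>R ?G (stereo k t)))"
    by (simp only: ellipsoid_patch_def patch_integral.simps set_lebesgue_integral_def eq Int_UNIV_left)
  also have "(LINT t|hyperplane_lborel k. (- ?d) *\<^sub>R (indicator (hyperplane k) t *\<^sub>R ?w t *\<^sub>R ?G (stereo k t))) =
      (- ?d) *\<^sub>R cap_integral k ?G"
    unfolding cap_integral_def set_lebesgue_integral_def by (rule integral_scaleR_right)
  finally show ?thesis by (simp add: abs_sgn mult.commute)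
qed

text \<open>
  The two patches are those of \<open>T\<close> and of \<open>T\<close> composed with the reflection in \<open>k\<close>; both maps take
  the unit ball to the same ellipsoid.
\<close>
lemma boundary_integral_ellipsoid:
  fixes T T' :: "'a::euclidean_space \<Rightarrow> 'a" and \<eta> :: "'a \<Rightarrow> 'a \<Rightarrow> 'b::euclidean_space"
  assumes T: "linear T" and T': "linear T'" and inv: "\<And>x. T (T' x) = x" "\<And>x. T' (T x) = x"
    and k: "k \<in> Basis" and I: "has_boundary_integral (T ` ball 0 1) \<eta> I"
    and G: "\<And>z. G z = (\<Sum>j\<in>Basis. (z \<bullet> T' j) *\<^sub>R \<eta> (T z) j)"
  shows "\<bar>basis_det T\<bar> *\<^sub>R (cap_integral k G + cap_integral k (\<lambda>z. G (refl_along k z))) = I"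
proof -
  let ?R = "refl_along k"
  let ?S = "\<lambda>x. T (?R x)" and ?S' = "\<lambda>x. ?R (T' x)"
  have S: "linear ?S" "linear ?S'" 
    using linear_compose[OF linear_refl_along T] linear_compose[OF T' linear_refl_along] by (simp_all add: o_def)
  have Sinv: "\<And>x. ?S (?S' x) = x" "\<And>x. ?S' (?S x) = x" using inv by simp_all
  have img: "?S ` ball 0 1 = T ` ball 0 1"
    unfolding ellipsoid_eq[OF Sinv] ellipsoid_eq[OF inv] by (simp add: norm_eq_sqrt_inner refl_along_inner)
  let ?Ps = "[ellipsoid_patch k T T', ellipsoid_patch k ?S ?S']"
  have "boundary_partition (T ` ball 0 1) ?Ps"
    unfolding boundary_partition_def
    using boundary_patch_ellipsoid[OF T T' inv k] boundary_patch_ellipsoid[OF S Sinv k] half_weight_refl_along[OF k]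
    by (auto simp: img) (simp_all add: ellipsoid_patch_def)
  then have "(\<Sum>P\<leftarrow>?Ps. patch_integral \<eta> P) = I" using I unfolding has_boundary_integral_def by blast
  then have "\<bar>basis_det T\<bar> *\<^sub>R cap_integral k (\<lambda>z. \<Sum>j\<in>Basis. (z \<bullet> T' j) *\<^sub>R \<eta> (T z) j) +
    \<bar>basis_det ?S\<bar> *\<^sub>R cap_integral k (\<lambda>z. \<Sum>j\<in>Basis. (z \<bullet> ?S' j) *\<^sub>R \<eta> (?S z) j) = I"
    by (simp add: patch_integral_ellipsoid[OF T T' inv k] patch_integral_ellipsoid[OF S Sinv k])
  moreover have "\<bar>basis_det ?S\<bar> = \<bar>basis_det T\<bar>"
    using basis_det_compose[OF T, of ?R] by (simp add: abs_mult basis_det_refl_along_abs)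
  ultimately show ?thesis unfolding G by (simp add: scaleR_add_right refl_along_sym)
qed

section \<open>The averaging functional on the sphere\<close>

definition plane_point :: "'a::euclidean_space \<Rightarrow> ('a \<Rightarrow> real) \<Rightarrow> 'a" where
  "plane_point k \<tau> = (\<Sum>b\<in>Basis - {k}. \<tau> b *\<^sub>R b)"

lemma hyperplane_lborel_eq:
  "hyperplane_lborel k = distr (\<Pi>\<^sub>M b\<in>Basis - {k}. lborel) borel (plane_point k)"
  by (simp add: hyperplane_lborel_def plane_point_def[abs_def])

lemma sets_hyperplane_lborel [measurable_cong, simp]: "sets (hyperplane_lborel k) = sets borel"
  by (simp add: hyperplane_lborel_eq)

lemma plane_point_measurable [measurable]:
  "plane_point k \<in> (\<Pi>\<^sub>M b\<in>Basis - {k}. lborel) \<rightarrow>\<^sub>M borel"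
proof -
  have "(\<lambda>\<tau>. \<tau> b) \<in> borel_measurable (\<Pi>\<^sub>M b\<in>Basis - {k}. lborel)" if "b \<in> Basis - {k}" for b
    using measurable_component_singleton[OF that, of "\<lambda>_. lborel"] by simp
  then show ?thesis unfolding plane_point_def[abs_def] 
    by (intro borel_measurable_sum borel_measurable_scaleR borel_measurable_const)
qed

lemma plane_point_inner: "b \<in> Basis - {k} \<Longrightarrow> plane_point k \<tau> \<bullet> b = \<tau> b"
  by (simp add: plane_point_def inner_sum_left inner_Basis if_distrib cong: if_cong)

lemma plane_point_in_hyperplane: "k \<in> Basis \<Longrightarrow> plane_point k \<tau> \<in> hyperplane k"
  unfolding plane_point_def hyperplane_def
  by (auto simp: inner_sum_left inner_Basis intro!: sum.neutral)

lemma emeasure_PiM_lborel: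
  assumes "finite I" "\<And>i. i \<in> I \<Longrightarrow> A i \<in> sets lborel"
  shows "emeasure (\<Pi>\<^sub>M b\<in>I. lborel) (PiE I A) = (\<Prod>i\<in>I. emeasure lborel (A i :: real set))"
proof -
  interpret product_sigma_finite "\<lambda>_::'a. lborel :: real measure" by standard
  show ?thesis by (rule emeasure_PiM[OF assms])
qed

lemma emeasure_hyperplane_cball: "emeasure (hyperplane_lborel k) (cball (0::'a::euclidean_space) 1) < \<infinity>"
proof -
  let ?M = "\<Pi>\<^sub>M b\<in>Basis - {k::'a}. lborel :: real measure"
  let ?A = "PiE (Basis - {k}) (\<lambda>_. {-1..1::real})"
  have "emeasure (hyperplane_lborel k) (cball 0 1) = emeasure ?M (plane_point k -` cball 0 1 \<inter> space ?M)"
    unfolding hyperplane_lborel_eq by (intro emeasure_distr plane_point_measurable) simp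
  also have "\<dots> \<le> emeasure ?M ?A"
  proof (rule emeasure_mono)
    show "?A \<in> sets ?M" by (intro sets_PiM_I_finite) auto
    show "plane_point k -` cball 0 1 \<inter> space ?M \<subseteq> ?A"
    proof
      fix \<tau> assume \<tau>: "\<tau> \<in> plane_point k -` cball 0 1 \<inter> space ?M"
      have "\<tau> b \<in> {-1..1}" if b: "b \<in> Basis - {k}" for b
      proof -
        have "\<bar>plane_point k \<tau> \<bullet> b\<bar> \<le> 1" using \<tau> b Basis_le_norm[of b "plane_point k \<tau>"] by auto
        then show ?thesis by (simp add: plane_point_inner[OF b] abs_le_iff)
      qed
      then show "\<tau> \<in> ?A" using \<tau> by (auto simp: space_PiM PiE_def)
    qed
  qed
  also have "\<dots> = (\<Prod>b\<in>Basis - {k}. emeasure lborel {-1..1::real})"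
    by (rule emeasure_PiM_lborel) auto
  also have "\<dots> < \<infinity>" by (simp add: ennreal_prod_eq_top less_top[symmetric] power_eq_top_ennreal)
  finally show ?thesis .
qed

definition sphere_fun :: "('a::euclidean_space \<Rightarrow> 'b::euclidean_space) \<Rightarrow> bool" where
  "sphere_fun F \<longleftrightarrow> F \<in> borel_measurable borel \<and> continuous_on (sphere 0 1) F"

lemma sphere_fun_add: "sphere_fun F \<Longrightarrow> sphere_fun G \<Longrightarrow> sphere_fun (\<lambda>z. F z + G z)"
  by (simp add: sphere_fun_def continuous_on_add borel_measurable_add)

lemma sphere_fun_scaleR: "sphere_fun q \<Longrightarrow> sphere_fun F \<Longrightarrow> sphere_fun (\<lambda>z. q z *\<^sub>R F z)"
  by (simp add: sphere_fun_def continuous_on_scaleR borel_measurable_scaleR)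

lemma sphere_fun_const: "sphere_fun (\<lambda>z. c)"
  by (simp add: sphere_fun_def)

lemma sphere_fun_continuous: "continuous_on UNIV F \<Longrightarrow> sphere_fun F"
  unfolding sphere_fun_def using continuous_on_subset borel_measurable_continuous_onI by blast

lemma sphere_fun_compose:
  assumes F: "sphere_fun F" and P: "linear P" "\<And>z. norm (P z) = norm z"
  shows "sphere_fun (\<lambda>z. F (P z))"
proof -
  have c: "continuous_on S P" for S using P(1) linear_continuous_on linear_conv_bounded_linear by blast
  have [measurable]: "P \<in> borel_measurable borel" by (intro borel_measurable_continuous_onI c)
  have [measurable]: "F \<in> borel_measurable borel" using F by (simp add: sphere_fun_def)
  have "continuous_on (sphere 0 1) (\<lambda>z. F (P z))"
    by (rule continuous_on_compose2[OF _ c]) (use F P(2) in \<open>auto simp: sphere_fun_def\<close>)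
  then show ?thesis by (simp add: sphere_fun_def)
qed

definition cap_integrand :: "'a::euclidean_space \<Rightarrow> ('a \<Rightarrow> 'b::euclidean_space) \<Rightarrow> 'a \<Rightarrow> 'b" where
  "cap_integrand k F t = indicator (hyperplane k) t *\<^sub>R
     (half_weight k (stereo k t) * (2 / (t \<bullet> t + 1)) ^ (DIM('a) - 1)) *\<^sub>R F (stereo k t)"

lemma cap_integral_eq: "cap_integral k F = (LINT t|hyperplane_lborel k. cap_integrand k F t)"
  by (simp add: cap_integral_def cap_integrand_def set_lebesgue_integral_def)

lemma hyperplane_sets [measurable]: "hyperplane k \<in> sets borel"
proof -
  have "closed (hyperplane k)" unfolding hyperplane_def by (intro closed_Collect_eq continuous_intros)
  then show ?thesis by (rule borel_closed)
qed

lemma cap_integrable: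
  fixes F :: "'a::euclidean_space \<Rightarrow> 'b::euclidean_space"
  assumes F: "sphere_fun F" and k: "k \<in> Basis"
  shows "integrable (hyperplane_lborel k) (cap_integrand k F)"
proof -
  have [measurable]: "F \<in> borel_measurable borel" using F by (simp add: sphere_fun_def)
  have [measurable]: "stereo k \<in> borel_measurable borel"
    by (intro borel_measurable_continuous_onI continuous_on_stereo)
  have [measurable]: "(\<lambda>t::'a. (2 / (t \<bullet> t + 1)) ^ (DIM('a) - 1)) \<in> borel_measurable borel"
    by measurable
  have m: "cap_integrand k F \<in> borel_measurable (hyperplane_lborel k)"
    unfolding cap_integrand_def[abs_def] by measurable
  have "bounded (F ` sphere 0 1)"
    using F by (intro compact_imp_bounded compact_continuous_image) (auto simp: sphere_fun_def)
  then obtain B where B: "0 < B" "\<And>z. norm z = 1 \<Longrightarrow> norm (F z) \<le> B"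
    by (auto simp: bounded_pos)
  show ?thesis
  proof (rule integrableI_bounded_set[OF _ m emeasure_hyperplane_cball])
    show "cball 0 1 \<in> sets (hyperplane_lborel k)" by simp
    show "AE t in hyperplane_lborel k. t \<in> cball 0 1 \<longrightarrow> norm (cap_integrand k F t) \<le> 2 ^ (DIM('a) - 1) * B"
    proof (intro AE_I2 impI)
      fix t :: 'a
      show "norm (cap_integrand k F t) \<le> 2 ^ (DIM('a) - 1) * B"
      proof (cases "t \<in> hyperplane k")
        case True
        have "1 \<le> t \<bullet> t + 1" using inner_ge_zero[of t] by linarith
        then have "0 \<le> 2 / (t \<bullet> t + 1)" "2 / (t \<bullet> t + 1) \<le> 2"
          using divide_left_mono[of 1 "t \<bullet> t + 1" 2] inner_self_add_1_pos[of t] by auto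
        then have "half_weight k (stereo k t) * (2 / (t \<bullet> t + 1)) ^ (DIM('a) - 1) \<le> 1 * 2 ^ (DIM('a) - 1)"
          by (intro mult_mono power_mono half_weight_le_1 half_weight_nonneg) auto
        moreover have "norm (F (stereo k t)) \<le> B"
          using True by (intro B(2) norm_stereo k) (simp add: hyperplane_def)
        moreover have "0 \<le> half_weight k (stereo k t) * (2 / (t \<bullet> t + 1)) ^ (DIM('a) - 1)"
          using half_weight_nonneg \<open>0 \<le> 2 / (t \<bullet> t + 1)\<close> by (intro mult_nonneg_nonneg zero_le_power)
        ultimately show ?thesis using True B(1)
          by (simp add: cap_integrand_def abs_mult) (intro mult_mono; simp)
      qed (use B in \<open>simp add: cap_integrand_def\<close>)
    qed
    show "AE t in hyperplane_lborel k. t \<notin> cball 0 1 \<longrightarrow> cap_integrand k F t = 0"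
      using half_weight_stereo_eq_0[OF k] by (intro AE_I2) (auto simp: cap_integrand_def indicator_def)
  qed
qed

lemma cap_integral_add:
  assumes "sphere_fun F" "sphere_fun G" "k \<in> Basis"
  shows "cap_integral k (\<lambda>z. F z + G z) = cap_integral k F + cap_integral k G"
proof -
  have "cap_integrand k (\<lambda>z. F z + G z) = (\<lambda>t. cap_integrand k F t + cap_integrand k G t)"
    by (simp add: cap_integrand_def scaleR_add_right fun_eq_iff)
  then show ?thesis
    unfolding cap_integral_eq using Bochner_Integration.integral_add[OF cap_integrable cap_integrable] assms by simp
qed

lemma cap_integral_scaleR: "cap_integral k (\<lambda>z. c *\<^sub>R F z) = c *\<^sub>R cap_integral k F"
proof -
  have "cap_integrand k (\<lambda>z. c *\<^sub>R F z) = (\<lambda>t. c *\<^sub>R cap_integrand k F t)"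
    by (simp add: cap_integrand_def fun_eq_iff)
  then show ?thesis unfolding cap_integral_eq by simp
qed

lemma cap_integral_scaleR_left:
  assumes "sphere_fun q" "k \<in> Basis"
  shows "cap_integral k (\<lambda>z. q z *\<^sub>R C) = cap_integral k q *\<^sub>R C"
proof -
  have "cap_integrand k (\<lambda>z. q z *\<^sub>R C) = (\<lambda>t. cap_integrand k q t *\<^sub>R C)"
    by (simp add: cap_integrand_def fun_eq_iff mult.assoc)
  then show ?thesis unfolding cap_integral_eq using integral_scaleR_left[of C] cap_integrable[OF assms] by simp
qed

lemma cap_integral_cong:
  assumes "\<And>z. norm z = 1 \<Longrightarrow> F z = G z" "k \<in> Basis"
  shows "cap_integral k F = cap_integral k G"
proof -
  have "cap_integrand k F = cap_integrand k G"
    using assms norm_stereo[of k] by (auto simp: cap_integrand_def indicator_def hyperplane_def fun_eq_iff)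
  then show ?thesis unfolding cap_integral_eq by (simp only:)
qed

lemma cap_integrand_nonneg:
  assumes "\<And>z. norm z = 1 \<Longrightarrow> 0 \<le> (q z :: real)" "k \<in> Basis"
  shows "0 \<le> cap_integrand k q t"
proof (cases "t \<in> hyperplane k")
  case True
  have "0 \<le> 2 / (t \<bullet> t + 1)" using inner_self_add_1_pos[of t] by simp
  then show ?thesis using True assms(1)[OF norm_stereo[OF assms(2), of t]]
    by (auto simp: cap_integrand_def hyperplane_def half_weight_nonneg intro!: mult_nonneg_nonneg)
qed (simp add: cap_integrand_def)

lemma cap_integral_nonneg:
  assumes "\<And>z. norm z = 1 \<Longrightarrow> 0 \<le> (q z :: real)" "k \<in> Basis"
  shows "0 \<le> cap_integral k q"
  unfolding cap_integral_eq using cap_integrand_nonneg[OF assms] by (intro integral_nonneg_AE) simp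

lemma cap_integral_pos:
  fixes q :: "'a::euclidean_space \<Rightarrow> real"
  assumes q: "sphere_fun q" and k: "k \<in> Basis" and nn: "\<And>z. norm z = 1 \<Longrightarrow> 0 \<le> q z"
    and z: "norm z = 1" "z \<bullet> k < 0" "0 < q z"
  shows "0 < cap_integral k q"
proof -
  obtain t0 where t0: "t0 \<in> hyperplane k" "stereo k t0 = z" using stereo_surj[OF k z(1)] z(2) by auto
  have c: "continuous_on (hyperplane k) (\<lambda>t. q (stereo k t))"
    by (rule continuous_on_compose2[OF _ continuous_on_stereo])
      (use q norm_stereo[OF k] in \<open>auto simp: sphere_fun_def hyperplane_def\<close>)
  obtain d1 where d1: "0 < d1" "\<And>t. t \<in> hyperplane k \<Longrightarrow> dist t t0 < d1 \<Longrightarrow> dist (q (stereo k t)) (q z) < q z"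
    using c t0 z(3) unfolding continuous_on_iff by metis
  have "continuous_on (hyperplane k) (\<lambda>t. stereo k t \<bullet> k)" by (intro continuous_intros continuous_on_stereo)
  then obtain d2 where d2: "0 < d2" "\<And>t. t \<in> hyperplane k \<Longrightarrow> dist t t0 < d2 \<Longrightarrow> dist (stereo k t \<bullet> k) (z \<bullet> k) < - (z \<bullet> k)"
    using t0 z(2) unfolding continuous_on_iff by (metis neg_0_less_iff_less)
  define \<delta> where "\<delta> = min d1 d2 / DIM('a)"
  have \<delta>: "0 < \<delta>" using d1 d2 by (simp add: \<delta>_def)
  let ?M = "\<Pi>\<^sub>M b\<in>Basis - {k}. lborel :: real measure"
  let ?A = "PiE (Basis - {k}) (\<lambda>b. {t0 \<bullet> b - \<delta> <..< t0 \<bullet> b + \<delta>})"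
  have pos: "cap_integrand k q (plane_point k \<tau>) \<noteq> 0" if \<tau>: "\<tau> \<in> ?A" for \<tau>
  proof -
    let ?t = "plane_point k \<tau>"
    have h: "?t \<in> hyperplane k" by (rule plane_point_in_hyperplane[OF k])
    have "norm (?t - t0) \<le> (\<Sum>b\<in>Basis. \<bar>(?t - t0) \<bullet> b\<bar>)" by (rule norm_le_l1)
    also have "\<dots> < (\<Sum>b\<in>(Basis :: 'a set). \<delta>)"
    proof (rule sum_strict_mono)
      fix b :: 'a assume b: "b \<in> Basis"
      show "\<bar>(?t - t0) \<bullet> b\<bar> < \<delta>"
      proof (cases "b = k")
        case True
        then show ?thesis using h t0 \<delta> by (simp add: hyperplane_def inner_diff_left)
      next
        case False
        then have b': "b \<in> Basis - {k}" using b by simp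
        then have "\<tau> b \<in> {t0 \<bullet> b - \<delta> <..< t0 \<bullet> b + \<delta>}" using \<tau> by (auto simp: PiE_def)
        then show ?thesis unfolding inner_diff_left plane_point_inner[OF b'] by (simp add: abs_less_iff)
      qed
    qed auto
    also have "\<dots> = min d1 d2" by (simp add: \<delta>_def)
    finally have "dist ?t t0 < d1" "dist ?t t0 < d2" by (auto simp: dist_norm)
    then have "0 < q (stereo k ?t)" "stereo k ?t \<bullet> k < 0"
      using d1(2)[OF h] d2(2)[OF h] by (auto simp: dist_real_def abs_less_iff)
    then show ?thesis using h inner_self_add_1_pos[of ?t] by (simp add: cap_integrand_def half_weight_def)
  qed
  have "cap_integral k q \<noteq> 0"
  proof
    assume "cap_integral k q = 0"
    then have "AE t in hyperplane_lborel k. cap_integrand k q t = 0"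
      unfolding cap_integral_eq
      using integral_nonneg_eq_0_iff_AE[OF cap_integrable[OF q k]] cap_integrand_nonneg[OF nn k] by auto
    then have "AE \<tau> in ?M. cap_integrand k q (plane_point k \<tau>) = 0"
      unfolding hyperplane_lborel_eq by (rule AE_distrD[OF plane_point_measurable])
    then obtain N where N: "N \<in> null_sets ?M" "{\<tau> \<in> space ?M. cap_integrand k q (plane_point k \<tau>) \<noteq> 0} \<subseteq> N"
      unfolding eventually_ae_filter by auto
    have "?A \<subseteq> N" using pos N(2) by (auto simp: space_PiM PiE_def)
    moreover have "?A \<in> sets ?M" by (intro sets_PiM_I_finite) auto
    ultimately have "emeasure ?M ?A = 0" using null_sets_subset[OF N(1)] by blast
    moreover have "emeasure ?M ?A = (\<Prod>b\<in>Basis - {k}. emeasure lborel {t0 \<bullet> b - \<delta> <..< t0 \<bullet> b + \<delta>})"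
      by (rule emeasure_PiM_lborel) auto
    ultimately show False using \<delta> by (simp add: prod_zero_iff)
  qed
  moreover have "0 \<le> cap_integral k q" by (rule cap_integral_nonneg) (use nn k in auto)
  ultimately show ?thesis by simp
qed

definition sphere_integral :: "'a::euclidean_space \<Rightarrow> ('a \<Rightarrow> 'b::euclidean_space) \<Rightarrow> 'b" where
  "sphere_integral k F = cap_integral k F + cap_integral k (\<lambda>z. F (refl_along k z))"

lemma norm_refl_along: "norm (refl_along u z) = norm z"
  by (simp add: norm_eq_sqrt_inner refl_along_inner)

lemma sphere_integral_add:
  assumes "sphere_fun F" "sphere_fun G" "k \<in> Basis"
  shows "sphere_integral k (\<lambda>z. F z + G z) = sphere_integral k F + sphere_integral k G"
  using cap_integral_add[OF assms]
    cap_integral_add[OF sphere_fun_compose[OF assms(1) linear_refl_along norm_refl_along]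
      sphere_fun_compose[OF assms(2) linear_refl_along norm_refl_along] assms(3)]
  by (simp add: sphere_integral_def)

lemma sphere_integral_scaleR: "sphere_integral k (\<lambda>z. c *\<^sub>R F z) = c *\<^sub>R sphere_integral k F"
  by (simp add: sphere_integral_def cap_integral_scaleR scaleR_add_right)

lemma sphere_integral_scaleR_left:
  assumes "sphere_fun q" "k \<in> Basis"
  shows "sphere_integral k (\<lambda>z. q z *\<^sub>R C) = sphere_integral k q *\<^sub>R C"
  using cap_integral_scaleR_left[OF assms, of C]
    cap_integral_scaleR_left[OF sphere_fun_compose[OF assms(1) linear_refl_along norm_refl_along] assms(2), of _ C]
  by (simp add: sphere_integral_def scaleR_add_left)

lemma sphere_integral_cong:
  assumes "\<And>z. norm z = 1 \<Longrightarrow> F z = G z" "k \<in> Basis"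
  shows "sphere_integral k F = sphere_integral k G"
  unfolding sphere_integral_def using assms
  by (intro arg_cong2[of _ _ _ _ "(+)"] cap_integral_cong) (auto simp: norm_refl_along)

lemma sphere_integral_pos:
  fixes q :: "'a::euclidean_space \<Rightarrow> real"
  assumes q: "sphere_fun q" and k: "k \<in> Basis" and nn: "\<And>z. norm z = 1 \<Longrightarrow> 0 \<le> q z"
    and z: "norm z = 1" "z \<bullet> k < 0" "0 < q z"
  shows "0 < sphere_integral k q"
  unfolding sphere_integral_def
  by (intro add_pos_nonneg cap_integral_pos[OF q k nn z] cap_integral_nonneg nn k) (auto simp: norm_refl_along)

section \<open>Admissibility forces a square root of the Laplacian\<close>

text \<open>
  The integrand in the Cauchy formula at the origin for the function 1, up to the factor \<open>norm y ^ d\<close>: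
  \<open>u\<close> is the point \<open>y\<close> and \<open>w\<close> the normal vector.
\<close>
definition kernel_form ::
  "nat \<Rightarrow> ('a::{real_algebra_1, euclidean_space} \<Rightarrow> nat \<Rightarrow> 'a) \<Rightarrow> ('a \<Rightarrow> nat \<Rightarrow> 'a) \<Rightarrow> 'a \<Rightarrow> 'a \<Rightarrow> 'a" where
  "kernel_form q a b u w =
     (\<Sum>i\<in>Basis. \<Sum>j\<in>Basis. ((u \<bullet> i) * (w \<bullet> j)) *\<^sub>R (\<Sum>m=1..q. a j m * b i m))"

lemma bilinear_kernel_form: "bilinear (kernel_form q a b)"
  unfolding bilinear_def
  by (intro conjI allI linearI)
    (simp_all add: kernel_form_def inner_add_left algebra_simps scaleR_add_left sum.distrib scaleR_sum_right)

lemma kernel_form_Basis: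
  assumes "i \<in> Basis" "j \<in> Basis"
  shows "kernel_form q a b i j = (\<Sum>m=1..q. a j m * b i m)"
proof -
  have delta: "(if P then 1 else 0 :: real) *\<^sub>R X = (if P then X else 0)" for P and X :: 'a by simp
  show ?thesis
    unfolding kernel_form_def scaleR_scaleR[symmetric] scaleR_sum_right[symmetric]
    using assms by (simp add: inner_Basis delta)
qed

lemma continuous_on_kernel_form:
  "continuous_on S f \<Longrightarrow> continuous_on S g \<Longrightarrow> continuous_on S (\<lambda>z. kernel_form q a b (f z) (g z))"
  unfolding kernel_form_def by (intro continuous_intros)

definition is_cauchy_kernel ::
  "nat \<Rightarrow> ('a::{real_algebra_1, euclidean_space} \<Rightarrow> nat \<Rightarrow> 'a) \<Rightarrow> ('a \<Rightarrow> nat \<Rightarrow> 'a) \<Rightarrow> bool" where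
  "is_cauchy_kernel q a b \<longleftrightarrow> (\<forall>G g. \<forall>x\<in>G.
        bounded_smooth_domain G \<and> C1_closure G g \<and> satisfies_cauchy_conditions q a G g \<longrightarrow>
        has_boundary_integral G
          (\<lambda>y j. g y * (\<Sum>m=1..q. a j m * (kernel_phi b m x y /\<^sub>R norm (y - x) ^ DIM('a))))
          (g x))"

text \<open>
  The Cauchy formula for the function 1 on the image of the unit ball under \<open>T\<close>, pulled back to the
  unit sphere.  Normal vectors transform by the inverse transpose \<open>Ts\<close> of \<open>T\<close>.
\<close>
lemma kernel_identity:
  fixes a b :: "'a::{real_algebra_1, euclidean_space} \<Rightarrow> nat \<Rightarrow> 'a"
  assumes adm: "is_cauchy_kernel q a b" and T: "linear T" and Ts: "linear Ts"
    and dual: "\<And>x y. T x \<bullet> Ts y = x \<bullet> y" and k: "k \<in> Basis"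
  shows "\<bar>basis_det T\<bar> *\<^sub>R sphere_integral k
    (\<lambda>z. (1 / norm (T z) ^ DIM('a)) *\<^sub>R kernel_form q a b (T z) (Ts z)) = 1"
proof -
  define T' where "T' = adjoint Ts"
  have T': "linear T'" unfolding T'_def by (rule adjoint_linear[OF Ts])
  have adj: "x \<bullet> T' y = Ts x \<bullet> y" for x y unfolding T'_def by (rule adjoint_works[OF Ts])
  have inv2: "T' (T x) = x" for x
  proof -
    have "y \<bullet> T' (T x) = y \<bullet> x" for y using adj[of y "T x"] dual[of x y] by (simp add: inner_commute)
    then show ?thesis using vector_eq_ldot by blast
  qed
  have "inj T" using inv2 by (metis injI)
  then have "surj T" using linear_injective_imp_surjective[OF T] by blast
  then have inv1: "T (T' x) = x" for x using inv2 by (metis surjD)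
  let ?\<eta> = "\<lambda>y j. 1 * (\<Sum>m=1..q. a j m * (kernel_phi b m 0 y /\<^sub>R norm (y - 0) ^ DIM('a)))"
  let ?E = "T ` ball 0 1"
  have p0: "partial (\<lambda>x::'a. 1::'a) j = (\<lambda>x. 0)" for j
    by (rule ext, rule partialI[OF has_derivative_const])
  have "C1_closure ?E (\<lambda>x. 1::'a)"
    unfolding C1_closure_def p0 using Ck_const[of 1 ?E "1::'a"]
    by (auto intro!: exI[of _ "\<lambda>x. 0"] simp del: Ck_on.simps)
  moreover have "satisfies_cauchy_conditions q a ?E (\<lambda>x. 1)"
    by (simp add: satisfies_cauchy_conditions_def p0)
  moreover have "bounded_smooth_domain ?E"
    by (rule ellipsoid_bounded_smooth_domain[OF T T' inv1 inv2])
  moreover have "0 \<in> ?E" using linear_0[OF T] by (intro image_eqI[of _ _ 0]) auto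
  ultimately have I: "has_boundary_integral ?E ?\<eta> 1"
    using adm unfolding is_cauchy_kernel_def by blast
  let ?F = "\<lambda>z. (1 / norm (T z) ^ DIM('a)) *\<^sub>R kernel_form q a b (T z) (Ts z)"
  have "?F z = (\<Sum>j\<in>Basis. (z \<bullet> T' j) *\<^sub>R ?\<eta> (T z) j)" for z
  proof -
    let ?n = "1 / norm (T z) ^ DIM('a)"
    have "(\<Sum>j\<in>Basis. (z \<bullet> T' j) *\<^sub>R ?\<eta> (T z) j) =
      (\<Sum>j\<in>Basis. \<Sum>m=1..q. \<Sum>i\<in>Basis. (?n * ((T z \<bullet> i) * (Ts z \<bullet> j))) *\<^sub>R (a j m * b i m))"
      unfolding adj kernel_phi_def
      by (intro sum.cong refl) (simp add: scaleR_sum_right sum_distrib_left divide_inverse mult_ac)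
    also have "\<dots> = (\<Sum>j\<in>Basis. \<Sum>i\<in>Basis. \<Sum>m=1..q. (?n * ((T z \<bullet> i) * (Ts z \<bullet> j))) *\<^sub>R (a j m * b i m))"
      by (rule sum.cong[OF refl], rule sum.swap)
    also have "\<dots> = (\<Sum>i\<in>Basis. \<Sum>j\<in>Basis. \<Sum>m=1..q. (?n * ((T z \<bullet> i) * (Ts z \<bullet> j))) *\<^sub>R (a j m * b i m))"
      by (rule sum.swap)
    also have "\<dots> = ?F z" by (simp only: kernel_form_def scaleR_sum_right scaleR_scaleR)
    finally show ?thesis by simp
  qed
  from boundary_integral_ellipsoid[OF T T' inv1 inv2 k I this] show ?thesis
    by (simp only: sphere_integral_def)
qed

definition orth_map :: "('a::euclidean_space \<Rightarrow> 'a) \<Rightarrow> bool" where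
  "orth_map P \<longleftrightarrow> linear P \<and> (\<forall>x y. P x \<bullet> P y = x \<bullet> y) \<and> \<bar>basis_det P\<bar> = 1"

lemma orth_map_id: "orth_map (\<lambda>z. z)"
  by (simp add: orth_map_def basis_det_id linear_id[unfolded id_def])

lemma orth_map_refl_compose: "orth_map P \<Longrightarrow> orth_map (\<lambda>z. refl_along u (P z))"
  using linear_compose[OF _ linear_refl_along, of P u] basis_det_compose[OF linear_refl_along, of u P]
  by (auto simp: orth_map_def refl_along_inner abs_mult basis_det_refl_along_abs o_def)

lemma orth_map_norm: "orth_map P \<Longrightarrow> norm (P z) = norm z"
  by (simp add: orth_map_def norm_eq_sqrt_inner)

definition stretch :: "'a::euclidean_space \<Rightarrow> real \<Rightarrow> 'a \<Rightarrow> 'a" where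
  "stretch f c z = z + (c * (z \<bullet> f)) *\<^sub>R f"

lemma linear_stretch: "linear (stretch f c)"
  by (rule linearI) (simp_all add: stretch_def inner_add_left algebra_simps)

lemma continuous_on_stretch: "continuous_on S (stretch f c)"
  unfolding stretch_def by (intro continuous_intros)

text \<open>
  Stretching by 2 along \<open>f\<close> is symmetric, so its inverse transpose is shrinking by 2.
\<close>
lemma stretch_dual: "norm f = 1 \<Longrightarrow> stretch f 1 x \<bullet> stretch f (- 1 / 2) y = x \<bullet> y"
  by (simp add: stretch_def inner_add_left inner_add_right dot_square_norm algebra_simps inner_commute)

lemma norm_stretch:
  assumes "norm f = 1" "norm z = 1"
  shows "norm (stretch f 1 z) = sqrt (1 + 3 * (z \<bullet> f)\<^sup>2)"
proof -
  have "stretch f 1 z \<bullet> stretch f 1 z = 1 + 3 * (z \<bullet> f)\<^sup>2"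
  proof -
    have "z \<bullet> z = 1" "f \<bullet> f = 1" using assms by (simp_all add: dot_square_norm)
    then show ?thesis
      by (simp add: stretch_def inner_add_left inner_add_right power2_eq_square inner_commute[of f z])
  qed
  then show ?thesis by (simp add: norm_eq_sqrt_inner)
qed

definition stretch_form where
  "stretch_form q a b f z = (1 / norm (stretch f 1 z) ^ DIM('a::{real_algebra_1, euclidean_space})) *\<^sub>R
     kernel_form q a b (stretch f 1 z) (stretch f (- 1 / 2) z :: 'a)"

lemma sphere_fun_stretch_form:
  assumes f: "norm f = 1"
  shows "sphere_fun (stretch_form q a b f)"
proof -
  have c: "continuous_on S (\<lambda>z. kernel_form q a b (stretch f 1 z) (stretch f (- 1 / 2) z))" for S
    by (intro continuous_on_kernel_form continuous_on_stretch)
  have n: "continuous_on S (\<lambda>z. norm (stretch f 1 z))" for S by (intro continuous_intros continuous_on_stretch)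
  have "norm (stretch f 1 z) \<noteq> 0" if "norm z = 1" for z
    unfolding norm_stretch[OF f that] using zero_le_power2[of "z \<bullet> f"] by (simp add: add_nonneg_eq_0_iff)
  then have "continuous_on (sphere 0 1) (stretch_form q a b f)"
    unfolding stretch_form_def by (intro continuous_intros c n) auto
  moreover have "stretch_form q a b f \<in> borel_measurable borel"
  proof -
    have [measurable]: "(\<lambda>z. norm (stretch f 1 z)) \<in> borel_measurable borel"
      by (intro borel_measurable_continuous_onI n)
    have [measurable]: "(\<lambda>z. kernel_form q a b (stretch f 1 z) (stretch f (- 1 / 2) z)) \<in> borel_measurable borel"
      by (intro borel_measurable_continuous_onI c)
    show ?thesis unfolding stretch_form_def by measurable
  qed
  ultimately show ?thesis by (simp add: sphere_fun_def)
qed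

lemma sphere_integral_stretch_form:
  assumes adm: "is_cauchy_kernel q a b" and f: "norm f = 1" and P: "orth_map P" and k: "k \<in> Basis"
  shows "\<bar>basis_det (stretch f 1)\<bar> *\<^sub>R sphere_integral k (\<lambda>z. stretch_form q a b f (P z)) = 1"
proof -
  have lP: "linear P" using P by (simp add: orth_map_def)
  have "\<bar>basis_det (\<lambda>z. stretch f 1 (P z))\<bar> *\<^sub>R sphere_integral k (\<lambda>z. stretch_form q a b f (P z)) = 1"
    unfolding stretch_form_def
    by (rule kernel_identity[OF adm _ _ _ k])
      (use linear_compose[OF lP linear_stretch] P in \<open>simp_all add: o_def stretch_dual[OF f, simplified] orth_map_def\<close>)
  then show ?thesis using P basis_det_compose[OF linear_stretch, of f 1 P] by (simp add: orth_map_def abs_mult)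
qed

lemma bilinear_sign_average:
  assumes M: "bilinear M"
  shows "M (x + y + w) (x' + y' + w) + M (- x + y + w) (- x' + y' + w) +
     M (x - y + w) (x' - y' + w) + M (- x - y + w) (- x' - y' + w) =
     4 *\<^sub>R (M x x' + M y y' + M w w)"
proof -
  have 4: "4 *\<^sub>R v = v + v + v + v" for v :: 'b using scaleR_left_distrib[of 2 2 v] by (simp add: scaleR_2)
  show ?thesis unfolding 4
    by (simp add: bilinear_ladd[OF M] bilinear_radd[OF M] bilinear_lneg[OF M] bilinear_rneg[OF M]
      bilinear_lsub[OF M] bilinear_rsub[OF M] algebra_simps)
qed

text \<open>
  Averaging over the reflections along \<open>f\<close> and \<open>f'\<close> removes all mixed terms.  In the remaining term
  along \<open>f\<close> the stretching of the point and the shrinking of the normal cancel, so that the stretching is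
  seen only in the denominator.
\<close>
lemma stretch_form_sign_average:
  fixes f f' z :: "'a::{real_algebra_1, euclidean_space}"
  assumes f: "norm f = 1" "norm f' = 1" "f \<bullet> f' = 0" and z: "norm z = 1"
  defines "\<alpha> \<equiv> z \<bullet> f" and "\<alpha>' \<equiv> z \<bullet> f'"
  defines "\<zeta> \<equiv> z - \<alpha> *\<^sub>R f - \<alpha>' *\<^sub>R f'"
  shows "stretch_form q a b f z + stretch_form q a b f (refl_along f z) +
    stretch_form q a b f (refl_along f' z) + stretch_form q a b f (refl_along f (refl_along f' z)) =
    (4 / sqrt (1 + 3 * \<alpha>\<^sup>2) ^ DIM('a)) *\<^sub>R
      (\<alpha>\<^sup>2 *\<^sub>R kernel_form q a b f f + \<alpha>'\<^sup>2 *\<^sub>R kernel_form q a b f' f' + kernel_form q a b \<zeta> \<zeta>)"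
proof -
  let ?M = "kernel_form q a b"
  note M = bilinear_kernel_form[of q a b]
  have ff: "f \<bullet> f = 1" "f' \<bullet> f' = 1" "f' \<bullet> f = 0" using f by (simp_all add: dot_square_norm inner_commute)
  have R: "refl_along f w = w - (2 * (w \<bullet> f)) *\<^sub>R f" "refl_along f' w = w - (2 * (w \<bullet> f')) *\<^sub>R f'" for w
    by (simp_all add: refl_along_def ff)
  let ?x = "(2 * \<alpha>) *\<^sub>R f" and ?x' = "(\<alpha> / 2) *\<^sub>R f" and ?y = "\<alpha>' *\<^sub>R f'"
  have half: "(\<alpha> / 2) *\<^sub>R f + (\<alpha> / 2) *\<^sub>R f = \<alpha> *\<^sub>R f" by (simp flip: scaleR_left_distrib)
  have S: "stretch f 1 z = ?x + ?y + \<zeta>" "stretch f (- 1 / 2) z = ?x' + ?y + \<zeta>"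
    "stretch f 1 (refl_along f z) = - ?x + ?y + \<zeta>" "stretch f (- 1 / 2) (refl_along f z) = - ?x' + ?y + \<zeta>"
    "stretch f 1 (refl_along f' z) = ?x - ?y + \<zeta>" "stretch f (- 1 / 2) (refl_along f' z) = ?x' - ?y + \<zeta>"
    "stretch f 1 (refl_along f (refl_along f' z)) = - ?x - ?y + \<zeta>"
    "stretch f (- 1 / 2) (refl_along f (refl_along f' z)) = - ?x' - ?y + \<zeta>"
    unfolding R stretch_def \<zeta>_def
    using half by (simp_all add: inner_diff_left ff \<alpha>_def[symmetric] \<alpha>'_def[symmetric] algebra_simps scaleR_2 flip: scaleR_scaleR)
  have n: "norm (stretch f 1 (refl_along f z)) = sqrt (1 + 3 * \<alpha>\<^sup>2)"
    "norm (stretch f 1 (refl_along f' z)) = sqrt (1 + 3 * \<alpha>\<^sup>2)"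
    "norm (stretch f 1 (refl_along f (refl_along f' z))) = sqrt (1 + 3 * \<alpha>\<^sup>2)"
    "norm (stretch f 1 z) = sqrt (1 + 3 * \<alpha>\<^sup>2)"
    using z by (simp_all add: norm_stretch[OF f(1)] norm_refl_along)
      (simp_all add: R inner_diff_left ff \<alpha>_def power2_eq_square)
  let ?n = "1 / sqrt (1 + 3 * \<alpha>\<^sup>2) ^ DIM('a)"
  have "stretch_form q a b f z + stretch_form q a b f (refl_along f z) +
    stretch_form q a b f (refl_along f' z) + stretch_form q a b f (refl_along f (refl_along f' z)) =
    ?n *\<^sub>R (?M (?x + ?y + \<zeta>) (?x' + ?y + \<zeta>) + ?M (- ?x + ?y + \<zeta>) (- ?x' + ?y + \<zeta>) +
      ?M (?x - ?y + \<zeta>) (?x' - ?y + \<zeta>) + ?M (- ?x - ?y + \<zeta>) (- ?x' - ?y + \<zeta>))"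
    unfolding stretch_form_def n unfolding S by (simp only: scaleR_add_right)
  also have "\<dots> = ?n *\<^sub>R (4 *\<^sub>R (?M ?x ?x' + ?M ?y ?y + ?M \<zeta> \<zeta>))"
    by (simp only: bilinear_sign_average[OF M])
  also have "?M ?x ?x' = \<alpha>\<^sup>2 *\<^sub>R ?M f f" by (simp add: bilinear_lmul[OF M] bilinear_rmul[OF M] power2_eq_square)
  also have "?M ?y ?y = \<alpha>'\<^sup>2 *\<^sub>R ?M f' f'" by (simp add: bilinear_lmul[OF M] bilinear_rmul[OF M] power2_eq_square)
  finally show ?thesis by simp
qed

text \<open>
  The integrals of \<open>stretch_form\<close> for \<open>f\<close> and for \<open>f'\<close> agree, also after composition with orthogonal
  maps.  After averaging over signs and interchanging \<open>f\<close> and \<open>f'\<close> their difference is the integral of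
  \<open>((z \<bullet> f)\<^sup>2 - (z \<bullet> f')\<^sup>2) * (1 / n (z \<bullet> f') - 1 / n (z \<bullet> f))\<close> times the difference of the two values of the form.
  Here \<open>n x = sqrt (1 + 3 * x\<^sup>2) ^ d\<close>; as \<open>n\<close> is increasing in the square of its argument, this function is nonnegative and not 0.
\<close>
lemma kernel_form_diag_eq:
  fixes f f' :: "'a::{real_algebra_1, euclidean_space}"
  assumes adm: "is_cauchy_kernel q a b" and f: "norm f = 1" "norm f' = 1" "f \<bullet> f' = 0"
    and k: "k \<in> Basis" "0 < f \<bullet> k"
  shows "kernel_form q a b f f = kernel_form q a b f' f'"
proof -
  let ?M = "kernel_form q a b"
  \<comment> \<open>This reflection interchanges \<open>f\<close> and \<open>f'\<close>.\<close>
  define W where "W = refl_along (f - f')"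
  have ff: "f \<bullet> f = 1" "f' \<bullet> f' = 1" "f' \<bullet> f = 0" using f by (simp_all add: dot_square_norm inner_commute)
  have f': "f' \<bullet> f = 0" by fact
  have u2: "(f - f') \<bullet> (f - f') = 2" by (simp add: inner_diff_left inner_diff_right ff f(3))
  have W: "W z = z - (z \<bullet> f - z \<bullet> f') *\<^sub>R (f - f')" for z
    unfolding W_def refl_along_def u2 by (simp add: inner_diff_right)
  have Wf: "W z \<bullet> f = z \<bullet> f'" "W z \<bullet> f' = z \<bullet> f" for z
    unfolding W by (simp_all add: inner_diff_left ff f(3))
  have nW: "norm (W z) = norm z" for z unfolding W_def by (rule norm_refl_along)
  define d where "d = \<bar>basis_det (stretch f 1)\<bar>"
  have det: "\<bar>basis_det (stretch f' 1)\<bar> = d"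
  proof -
    have "stretch f' 1 = (\<lambda>z. W (stretch f 1 (W z)))"
    proof
      fix z
      have "W (stretch f 1 (W z)) = W (W z) + (z \<bullet> f') *\<^sub>R W f"
        unfolding W_def using linear_add[OF linear_refl_along[of "f - f'"]]
          linear_scale[OF linear_refl_along[of "f - f'"]] Wf(1)[of z, unfolded W_def]
        by (simp add: stretch_def)
      also have "W f = f'" unfolding W by (simp add: ff f(3))
      finally show "stretch f' 1 z = W (stretch f 1 (W z))" by (simp add: stretch_def W_def)
    qed
    then have "basis_det (stretch f' 1) = basis_det W * basis_det (stretch f 1) * basis_det W"
      using basis_det_compose[OF linear_refl_along, of "f - f'" "\<lambda>z. stretch f 1 (W z)"]
        basis_det_compose[OF linear_stretch, of f 1 W] by (simp add: W_def)
    then show ?thesis by (simp add: d_def abs_mult W_def basis_det_refl_along_abs)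
  qed
  have SI: "d *\<^sub>R sphere_integral k (\<lambda>z. stretch_form q a b f (P z)) = 1"
    "d *\<^sub>R sphere_integral k (\<lambda>z. stretch_form q a b f' (P z)) = 1" if "orth_map P" for P
    using sphere_integral_stretch_form[OF adm f(1) that k(1)] sphere_integral_stretch_form[OF adm f(2) that k(1)]
    by (simp_all add: d_def[symmetric] det)
  define A where "A = (\<lambda>f f' z. stretch_form q a b f z + stretch_form q a b f (refl_along f z) +
    stretch_form q a b f (refl_along f' z) + stretch_form q a b f (refl_along f (refl_along f' z)))"
  have sfP: "sphere_fun (\<lambda>z. stretch_form q a b g (P z))" if "norm g = 1" "orth_map P" for g P
    by (rule sphere_fun_compose[OF sphere_fun_stretch_form[OF that(1)] _ orth_map_norm[OF that(2)]])
      (use that(2) in \<open>simp add: orth_map_def\<close>)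
  have sfA: "sphere_fun (\<lambda>z. A g g' (P z))" if "norm g = 1" "orth_map P" for g g' P
    unfolding A_def using that by (intro sphere_fun_add sfP orth_map_refl_compose)
  have intA: "d *\<^sub>R sphere_integral k (\<lambda>z. A g g' (P z)) = 4"
    if g: "norm g = 1" and P: "orth_map P" and SIg: "\<And>P. orth_map P \<Longrightarrow> d *\<^sub>R sphere_integral k (\<lambda>z. stretch_form q a b g (P z)) = 1"
    for g g' P
  proof -
    have "sphere_integral k (\<lambda>z. A g g' (P z)) = sphere_integral k (\<lambda>z. stretch_form q a b g (P z)) +
      sphere_integral k (\<lambda>z. stretch_form q a b g (refl_along g (P z))) +
      sphere_integral k (\<lambda>z. stretch_form q a b g (refl_along g' (P z))) +
      sphere_integral k (\<lambda>z. stretch_form q a b g (refl_along g (refl_along g' (P z))))"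
      unfolding A_def using g P k(1)
      by (simp add: sphere_integral_add sphere_fun_add sfP orth_map_refl_compose)
    then show ?thesis
      using SIg[OF P] SIg[OF orth_map_refl_compose[OF P]] SIg[OF orth_map_refl_compose[OF orth_map_refl_compose[OF P]]]
      by (simp add: scaleR_add_right)
  qed
  have oW: "orth_map W" using orth_map_refl_compose[OF orth_map_id, of "f - f'"] by (simp add: W_def[abs_def])
  let ?B = "\<lambda>z. (A f' f (W z) + (- 1) *\<^sub>R A f f' z) + (A f' f z + (- 1) *\<^sub>R A f f' (W z))"
  note sf = sfA[OF f(1) orth_map_id] sfA[OF f(1) oW] sfA[OF f(2) orth_map_id] sfA[OF f(2) oW]
  have "d *\<^sub>R sphere_integral k ?B = 0"
  proof -
    have "sphere_integral k ?B = (sphere_integral k (\<lambda>z. A f' f (W z)) + (- 1) *\<^sub>R sphere_integral k (\<lambda>z. A f f' z)) +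
      (sphere_integral k (\<lambda>z. A f' f z) + (- 1) *\<^sub>R sphere_integral k (\<lambda>z. A f f' (W z)))"
      by (subst sphere_integral_add sphere_integral_scaleR;
          (intro sphere_fun_add sphere_fun_scaleR[OF sphere_fun_const] sf k)?)+ (rule refl)
    then show ?thesis
      using intA[OF f(1) orth_map_id SI(1), of f'] intA[OF f(1) oW SI(1), of f']
        intA[OF f(2) orth_map_id SI(2), of f] intA[OF f(2) oW SI(2), of f]
      by (simp add: scaleR_add_right scaleR_diff_right)
  qed
  moreover have d: "d \<noteq> 0" using SI(1)[OF orth_map_id] by auto
  ultimately have B0: "sphere_integral k ?B = 0" by simp
  define n where "n = (\<lambda>x::real. sqrt (1 + 3 * x\<^sup>2) ^ DIM('a))"
  define \<phi> where "\<phi> = (\<lambda>z. ((z \<bullet> f)\<^sup>2 - (z \<bullet> f')\<^sup>2) * (1 / n (z \<bullet> f') - 1 / n (z \<bullet> f)))"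
  have npos: "0 < n x" for x
    unfolding n_def using zero_le_power2[of x] by (intro zero_less_power) (simp add: add_pos_nonneg)
  have Beq: "?B z = \<phi> z *\<^sub>R (4 *\<^sub>R (?M f f - ?M f' f'))" if z: "norm z = 1" for z
  proof -
    let ?\<zeta> = "z - (z \<bullet> f) *\<^sub>R f - (z \<bullet> f') *\<^sub>R f'"
    have A1: "A f f' z = (4 / n (z \<bullet> f)) *\<^sub>R ((z \<bullet> f)\<^sup>2 *\<^sub>R ?M f f + (z \<bullet> f')\<^sup>2 *\<^sub>R ?M f' f' + ?M ?\<zeta> ?\<zeta>)"
      unfolding A_def n_def by (rule stretch_form_sign_average[OF f z])
    have \<zeta>': "z - (z \<bullet> f') *\<^sub>R f' - (z \<bullet> f) *\<^sub>R f = ?\<zeta>" by simp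
    have A2: "A f' f z = (4 / n (z \<bullet> f')) *\<^sub>R ((z \<bullet> f')\<^sup>2 *\<^sub>R ?M f' f' + (z \<bullet> f)\<^sup>2 *\<^sub>R ?M f f + ?M ?\<zeta> ?\<zeta>)"
      unfolding A_def n_def using stretch_form_sign_average[OF f(2,1) f' z] unfolding \<zeta>' .
    have zW: "norm (W z) = 1" using z nW by simp
    have \<zeta>W: "W z - (z \<bullet> f') *\<^sub>R f - (z \<bullet> f) *\<^sub>R f' = ?\<zeta>" "W z - (z \<bullet> f) *\<^sub>R f' - (z \<bullet> f') *\<^sub>R f = ?\<zeta>"
      unfolding W by (simp_all add: algebra_simps)
    have A3: "A f f' (W z) = (4 / n (z \<bullet> f')) *\<^sub>R ((z \<bullet> f')\<^sup>2 *\<^sub>R ?M f f + (z \<bullet> f)\<^sup>2 *\<^sub>R ?M f' f' + ?M ?\<zeta> ?\<zeta>)"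
      unfolding A_def n_def using stretch_form_sign_average[OF f zW] unfolding Wf \<zeta>W .
    have A4: "A f' f (W z) = (4 / n (z \<bullet> f)) *\<^sub>R ((z \<bullet> f)\<^sup>2 *\<^sub>R ?M f' f' + (z \<bullet> f')\<^sup>2 *\<^sub>R ?M f f + ?M ?\<zeta> ?\<zeta>)"
      unfolding A_def n_def using stretch_form_sign_average[OF f(2,1) f' zW] unfolding Wf \<zeta>W .
    show ?thesis unfolding A1 A2 A3 A4 \<phi>_def by (simp add: algebra_simps)
  qed
  have sf\<phi>: "sphere_fun \<phi>"
  proof (rule sphere_fun_continuous)
    have nz: "n x \<noteq> 0" for x using npos[of x] by simp
    have "continuous_on UNIV n" unfolding n_def by (intro continuous_intros)
    then have "continuous_on UNIV (\<lambda>z. n (z \<bullet> g))" for g :: 'a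
      by (rule continuous_on_compose2) (auto intro!: continuous_intros)
    then show "continuous_on UNIV \<phi>" unfolding \<phi>_def by (intro continuous_intros) (auto simp: nz)
  qed
  have "sphere_integral k \<phi> *\<^sub>R (4 *\<^sub>R (?M f f - ?M f' f')) = 0"
    using sphere_integral_cong[OF Beq k(1)] B0 sphere_integral_scaleR_left[OF sf\<phi> k(1), of "4 *\<^sub>R (?M f f - ?M f' f')"] by simp
  moreover have "0 < sphere_integral k \<phi>"
  proof (rule sphere_integral_pos[OF sf\<phi> k(1)])
    have mono: "n x \<le> n y" if "x\<^sup>2 \<le> y\<^sup>2" for x y
      unfolding n_def using that by (intro power_mono) auto
    fix z :: 'a
    show "0 \<le> \<phi> z"
    proof (cases "(z \<bullet> f')\<^sup>2 \<le> (z \<bullet> f)\<^sup>2")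
      case True
      then show ?thesis unfolding \<phi>_def using mono[OF True] npos
        by (intro mult_nonneg_nonneg) (simp_all add: frac_le)
    next
      case False
      then have "(z \<bullet> f)\<^sup>2 \<le> (z \<bullet> f')\<^sup>2" by simp
      then show ?thesis unfolding \<phi>_def using mono npos
        by (intro mult_nonpos_nonpos) (simp_all add: frac_le)
    qed
  next
    show "norm (- f) = 1" "(- f) \<bullet> k < 0" using f k by auto
    have "1 < n 1" "n 0 = 1" unfolding n_def by (simp_all add: one_less_power)
    then show "0 < \<phi> (- f)" by (simp add: \<phi>_def ff f(3) n_def)
  qed
  ultimately show ?thesis by simp
qed

text \<open>
  Polarization along \<open>i + j\<close> and \<open>i - j\<close> shows that the form is antisymmetric off the diagonal, so its
  value at \<open>(z, z)\<close> is \<open>z \<bullet> z\<close> times a constant \<open>C\<close> of the algebra.  The Cauchy formula on the unit ball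
  says that the area of the sphere times \<open>C\<close> is 1, which makes \<open>C\<close> a real number and not just an
  element of the algebra.
\<close>
lemma admissible_dirac_pair:
  fixes a :: "'a::{real_algebra_1, euclidean_space} \<Rightarrow> nat \<Rightarrow> 'a"
  assumes "admissible_cauchy_conditions q a"
  obtains \<beta> where "dirac_pair q a \<beta>"
proof -
  obtain b where adm: "is_cauchy_kernel q a b"
    using assms unfolding admissible_cauchy_conditions_def is_cauchy_kernel_def by blast
  let ?M = "kernel_form q a b"
  note M = bilinear_kernel_form[of q a b]
  obtain k :: 'a where k: "k \<in> Basis" using nonempty_Basis by blast
  define C where "C = ?M k k"
  have diag: "?M i i = C" if "i \<in> Basis" for i
  proof (cases "i = k")
    case False
    then show ?thesis unfolding C_def
      using kernel_form_diag_eq[OF adm, of k i k] k that by (simp add: inner_not_same_Basis)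
  qed (simp add: C_def)
  have off: "?M i j + ?M j i = 0" if ij: "i \<in> Basis" "j \<in> Basis" "i \<noteq> j" for i j
  proof -
    let ?s = "1 / sqrt 2"
    have i0: "i \<bullet> j = 0" "j \<bullet> i = 0" using ij by (simp_all add: inner_not_same_Basis)
    have sq: "?s * ?s = 1 / 2" by simp
    have "?M (?s *\<^sub>R (i + j)) (?s *\<^sub>R (i + j)) = ?M (?s *\<^sub>R (i - j)) (?s *\<^sub>R (i - j))"
    proof (rule kernel_form_diag_eq[OF adm _ _ _ ij(1)])
      have "(i + j) \<bullet> (i + j) = 2" "(i - j) \<bullet> (i - j) = 2" "(i + j) \<bullet> (i - j) = 0"
        using ij i0 by (simp_all add: inner_add_left inner_add_right inner_diff_left inner_diff_right)
      then show "norm (?s *\<^sub>R (i + j)) = 1" "norm (?s *\<^sub>R (i - j)) = 1" "(?s *\<^sub>R (i + j)) \<bullet> (?s *\<^sub>R (i - j)) = 0"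
        by (simp_all add: norm_eq_sqrt_inner)
      show "0 < (?s *\<^sub>R (i + j)) \<bullet> i" using ij i0 by (simp add: inner_add_left)
    qed
    then have "?M (i + j) (i + j) = ?M (i - j) (i - j)"
      by (simp add: bilinear_lmul[OF M] bilinear_rmul[OF M] sq)
    then have "(?M i j + ?M j i) + (?M i j + ?M j i) = 0"
      by (simp add: bilinear_ladd[OF M] bilinear_radd[OF M] bilinear_lsub[OF M] bilinear_rsub[OF M] algebra_simps)
    then show ?thesis by (metis scaleR_2 scaleR_eq_0_iff zero_neq_numeral)
  qed
  have MC: "?M z z = (z \<bullet> z) *\<^sub>R C" for z
  proof -
    let ?N = "\<lambda>i j. ((z \<bullet> i) * (z \<bullet> j)) *\<^sub>R ?M i j"
    have "?M z z = ?M (\<Sum>i\<in>Basis. (z \<bullet> i) *\<^sub>R i) (\<Sum>j\<in>Basis. (z \<bullet> j) *\<^sub>R j)" by (simp add: euclidean_representation)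
    also have "\<dots> = (\<Sum>i\<in>Basis. \<Sum>j\<in>Basis. ?N i j)"
      by (simp add: bilinear_sum[OF M] sum.cartesian_product bilinear_lmul[OF M] bilinear_rmul[OF M] split_def mult.commute)
    finally have 1: "?M z z = (\<Sum>i\<in>Basis. \<Sum>j\<in>Basis. ?N i j)" .
    have "?M z z + ?M z z = (\<Sum>i\<in>Basis. \<Sum>j\<in>Basis. ?N i j) + (\<Sum>i\<in>Basis. \<Sum>j\<in>Basis. ?N j i)"
      using 1 sum.swap[of ?N Basis Basis] by simp
    also have "\<dots> = (\<Sum>i\<in>Basis. \<Sum>j\<in>Basis. ((z \<bullet> i) * (z \<bullet> j)) *\<^sub>R (?M i j + ?M j i))"
      by (simp add: sum.distrib[symmetric] scaleR_add_right mult.commute)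
    also have "\<dots> = (\<Sum>i\<in>Basis. \<Sum>j\<in>Basis. if j = i then ((z \<bullet> i) * (z \<bullet> i)) *\<^sub>R (C + C) else 0)"
      by (intro sum.cong refl) (auto simp: off diag)
    also have "\<dots> = (z \<bullet> z) *\<^sub>R (C + C)"
      by (simp add: scaleR_sum_left[symmetric] euclidean_inner[of z z])
    finally have "2 *\<^sub>R ?M z z = 2 *\<^sub>R ((z \<bullet> z) *\<^sub>R C)" by (simp only: scaleR_2 scaleR_add_right)
    then show ?thesis by (simp only: scaleR_cancel_left) simp
  qed
  define r where "r = sphere_integral k (\<lambda>z::'a. 1::real)"
  have "sphere_integral k (\<lambda>z. (1 / norm z ^ DIM('a)) *\<^sub>R ?M z z) = 1"
    using kernel_identity[OF adm linear_id linear_id _ k] by (simp add: basis_det_id id_def)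
  moreover have "sphere_integral k (\<lambda>z. (1 / norm z ^ DIM('a)) *\<^sub>R ?M z z) = sphere_integral k (\<lambda>z::'a. 1 *\<^sub>R C)"
    by (rule sphere_integral_cong[OF _ k]) (simp add: MC dot_square_norm)
  ultimately have rC: "r *\<^sub>R C = 1"
    using sphere_integral_scaleR_left[OF sphere_fun_const k, of "1::real" C] by (simp add: r_def)
  show thesis
  proof (rule that[of "\<lambda>i m. r *\<^sub>R b i m"])
    show "dirac_pair q a (\<lambda>i m. r *\<^sub>R b i m)"
      unfolding dirac_pair_def
    proof (intro ballI)
      fix i j :: 'a assume ij: "i \<in> Basis" "j \<in> Basis"
      have "(\<Sum>m=1..q. a i m * r *\<^sub>R b j m + a j m * r *\<^sub>R b i m) = r *\<^sub>R (?M j i + ?M i j)"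
        using ij by (simp add: kernel_form_Basis sum.distrib scaleR_add_right scaleR_sum_right)
      also have "\<dots> = (if i = j then 2 else 0)"
      proof (cases "i = j")
        case True
        then show ?thesis using ij diag[of i] rC by (simp add: scaleR_add_right)
      next
        case False
        then show ?thesis using ij off[of j i] by simp
      qed
      finally show "(\<Sum>m=1..q. a i m * r *\<^sub>R b j m + a j m * r *\<^sub>R b i m) = (if i = j then 2 else 0)" .
    qed
  qed
qed

section \<open>Hartogs extension\<close>

lemma cauchy_on_diff:
  fixes f g :: "'a::{real_algebra_1, euclidean_space} ^ 'n \<Rightarrow> 'a"
  assumes "open S" "cauchy_on q a S f" "cauchy_on q a S g"
  shows "cauchy_on q a S (\<lambda>x. f x - g x)"
  unfolding cauchy_on_def
proof (intro conjI ballI allI)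
  show "Ck_on 1 S (\<lambda>x. f x - g x)" by (intro Ck_diff cauchy_on_D(1)[OF assms(2)] cauchy_on_D(1)[OF assms(3)] assms(1))
  fix x l m assume x: "x \<in> S" and m: "m \<in> {1..q}"
  note fd = C1_differentiable[OF cauchy_on_D(1)[OF assms(2)] x] and gd = C1_differentiable[OF cauchy_on_D(1)[OF assms(3)] x]
  show "(\<Sum>j\<in>Basis. partial (\<lambda>x. f x - g x) (axis l j) x * a j m) = 0"
    unfolding partial_diff[OF fd gd]
    by (simp only: left_diff_distrib sum_subtractf cauchy_on_D(2)[OF assms(2) x m] cauchy_on_D(2)[OF assms(3) x m] diff_self)
qed

lemma Ck_cutoff:
  fixes \<rho> :: "'e::euclidean_space \<Rightarrow> real"
  assumes S: "open S" and \<rho>: "Ck_on k S \<rho>" and st: "s < t"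
  obtains \<theta> :: "'e \<Rightarrow> real" where "Ck_on k S \<theta>" "\<And>x. \<rho> x \<le> s \<Longrightarrow> \<theta> x = 0" "\<And>x. t \<le> \<rho> x \<Longrightarrow> \<theta> x = 1"
proof -
  let ?A = "\<lambda>x. pospow (Suc k) (\<rho> x - s)" and ?B = "\<lambda>x. pospow (Suc k) (t - \<rho> x)"
  let ?c = "\<lambda>x. ?A x *\<^sub>R inverse (?A x + ?B x)"
  have "?A x + ?B x \<noteq> 0" for x
  proof -
    have "0 < ?A x \<or> 0 < ?B x" using st by (auto simp: pospow_def)
    moreover have "0 \<le> ?A x" "0 \<le> ?B x" by (auto simp: pospow_def)
    ultimately show ?thesis by linarith
  qed
  then have "Ck_on k S ?c"
    by (intro Ck_scaleR Ck_inverse Ck_add Ck_pospow Ck_diff Ck_const S \<rho>)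
  moreover have "?c x = 0" if "\<rho> x \<le> s" for x using that by (simp add: pospow_def)
  moreover have "?c x = 1" if "t \<le> \<rho> x" for x
  proof -
    have B: "?B x = 0" using that by (simp add: pospow_def)
    have "?A x \<noteq> 0" using that st by (simp add: pospow_def)
    then show ?thesis unfolding B by simp
  qed
  ultimately show thesis by (rule that)
qed

lemma cauchy_hartogs:
  fixes f :: "'a::{real_algebra_1, euclidean_space} ^ 'n \<Rightarrow> 'a"
  assumes n: "2 \<le> CARD('n)" and dp: "dirac_pair q a \<beta>"
    and D: "open D" "D \<noteq> {}" "bounded D"
    and \<rho>: "smooth_on UNIV \<rho>" and D\<rho>: "D = {x. \<rho> x < 0}" and \<epsilon>: "\<epsilon> > 0"
    and conn: "connected (annulus \<rho> \<epsilon>)" and f: "cauchy_on q a (annulus \<rho> \<epsilon>) f"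
  shows "\<exists>F. cauchy_on q a (D \<union> annulus \<rho> \<epsilon>) F \<and> (\<forall>x\<in>annulus \<rho> \<epsilon>. F x = f x)"
proof -
  have \<rho>k: "Ck_on k UNIV \<rho>" for k using \<rho> by (simp add: smooth_on_def)
  have \<rho>c: "continuous_on UNIV \<rho>" using \<rho>k[of 0] by simp
  have o: "open {x. c < \<rho> x}" "open {x. \<rho> x < c}" for c
    by (intro open_Collect_less \<rho>c continuous_on_const)+
  define S where "S = annulus \<rho> \<epsilon>"
  define \<Omega> where "\<Omega> = D \<union> S"
  have S: "open S" unfolding S_def annulus_def using open_Int[OF o(1)[of "-\<epsilon>"] o(2)[of \<epsilon>]] by (simp add: Collect_conj_eq)
  have \<Omega>: "open \<Omega>" using S D by (auto simp: \<Omega>_def)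
  have \<Omega>\<rho>: "\<Omega> = {x. \<rho> x < \<epsilon>}" using \<epsilon> by (auto simp: \<Omega>_def S_def annulus_def D\<rho>)
  have fS: "cauchy_on q a S f" using f by (simp add: S_def)
  obtain \<theta> :: "'a ^ 'n \<Rightarrow> real" where \<theta>: "Ck_on 3 UNIV \<theta>" "\<And>x. \<rho> x \<le> - (\<epsilon> / 2) \<Longrightarrow> \<theta> x = 0" "\<And>x. - (\<epsilon> / 4) \<le> \<rho> x \<Longrightarrow> \<theta> x = 1"
    using Ck_cutoff[OF open_UNIV \<rho>k, of "- (\<epsilon> / 2)" "- (\<epsilon> / 4)" 3] \<epsilon> by auto
  define v where "v = (\<lambda>x. if x \<in> S then \<theta> x *\<^sub>R f x else 0)"
  \<comment> \<open>The conditions can fail for \<open>v\<close> only where the cutoff varies.\<close>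
  define Q where "Q = {x. - (\<epsilon> / 2) \<le> \<rho> x \<and> \<rho> x \<le> - (\<epsilon> / 4)}"
  have v0: "v x = 0" if "\<rho> x < - (\<epsilon> / 2)" for x using \<theta>(2)[of x] that by (simp add: v_def)
  have vf: "v x = f x" if "- (\<epsilon> / 4) < \<rho> x" "\<rho> x < \<epsilon>" for x
    using \<theta>(3)[of x] that \<epsilon> by (simp add: v_def S_def annulus_def)
  have v3: "Ck_on 3 \<Omega> v"
  proof -
    have "Ck_on 3 S (\<lambda>x. \<theta> x *\<^sub>R f x)"
      by (intro Ck_scaleR S Ck_subset[OF \<theta>(1)] cauchy_smooth[OF S dp fS]) simp
    then have "Ck_on 3 S v" by (rule Ck_cong[OF _ S]) (simp add: v_def)
    moreover have "Ck_on 3 {x. \<rho> x < - (\<epsilon> / 2)} v" by (rule Ck_cong[OF Ck_const[of 3 _ 0] o(2)]) (simp add: v0)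
    ultimately have "Ck_on 3 (S \<union> {x. \<rho> x < - (\<epsilon> / 2)}) v" by (rule Ck_Un[OF _ _ S o(2)])
    then show ?thesis by (rule Ck_subset) (use \<epsilon> in \<open>auto simp: \<Omega>\<rho> S_def annulus_def\<close>)
  qed
  have Q: "closed Q" "Q \<subseteq> D" "Q \<subseteq> \<Omega>" "bounded Q"
  proof -
    show "closed Q" unfolding Q_def
      by (intro closed_Collect_conj closed_Collect_le \<rho>c continuous_on_const)
    show 1: "Q \<subseteq> D" using \<epsilon> by (auto simp: Q_def D\<rho>)
    then show "Q \<subseteq> \<Omega>" "bounded Q" using D bounded_subset by (auto simp: \<Omega>_def)
  qed
  have v1: "Ck_on 1 \<Omega> v" by (rule Ck_le[OF v3]) simp
  have vQ: "(\<Sum>j\<in>Basis. partial v (axis l j) x * a j m) = 0" if x: "x \<in> \<Omega> - Q" and m: "m \<in> {1..q}" for x l m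
  proof (cases "\<rho> x < - (\<epsilon> / 2)")
    case True
    then have "partial v e x = 0" for e
      using partial_eq_0_on_open[OF o(2), of x _ v] v0 by simp
    then show ?thesis by simp
  next
    case False
    then have x': "- (\<epsilon> / 4) < \<rho> x" "\<rho> x < \<epsilon>" using x by (auto simp: Q_def \<Omega>\<rho>)
    have W: "open ({x. - (\<epsilon> / 4) < \<rho> x} \<inter> {x. \<rho> x < \<epsilon>})" using o by blast
    have "partial v e x = partial f e x" for e
      by (rule partial_transform[OF C1_differentiable[OF v1] W]) (use x x' vf in auto)
    moreover have "x \<in> S" using x' \<epsilon> by (simp add: S_def annulus_def)
    ultimately show ?thesis using cauchy_on_D(2)[OF fS _ m] by simp
  qed
  \<comment> \<open>Here the second variable enters: \<open>l0\<close> carries the convolution, \<open>l1\<close> the extreme point.\<close>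
  obtain l0 l1 :: 'n where l: "l0 \<noteq> l1"
  proof -
    have "\<not> (\<forall>x y :: 'n. x = y)"
    proof
      assume "\<forall>x y :: 'n. x = y"
      then have "(UNIV :: 'n set) \<subseteq> {undefined}" by auto
      then have "CARD('n) \<le> 1" using card_mono[of "{undefined}" "UNIV :: 'n set"] by simp
      then show False using n by simp
    qed
    then show thesis using that by blast
  qed
  obtain u where u1: "Ck_on 1 UNIV u"
    and uv: "\<And>x l m. x \<in> \<Omega> \<Longrightarrow> m \<in> {1..q} \<Longrightarrow>
      (\<Sum>j\<in>Basis. partial u (axis l j) x * a j m) = (\<Sum>j\<in>Basis. partial v (axis l j) x * a j m)"
    and u0: "\<And>x. (\<And>y. x + axis l0 y \<notin> Q) \<Longrightarrow> u x = 0"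
    using cauchy_solve[OF dp \<Omega> v3 Q(1,4,3) vQ, of l0] by blast
  define F where "F = (\<lambda>x. v x - u x)"
  have FC: "cauchy_on q a \<Omega> F"
    unfolding cauchy_on_def
  proof (intro conjI ballI allI)
    show "Ck_on 1 \<Omega> F" unfolding F_def by (intro Ck_diff \<Omega> v1 Ck_subset[OF u1]) simp
    fix x l m assume x: "x \<in> \<Omega>" and m: "m \<in> {1..q}"
    show "(\<Sum>j\<in>Basis. partial F (axis l j) x * a j m) = 0"
      unfolding F_def partial_diff[OF C1_differentiable[OF v1 x] C1_differentiable[OF u1 UNIV_I]]
      by (simp only: left_diff_distrib sum_subtractf uv[OF x m] diff_self)
  qed
  obtain j :: 'a where j: "j \<in> Basis" using nonempty_Basis by blast
  define ht where "ht = (\<lambda>x :: 'a ^ 'n. x \<bullet> axis l1 j)"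
  have "\<exists>p\<in>closure D. \<forall>x\<in>closure D. ht x \<le> ht p"
  proof (rule continuous_attains_sup)
    show "compact (closure D)" using D by (simp add: compact_closure)
    show "closure D \<noteq> {}" using D by simp
    show "continuous_on (closure D) ht" unfolding ht_def by (intro continuous_intros)
  qed
  then obtain p where p: "p \<in> closure D" "\<And>x. x \<in> D \<Longrightarrow> ht x \<le> ht p" using closure_subset by blast
  have htp: "ht (p + t *\<^sub>R axis l1 j) = ht p + t" for t
    using j by (simp add: ht_def inner_add_left inner_axis_axis)
  have shift: "\<exists>t>0. p + t *\<^sub>R axis l1 j \<in> T" if "open T" "p \<in> T" for T
  proof -
    obtain r where r: "0 < r" "ball p r \<subseteq> T" by (rule openE[OF \<open>open T\<close> \<open>p \<in> T\<close>])
    then have "p + (r/2) *\<^sub>R axis l1 j \<in> T" using j by (intro subsetD[OF r(2)]) (simp add: dist_norm)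
    then show ?thesis using r by (intro exI[of _ "r/2"]) simp
  qed
  \<comment> \<open>The extreme point lies on the boundary of \<open>D\<close>, hence in the annulus.\<close>
  have pS: "p \<in> S"
  proof -
    have "p \<notin> D"
    proof
      assume "p \<in> D"
      then obtain t where "t > 0" "p + t *\<^sub>R axis l1 j \<in> D" using shift[OF D(1)] by blast
      then show False using p(2)[of "p + t *\<^sub>R axis l1 j"] htp[of t] by simp
    qed
    moreover have "closure D \<subseteq> {x. \<rho> x \<le> 0}"
      by (intro closure_minimal closed_Collect_le \<rho>c continuous_on_const) (auto simp: D\<rho>)
    ultimately have "\<not> \<rho> p < 0" "\<rho> p \<le> 0" using p(1) unfolding D\<rho> by blast+
    then have "\<rho> p = 0" by simp
    then show ?thesis using \<epsilon> by (simp add: S_def annulus_def)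
  qed
  \<comment> \<open>Above the extreme point, the slices in the variable \<open>l0\<close> miss \<open>D\<close> and so the support \<open>Q\<close>.\<close>
  define W where "W = S \<inter> {x. ht p < ht x}"
  have oW: "open W" unfolding W_def ht_def
    by (intro open_Int S open_Collect_less continuous_intros)
  have neW: "W \<noteq> {}" using shift[OF S pS] htp by (auto simp: W_def)
  have W0: "f x - F x = 0" if x: "x \<in> W" for x
  proof -
    have "x \<notin> D" using x p(2)[of x] by (auto simp: W_def)
    then have "v x = f x" using x \<epsilon> by (intro vf) (auto simp: D\<rho> W_def S_def annulus_def)
    moreover have "u x = 0"
    proof (rule u0)
      fix y
      have "ht (x + axis l0 y) = ht x" using l by (simp add: ht_def inner_add_left inner_axis_axis)
      then show "x + axis l0 y \<notin> Q" using p(2)[of "x + axis l0 y"] x Q(2) by (auto simp: W_def)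
    qed
    ultimately show ?thesis by (simp add: F_def)
  qed
  have FS: "cauchy_on q a S F" using FC Ck_subset[of 1 \<Omega> F S] unfolding cauchy_on_def \<Omega>_def by blast
  have "f x - F x = 0" if "x \<in> S" for x
    by (rule cauchy_unique_continuation[OF S _ dp cauchy_on_diff[OF S fS FS] oW neW _ W0 that])
      (use conn in \<open>auto simp: S_def W_def\<close>)
  then show ?thesis using FC by (intro exI[of _ F]) (auto simp: \<Omega>_def S_def)
qed

theorem mainTheorem9:
  fixes q :: nat
    and a :: "'a::{real_algebra_1, euclidean_space} \<Rightarrow> nat \<Rightarrow> 'a"
    and D :: "('a ^ 'n) set"
    and \<rho> :: "'a ^ 'n \<Rightarrow> real"
    and \<epsilon> :: real
    and f :: "'a ^ 'n \<Rightarrow> 'a"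
  assumes "(1::'a) \<in> Basis"
    and "2 \<le> CARD('n)"
    and "admissible_cauchy_conditions q a"
    and "bounded_smooth_domain D"
    and "smooth_on UNIV \<rho>"
    and "D = {x. \<rho> x < 0}"
    and "\<epsilon> > 0"
    and "connected (annulus \<rho> \<epsilon>)"
    and "cauchy_on q a (annulus \<rho> \<epsilon>) f"
  shows "\<exists>F. cauchy_on q a (D \<union> annulus \<rho> \<epsilon>) F \<and> (\<forall>x\<in>annulus \<rho> \<epsilon>. F x = f x)"
proof -
  obtain \<beta> where "dirac_pair q a \<beta>" using admissible_dirac_pair[OF assms(3)] .
  moreover have "open D" "D \<noteq> {}" "bounded D" using assms(4) by (simp_all add: bounded_smooth_domain_def)
  ultimately show ?thesis using assms(2,5-9) by (intro cauchy_hartogs)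
qed

end
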